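(* Let $T>0$, let $k,m\in\mathbb{N}$, and let $(\Omega,\mathcal{F},\mathbb{P})$ be a fixed probability space. Let $X$ be a real separable Hilbert space. For each $n\in\mathbb{N}$, let $W_n$ be an $\mathbb{R}^k$-valued Wiener process on the filtered probability space $(\Omega,\mathcal{F},\{\mathcal{F}^n_t\}_{t\in[0,T]},\mathbb{P})$, and let $W$ be an $\mathbb{R}^k$-valued Wiener process on $(\Omega,\mathcal{F},\{\mathcal{F}_t\}_{t\in[0,T]},\mathbb{P})$. Suppose $p>2$. For each $n$, let $V_n$ be an $X^{m\times k}$-valued $\{\mathcal{F}^n_t\}$-predictable process, and let $V$ be an $X^{m\times k}$-valued $\{\mathcal{F}_t\}$-predictable process. Suppose $$V_n\rightharpoonup V\ \text{ weakly in } L^p([0,T];X^{m\times k}),\ \mathbb{P}\text{-almost surely},\qquad \sup_n\mathbb{E}\,\|V_n\|^p_{L^p([0,T];X^{m\times k})}<\infty,$$ $$W_n\to W\ \text{ in } C([0,T];\mathbb{R}^k),\ \mathbb{P}\text{-almost surely}.$$ Suppose that for a given $\beta\in X^*$, $$\mathbb{E}\int_h^T\big|\langle\beta,V_n\rangle_{X^*,X}(t)-\langle\beta,V_n\rangle_{X^*,X}(t-h)\big|\,\mathrm{d}t\longrightarrow0\quad\text{as } h\downarrow0,\ \text{uniformly in } n.$$ Then for every $t\in[0,T]$, $$\int_0^t\langle\beta,V_n\rangle_{X^*,X}\,\mathrm{d}W_n\longrightarrow\int_0^t\langle\beta,V\rangle_{X^*,X}\,\mathrm{d}W\quad\text{strongly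 in } L^2(\Omega;\mathbb{R}^m)\text{ as } n\to\infty.$$
   Context: $X^{m\times k}$ denotes $m\times k$ matrices with entries in $X$. The duality bracket $\langle\beta,\cdot\rangle_{X^*,X}$ is applied entrywise, so $\langle\beta,V_n\rangle_{X^*,X}$ is an $\mathbb{R}^{m\times k}$-valued process, and the stochastic integral is the $\mathbb{R}^m$-valued Itô integral. $|\cdot|$ is the Euclidean norm. *)

theory Defs
  imports "HOL-Probability.Probability"
begin

section \<open>Lebesgue--Bochner spaces\<close>

text \<open>Elements of \<open>L\<^sup>p\<close> are represented by measurable functions rather than by classes modulo
  null sets. Members of \<open>Lp_dual\<close> agree on a.e. equal functions, since they are linear and bounded
  with respect to the seminorm \<open>Lp_norm\<close>.\<close>

definition Lp :: "'a measure \<Rightarrow> real \<Rightarrow> ('a \<Rightarrow> 'b::real_normed_vector) set" where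
  "Lp \<mu> p = {f \<in> borel_measurable \<mu>. integrable \<mu> (\<lambda>x. norm (f x) powr p)}"

definition Lp_norm :: "'a measure \<Rightarrow> real \<Rightarrow> ('a \<Rightarrow> 'b::real_normed_vector) \<Rightarrow> real" where
  "Lp_norm \<mu> p f = (\<integral>x. norm (f x) powr p \<partial>\<mu>) powr (1 / p)"

definition Lp_strong_convergence ::
  "'a measure \<Rightarrow> real \<Rightarrow> (nat \<Rightarrow> 'a \<Rightarrow> 'b::real_normed_vector) \<Rightarrow> ('a \<Rightarrow> 'b) \<Rightarrow> bool" where
  "Lp_strong_convergence \<mu> p f g \<longleftrightarrow>
     (\<forall>n. f n \<in> Lp \<mu> p) \<and> g \<in> Lp \<mu> p \<and>
     (\<lambda>n. Lp_norm \<mu> p (\<lambda>x. f n x - g x)) \<longlonglongrightarrow> 0"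

definition Lp_dual :: "'a measure \<Rightarrow> real \<Rightarrow> (('a \<Rightarrow> 'b::real_normed_vector) \<Rightarrow> real) set" where
  "Lp_dual \<mu> p = {\<phi>.
     (\<forall>f\<in>Lp \<mu> p. \<forall>g\<in>Lp \<mu> p. \<phi> (\<lambda>x. f x + g x) = \<phi> f + \<phi> g) \<and>
     (\<forall>c. \<forall>f\<in>Lp \<mu> p. \<phi> (\<lambda>x. c *\<^sub>R f x) = c * \<phi> f) \<and>
     (\<exists>C. \<forall>f\<in>Lp \<mu> p. \<bar>\<phi> f\<bar> \<le> C * Lp_norm \<mu> p f)}"

definition Lp_weak_convergence ::
  "'a measure \<Rightarrow> real \<Rightarrow> (nat \<Rightarrow> 'a \<Rightarrow> 'b::real_normed_vector) \<Rightarrow> ('a \<Rightarrow> 'b) \<Rightarrow> bool" where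
  "Lp_weak_convergence \<mu> p f g \<longleftrightarrow>
     (\<forall>n. f n \<in> Lp \<mu> p) \<and> g \<in> Lp \<mu> p \<and>
     (\<forall>\<phi>\<in>Lp_dual \<mu> p. (\<lambda>n. \<phi> (f n)) \<longlonglongrightarrow> \<phi> g)"

abbreviation time_measure :: "real \<Rightarrow> real measure" where
  "time_measure T \<equiv> restrict_space lborel {0..T}"


section \<open>Filtrations, predictable processes and Wiener processes\<close>

text \<open>Filtrations are indexed by the time interval \<open>[0,T]\<close> only: the values of \<open>F\<close> and of all
  processes outside \<open>[0,T]\<close> are irrelevant. The usual conditions are not imposed.\<close>

definition filtration_on :: "'w measure \<Rightarrow> real \<Rightarrow> (real \<Rightarrow> 'w measure) \<Rightarrow> bool" where
  "filtration_on M T F \<longleftrightarrow>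
     (\<forall>t\<in>{0..T}. subalgebra M (F t)) \<and>
     (\<forall>s t. 0 \<le> s \<and> s \<le> t \<and> t \<le> T \<longrightarrow> sets (F s) \<subseteq> sets (F t))"

definition predictable_algebra ::
  "'w measure \<Rightarrow> real \<Rightarrow> (real \<Rightarrow> 'w measure) \<Rightarrow> (real \<times> 'w) measure" where
  "predictable_algebra M T F = sigma ({0..T} \<times> space M)
     ({{0} \<times> A | A. A \<in> sets (F 0)} \<union>
      {{s<..t} \<times> A | s t A. 0 \<le> s \<and> s \<le> t \<and> t \<le> T \<and> A \<in> sets (F s)})"

definition predictable_process ::
  "'w measure \<Rightarrow> real \<Rightarrow> (real \<Rightarrow> 'w measure) \<Rightarrow> (real \<Rightarrow> 'w \<Rightarrow> 'b::topological_space) \<Rightarrow> bool" where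
  "predictable_process M T F G \<longleftrightarrow>
     (\<lambda>(t, \<omega>). G t \<omega>) \<in> borel_measurable (predictable_algebra M T F)"

text \<open>The increment over \<open>[s,t]\<close> is independent of \<open>F s\<close> and has law \<open>N(0, (t - s) I)\<close>, whose
  density is the product of the one-dimensional ones.\<close>

definition wiener_process ::
  "'w measure \<Rightarrow> real \<Rightarrow> (real \<Rightarrow> 'w measure) \<Rightarrow> (real \<Rightarrow> 'w \<Rightarrow> real ^ 'k) \<Rightarrow> bool" where
  "wiener_process M T F W \<longleftrightarrow>
     (\<forall>t\<in>{0..T}. W t \<in> borel_measurable (F t)) \<and>
     (AE \<omega> in M. W 0 \<omega> = 0) \<and>
     (AE \<omega> in M. continuous_on {0..T} (\<lambda>t. W t \<omega>)) \<and>
     (\<forall>s t. 0 \<le> s \<and> s < t \<and> t \<le> T \<longrightarrow>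
        distributed M lborel (\<lambda>\<omega>. W t \<omega> - W s \<omega>)
          (\<lambda>x. ennreal (\<Prod>j\<in>UNIV. normal_density 0 (sqrt (t - s)) (x $ j))) \<and>
        prob_space.indep_set M (sets (F s))
          (sets (vimage_algebra (space M) (\<lambda>\<omega>. W t \<omega> - W s \<omega>) borel)))"


section \<open>The Ito integral\<close>

text \<open>A triple \<open>(N, \<tau>, \<xi>)\<close> encodes the elementary process \<open>\<Sum>i<N. \<xi>\<^sub>i 1\<^bsub>(\<tau>\<^sub>i, \<tau>\<^sub>i\<^sub>+\<^sub>1]\<^esub>\<close>, where
  \<open>\<xi>\<^sub>i\<close> is bounded and measurable with respect to \<open>F \<tau>\<^sub>i\<close>.\<close>

type_synonym ('w, 'b) elementary = "nat \<times> (nat \<Rightarrow> real) \<times> (nat \<Rightarrow> 'w \<Rightarrow> 'b)"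

fun elementary_on ::
  "'w measure \<Rightarrow> real \<Rightarrow> (real \<Rightarrow> 'w measure) \<Rightarrow> ('w, 'b::real_normed_vector) elementary \<Rightarrow> bool" where
  "elementary_on M T F (N, \<tau>, \<xi>) \<longleftrightarrow>
     0 \<le> \<tau> 0 \<and> \<tau> N \<le> T \<and> (\<forall>i<N. \<tau> i \<le> \<tau> (Suc i)) \<and>
     (\<forall>i<N. \<xi> i \<in> borel_measurable (F (\<tau> i)) \<and> bounded (\<xi> i ` space M))"

fun elementary_process :: "('w, 'b::real_normed_vector) elementary \<Rightarrow> real \<Rightarrow> 'w \<Rightarrow> 'b" where
  "elementary_process (N, \<tau>, \<xi>) t \<omega> = (\<Sum>i<N. indicator {\<tau> i<..\<tau> (Suc i)} t *\<^sub>R \<xi> i \<omega>)"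

fun elementary_integral ::
  "(real \<Rightarrow> 'w \<Rightarrow> real ^ 'k) \<Rightarrow> ('w, real ^ 'k ^ 'm) elementary \<Rightarrow> real \<Rightarrow> 'w \<Rightarrow> real ^ 'm" where
  "elementary_integral W (N, \<tau>, \<xi>) t \<omega> =
     (\<Sum>i<N. \<xi> i \<omega> *v (W (min t (\<tau> (Suc i))) \<omega> - W (min t (\<tau> i)) \<omega>))"

text \<open>The Ito integral over \<open>[0,t]\<close> is the \<open>L\<^sup>2(\<Omega>)\<close> limit of the integrals of elementary processes
  approximating \<open>G\<close> in \<open>L\<^sup>2([0,t] \<times> \<Omega>)\<close>. It is determined up to a null set, and \<open>ito_integral\<close>
  selects a version.\<close>

definition has_ito_integral ::
  "'w measure \<Rightarrow> real \<Rightarrow> (real \<Rightarrow> 'w measure) \<Rightarrow> (real \<Rightarrow> 'w \<Rightarrow> real ^ 'k) \<Rightarrow>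
   (real \<Rightarrow> 'w \<Rightarrow> real ^ 'k ^ 'm) \<Rightarrow> real \<Rightarrow> ('w \<Rightarrow> real ^ 'm) \<Rightarrow> bool" where
  "has_ito_integral M T F W G t I \<longleftrightarrow>
     predictable_process M T F G \<and>
     (\<exists>S. (\<forall>j. elementary_on M T F (S j)) \<and>
        Lp_strong_convergence (time_measure t \<Otimes>\<^sub>M M) 2
          (\<lambda>j (s, \<omega>). elementary_process (S j) s \<omega>) (\<lambda>(s, \<omega>). G s \<omega>) \<and>
        Lp_strong_convergence M 2 (\<lambda>j. elementary_integral W (S j) t) I)"

definition ito_integral ::
  "'w measure \<Rightarrow> real \<Rightarrow> (real \<Rightarrow> 'w measure) \<Rightarrow> (real \<Rightarrow> 'w \<Rightarrow> real ^ 'k) \<Rightarrow>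
   (real \<Rightarrow> 'w \<Rightarrow> real ^ 'k ^ 'm) \<Rightarrow> real \<Rightarrow> 'w \<Rightarrow> real ^ 'm" where
  "ito_integral M T F W G t = (SOME I. has_ito_integral M T F W G t I)"


section \<open>Entrywise duality bracket\<close>

definition bracket ::
  "('x::real_normed_vector \<Rightarrow>\<^sub>L real) \<Rightarrow> 'x ^ 'k ^ 'm \<Rightarrow> real ^ 'k ^ 'm" where
  "bracket \<beta> A = (\<chi> i j. blinfun_apply \<beta> (A $ i $ j))"

end

theory Submission
  imports Defs
begin

text \<open>Replace the integrands \<open>G\<^sub>n = \<langle>\<beta>, V\<^sub>n\<rangle>\<close> by step processes \<open>G\<^sub>n\<^sup>N\<close> whose value on a cell of the uniform
  partition into \<open>N\<close> cells is the average of \<open>G\<^sub>n\<close> over the preceding cell. Interpolating the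
  uniform \<open>L\<^sup>1\<close> bound on time translations with the \<open>L\<^sup>p\<close> bound gives a uniform \<open>L\<^sup>2\<close> modulus of
  translation, which the limit \<open>G = \<langle>\<beta>, V\<rangle>\<close> inherits by weak lower semicontinuity and Fatou's lemma. Hence
  \<open>G\<^sub>n\<^sup>N \<rightarrow> G\<^sub>n\<close> in \<open>L\<^sup>2([0,T] \<times> \<Omega>)\<close> as \<open>N \<rightarrow> \<infinity>\<close>, uniformly in \<open>n\<close>, and likewise for \<open>G\<close>; by the Ito isometry the
  stochastic integrals exist and are approximated uniformly in \<open>n\<close>. For fixed \<open>N\<close> the integral of
  \<open>G\<^sub>n\<^sup>N\<close> is a finite sum of averages times Wiener increments. The averages converge almost surely because
  they are weakly continuous functionals of \<open>V\<^sub>n\<close>, the increments converge by hypothesis, and the products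
  are bounded in \<open>L\<^sup>p\<close> with \<open>p > 2\<close>, so they converge in \<open>L\<^sup>2(\<Omega>)\<close>.\<close>

section \<open>Mean square convergence\<close>

text \<open>The Ito isometry compares integrands driven by one and the same Wiener process, whereas
  here integrators and filtrations change with n and the integrands converge only weakly. Step
  processes bridge this gap, because their integrals are pathwise expressions in finitely many
  averages and increments, for which almost sure convergence is enough. The average is taken over
  the preceding cell because one over the current cell would look into the future. The exponent p >
  2 enters through the inequality x^2 \<le> min(x,K)^2 + K^(2-p) x^p, which serves both the
  interpolation and the uniform integrability. Processes are extended by zero outside [0,T]; the
  price is a strip of width h at time 0, where the hypothesis on translations is silent and
  truncation at K costs K^2 h. Moments are bounded for V_n only; square integrability of the limit
  is read off from the translation estimate with the shift T + 1, which moves the translate off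
  [0,T] and leaves the plain norm.\<close>

lemma ennreal_tendsto_0_le:
  fixes f g :: "nat \<Rightarrow> ennreal"
  assumes "\<And>n. f n \<le> g n" "g \<longlonglongrightarrow> 0"
  shows "f \<longlonglongrightarrow> 0"
  using assms(1) by (intro tendsto_sandwich[OF _ _ tendsto_const assms(2)]) (auto intro: always_eventually)

text \<open>The squared norm is kept in [0,\<infinity>], so that estimates can be chained before
  finiteness is known.\<close>

definition L2sq :: "'a measure \<Rightarrow> ('a \<Rightarrow> 'b::real_normed_vector) \<Rightarrow> ennreal" where
  "L2sq M f = (\<integral>\<^sup>+x. ennreal ((norm (f x))\<^sup>2) \<partial>M)"

lemma norm_add_sq_le: "(norm (x + y))\<^sup>2 \<le> 2 * (norm x)\<^sup>2 + 2 * (norm y)\<^sup>2"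
proof -
  have "(norm (x + y))\<^sup>2 \<le> (norm x + norm y)\<^sup>2"
    by (intro power_mono norm_triangle_ineq) auto
  also have "\<dots> \<le> 2 * (norm x)\<^sup>2 + 2 * (norm y)\<^sup>2"
    using zero_le_power2[of "norm x - norm y"] by (simp add: power2_eq_square algebra_simps)
  finally show ?thesis .
qed

lemma L2sq_add_le:
  fixes f g :: "'a \<Rightarrow> 'b::{real_normed_vector, second_countable_topology}"
  assumes [measurable]: "f \<in> borel_measurable M" "g \<in> borel_measurable M"
  shows "L2sq M (\<lambda>x. f x + g x) \<le> 2 * L2sq M f + 2 * L2sq M g"
proof -
  have "L2sq M (\<lambda>x. f x + g x) \<le> (\<integral>\<^sup>+x. 2 * ennreal ((norm (f x))\<^sup>2) + 2 * ennreal ((norm (g x))\<^sup>2) \<partial>M)"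
    unfolding L2sq_def
  proof (intro nn_integral_mono)
    fix x
    have "ennreal ((norm (f x + g x))\<^sup>2) \<le> ennreal (2 * (norm (f x))\<^sup>2 + 2 * (norm (g x))\<^sup>2)"
      by (intro ennreal_leI norm_add_sq_le)
    then show "ennreal ((norm (f x + g x))\<^sup>2) \<le> 2 * ennreal ((norm (f x))\<^sup>2) + 2 * ennreal ((norm (g x))\<^sup>2)"
      by (simp add: ennreal_mult)
  qed
  then show ?thesis
    by (simp add: nn_integral_add nn_integral_cmult L2sq_def)
qed

lemma L2sq_minus_commute: "L2sq M (\<lambda>x. f x - g x) = L2sq M (\<lambda>x. g x - f x)"
  by (simp add: L2sq_def norm_minus_commute)

text \<open>The triangle inequality for squared norms; its factor 2 is the source of the quarters
  and of the factor 4 in the estimates around the Ito integral.\<close>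

lemma L2sq_diff_le:
  fixes f g h :: "'a \<Rightarrow> 'b::{real_normed_vector, second_countable_topology}"
  assumes [measurable]: "f \<in> borel_measurable M" "g \<in> borel_measurable M" "h \<in> borel_measurable M"
  shows "L2sq M (\<lambda>x. f x - g x) \<le> 2 * L2sq M (\<lambda>x. f x - h x) + 2 * L2sq M (\<lambda>x. h x - g x)"
  using L2sq_add_le[of "\<lambda>x. f x - h x" M "\<lambda>x. h x - g x"] by simp

text \<open>Cauchy-Schwarz against the constant sequence 1, which produces the factor
  \<open>card A\<close>.\<close>

lemma L2sq_sum_le:
  fixes f :: "'i \<Rightarrow> 'a \<Rightarrow> 'b::{real_normed_vector, second_countable_topology}"
  assumes "finite A" and "\<And>i. i \<in> A \<Longrightarrow> f i \<in> borel_measurable M"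
  shows "L2sq M (\<lambda>x. \<Sum>i\<in>A. f i x) \<le> of_nat (card A) * (\<Sum>i\<in>A. L2sq M (f i))"
proof -
  have "L2sq M (\<lambda>x. \<Sum>i\<in>A. f i x) \<le> (\<integral>\<^sup>+x. of_nat (card A) * (\<Sum>i\<in>A. ennreal ((norm (f i x))\<^sup>2)) \<partial>M)"
    unfolding L2sq_def
  proof (intro nn_integral_mono)
    fix x
    have "(norm (\<Sum>i\<in>A. f i x))\<^sup>2 \<le> (\<Sum>i\<in>A. 1 * norm (f i x))\<^sup>2"
      by (intro power_mono) (auto simp: norm_sum)
    also have "\<dots> \<le> (\<Sum>i\<in>A. 1\<^sup>2) * (\<Sum>i\<in>A. (norm (f i x))\<^sup>2)"
      by (rule Cauchy_Schwarz_ineq_sum)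
    also have "ennreal \<dots> = of_nat (card A) * (\<Sum>i\<in>A. ennreal ((norm (f i x))\<^sup>2))"
      by (simp add: ennreal_mult ennreal_of_nat_eq_real_of_nat sum_nonneg)
    finally show "ennreal ((norm (\<Sum>i\<in>A. f i x))\<^sup>2) \<le> of_nat (card A) * (\<Sum>i\<in>A. ennreal ((norm (f i x))\<^sup>2))"
      by (simp add: ennreal_leI)
  qed
  also have "\<dots> = of_nat (card A) * (\<Sum>i\<in>A. L2sq M (f i))"
    using assms by (subst nn_integral_cmult) (simp_all add: nn_integral_sum L2sq_def del: sum_ennreal)
  finally show ?thesis .
qed

lemma Lp_2_iff:
  fixes f :: "'a \<Rightarrow> 'b::{real_normed_vector, second_countable_topology}"
  shows "f \<in> Lp M 2 \<longleftrightarrow> f \<in> borel_measurable M \<and> L2sq M f < \<infinity>"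
  by (auto simp: Lp_def L2sq_def integrable_iff_bounded)

text \<open>Valid even for infinite norms: \<open>enn2real\<close> sends \<infinity> to 0, and 0 is
  also the Bochner integral of a nonintegrable function.\<close>

lemma Lp_norm_2_eq:
  fixes f :: "'a \<Rightarrow> 'b::{real_normed_vector, second_countable_topology}"
  assumes "f \<in> borel_measurable M"
  shows "Lp_norm M 2 f = sqrt (enn2real (L2sq M f))"
  using assms by (simp add: Lp_norm_def L2sq_def integral_eq_nn_integral powr_half_sqrt)

text \<open>Membership in \<open>Lp\<close> makes both norms finite, hence also that of the
  difference, so the default value 0 of the Bochner integral cannot fake convergence.\<close>

lemma Lp_strong_convergence_2_iff:
  fixes f :: "nat \<Rightarrow> 'a \<Rightarrow> 'b::{real_normed_vector, second_countable_topology}"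
  shows "Lp_strong_convergence M 2 f g \<longleftrightarrow>
    (\<forall>n. f n \<in> borel_measurable M \<and> L2sq M (f n) < \<infinity>) \<and> g \<in> borel_measurable M \<and> L2sq M g < \<infinity> \<and>
    (\<lambda>n. L2sq M (\<lambda>x. f n x - g x)) \<longlonglongrightarrow> 0"
proof -
  have "(\<lambda>n. Lp_norm M 2 (\<lambda>x. f n x - g x)) \<longlonglongrightarrow> 0 \<longleftrightarrow> (\<lambda>n. L2sq M (\<lambda>x. f n x - g x)) \<longlonglongrightarrow> 0"
    if f[measurable]: "\<And>n. f n \<in> borel_measurable M" "g \<in> borel_measurable M"
      and fin: "\<And>n. L2sq M (f n) < \<infinity>" "L2sq M g < \<infinity>"
  proof -
    have "L2sq M (\<lambda>x. f n x - g x) < \<infinity>" for n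
      using L2sq_diff_le[of "f n" M g "\<lambda>_. 0"] fin(1)[of n] fin(2)
      by (auto simp: L2sq_minus_commute[of M "\<lambda>_. 0", simplified] ennreal_mult_less_top less_top[symmetric] top_unique ennreal_mult_eq_top_iff)
    then have *: "ennreal ((Lp_norm M 2 (\<lambda>x. f n x - g x))\<^sup>2) = L2sq M (\<lambda>x. f n x - g x)" for n
      by (simp add: Lp_norm_2_eq)
    have "(\<lambda>n. Lp_norm M 2 (\<lambda>x. f n x - g x)) \<longlonglongrightarrow> 0 \<longleftrightarrow>
      (\<lambda>n. (Lp_norm M 2 (\<lambda>x. f n x - g x))\<^sup>2) \<longlonglongrightarrow> 0"
      using tendsto_power_zero[of _ sequentially 2] tendsto_null_power
      by (auto simp: tendsto_null_power)
    also have "\<dots> \<longleftrightarrow> (\<lambda>n. ennreal ((Lp_norm M 2 (\<lambda>x. f n x - g x))\<^sup>2)) \<longlonglongrightarrow> ennreal 0"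
      by (subst tendsto_ennreal_iff) auto
    finally show ?thesis by (simp add: *)
  qed
  then show ?thesis
    unfolding Lp_strong_convergence_def Lp_2_iff by blast
qed

lemma L2sq_Fatou:
  fixes f :: "nat \<Rightarrow> 'a \<Rightarrow> 'b::{real_normed_vector, second_countable_topology}"
  assumes [measurable]: "\<And>n. f n \<in> borel_measurable M"
    and lim: "AE x in M. (\<lambda>n. f n x) \<longlonglongrightarrow> g x"
    and bound: "\<forall>\<^sub>F n in sequentially. L2sq M (f n) \<le> c"
  shows "L2sq M g \<le> c"
proof -
  have "L2sq M g = (\<integral>\<^sup>+x. liminf (\<lambda>n. ennreal ((norm (f n x))\<^sup>2)) \<partial>M)"
    unfolding L2sq_def
  proof (intro nn_integral_cong_AE)
    show "AE x in M. ennreal ((norm (g x))\<^sup>2) = liminf (\<lambda>n. ennreal ((norm (f n x))\<^sup>2))"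
      using lim
    proof eventually_elim
      case (elim x)
      then have "(\<lambda>n. ennreal ((norm (f n x))\<^sup>2)) \<longlonglongrightarrow> ennreal ((norm (g x))\<^sup>2)"
        by (intro tendsto_intros)
      then show ?case
        by (intro lim_imp_Liminf[symmetric]) auto
    qed
  qed
  also have "\<dots> \<le> liminf (\<lambda>n. L2sq M (f n))"
    unfolding L2sq_def by (intro nn_integral_liminf) simp
  also have "\<dots> \<le> limsup (\<lambda>n. L2sq M (f n))"
    by (rule Liminf_le_Limsup) simp
  also have "\<dots> \<le> c"
    by (rule Limsup_bounded[OF bound])
  finally show ?thesis .
qed

text \<open>Completeness in the manner of Riesz and Fischer. A subsequence suffices for its use,
  since a subsequence of approximating elementary processes still approximates.\<close>

lemma L2sq_Cauchy_subseq_converges: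
  fixes f :: "nat \<Rightarrow> 'a \<Rightarrow> 'b::{banach, second_countable_topology}"
  assumes [measurable]: "\<And>n. f n \<in> borel_measurable M"
    and fin: "\<And>n. L2sq M (f n) < \<infinity>"
    and Cauchy: "\<And>e::real. e > 0 \<Longrightarrow> \<exists>N. \<forall>m\<ge>N. \<forall>n\<ge>N. L2sq M (\<lambda>x. f m x - f n x) \<le> ennreal e"
  obtains r g where "strict_mono (r::nat \<Rightarrow> nat)" "g \<in> borel_measurable M" "L2sq M g < \<infinity>"
    "(\<lambda>n. L2sq M (\<lambda>x. f (r n) x - g x)) \<longlonglongrightarrow> 0"
proof -
  obtain N where N: "\<And>k m n. m \<ge> N k \<Longrightarrow> n \<ge> N k \<Longrightarrow> L2sq M (\<lambda>x. f m x - f n x) \<le> ennreal ((1/4)^k)"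
  proof -
    have "\<forall>k. \<exists>N. \<forall>m\<ge>N. \<forall>n\<ge>N. L2sq M (\<lambda>x. f m x - f n x) \<le> ennreal ((1/4)^k)"
      using Cauchy by simp
    then show ?thesis using that by metis
  qed
  \<comment> \<open>The summand k makes \<open>r\<close> strictly increasing; the running maximum
    gives \<open>r k \<ge> N k\<close>.\<close>
  define r where "r k = k + Max (N ` {..k})" for k
  have r: "strict_mono r"
  proof (rule strict_mono_Suc_iff[THEN iffD2], intro allI)
    fix k
    have "Max (N ` {..k}) \<le> Max (N ` {..Suc k})"
      by (intro Max_mono) auto
    then show "r k < r (Suc k)" unfolding r_def by linarith
  qed
  have rN: "r k \<ge> N k" for k
    by (auto simp: r_def intro!: trans_le_add2 Max_ge)
  have rk: "L2sq M (\<lambda>x. f (r m) x - f (r n) x) \<le> ennreal ((1/4)^k)" if "m \<ge> k" "n \<ge> k" for k m n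
    using that rN[of k] strict_mono_mono[OF r] by (intro N) (meson monoD order_trans)+
  define d where "d k x = f (r (Suc k)) x - f (r k) x" for k x
  have [measurable]: "d k \<in> borel_measurable M" for k by (simp add: d_def[abs_def])
  have "(\<integral>\<^sup>+x. (\<Sum>k. ennreal (2^k * (norm (d k x))\<^sup>2)) \<partial>M) = (\<Sum>k. \<integral>\<^sup>+x. ennreal (2^k * (norm (d k x))\<^sup>2) \<partial>M)"
    by (intro nn_integral_suminf) simp
  \<comment> \<open>The weight 2^k spends part of the decay 4^(-k) and leaves a geometric series; in
    exchange, the weighted squares control the unsquared norms below.\<close>
  also have "\<dots> \<le> (\<Sum>k. ennreal ((1/2)^k))"
  proof (rule suminf_le)
    fix k
    have "(\<integral>\<^sup>+x. ennreal (2^k * (norm (d k x))\<^sup>2) \<partial>M) = ennreal (2^k) * L2sq M (d k)"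
      unfolding L2sq_def by (subst nn_integral_cmult[symmetric]) (auto simp: ennreal_mult)
    also have "\<dots> \<le> ennreal (2^k) * ennreal ((1/4)^k)"
      unfolding d_def by (intro mult_left_mono rk) auto
    also have "\<dots> = ennreal ((1/2)^k)"
      by (subst ennreal_mult[symmetric]) (auto simp: power_mult_distrib[symmetric])
    finally show "(\<integral>\<^sup>+x. ennreal (2^k * (norm (d k x))\<^sup>2) \<partial>M) \<le> ennreal ((1/2)^k)" .
  qed auto
  also have "\<dots> < \<infinity>"
    by (subst suminf_ennreal2) (auto simp: summable_geometric)
  finally have "AE x in M. (\<Sum>k. ennreal (2^k * (norm (d k x))\<^sup>2)) \<noteq> \<infinity>"
    by (intro nn_integral_noteq_infinite) auto
  then have conv: "AE x in M. convergent (\<lambda>k. f (r k) x)"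
  proof eventually_elim
    case (elim x)
    then have 1: "summable (\<lambda>k. 2^k * (norm (d k x))\<^sup>2)"
      by (intro summable_suminf_not_top) auto
    have "summable (\<lambda>k. norm (d k x))"
    proof (rule summable_comparison_test')
      show "summable (\<lambda>k. 2^k * (norm (d k x))\<^sup>2 + (1/2)^k)"
        by (intro summable_add 1 summable_geometric) auto
      fix k
      \<comment> \<open>The norm is split as a product a b with b^2 = 2^(-k), so that a b \<le> a^2
        + b^2 has a summable right side.\<close>
      define a where "a = sqrt (2^k) * norm (d k x)"
      define b where "b = sqrt ((1/2)^k)"
      have nd: "norm (d k x) = a * b"
        by (simp add: a_def b_def real_sqrt_mult[symmetric] power_mult_distrib[symmetric])
      have sq: "a\<^sup>2 = 2^k * (norm (d k x))\<^sup>2" "b\<^sup>2 = (1/2)^k"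
        by (auto simp: a_def b_def power_mult_distrib)
      have "0 \<le> a * b"
        by (simp add: a_def b_def)
      then have "a * b \<le> a\<^sup>2 + b\<^sup>2"
        using zero_le_power2[of "a - b"] by (simp add: power2_eq_square algebra_simps)
      then show "norm (norm (d k x)) \<le> 2^k * (norm (d k x))\<^sup>2 + (1/2)^k"
        unfolding real_norm_def abs_norm_cancel sq[symmetric] by (simp only: nd)
    qed
    then have "summable (\<lambda>k. d k x)" by (rule summable_norm_cancel)
    then have "convergent (\<lambda>n. \<Sum>k<n. d k x)"
      by (simp add: summable_iff_convergent)
    then have "convergent (\<lambda>n. f (r n) x - f (r 0) x)"
      by (simp add: d_def sum_lessThan_telescope[of "\<lambda>k. f (r k) x"])
    then show ?case
      using convergent_add[OF _ convergent_const[of "f (r 0) x"], of "\<lambda>n. f (r n) x - f (r 0) x"] by simp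
  qed
  define g where "g x = lim (\<lambda>k. f (r k) x)" for x
  have g[measurable]: "g \<in> borel_measurable M"
    unfolding g_def[abs_def] by (rule borel_measurable_lim_metric) simp
  have lim: "AE x in M. (\<lambda>k. f (r k) x) \<longlonglongrightarrow> g x"
    using conv unfolding g_def convergent_LIMSEQ_iff .
  \<comment> \<open>Fatou in the second index turns the Cauchy estimate into one for the distance to
    the limit.\<close>
  have le: "L2sq M (\<lambda>x. f (r k) x - g x) \<le> ennreal ((1/4)^k)" for k
  proof (rule L2sq_Fatou[where f="\<lambda>l x. f (r k) x - f (r l) x"])
    show "AE x in M. (\<lambda>l. f (r k) x - f (r l) x) \<longlonglongrightarrow> f (r k) x - g x"
      using lim by eventually_elim (rule tendsto_diff[OF tendsto_const])
    show "\<forall>\<^sub>F n in sequentially. L2sq M (\<lambda>x. f (r k) x - f (r n) x) \<le> ennreal ((1/4)^k)"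
      using eventually_ge_at_top[of k] by eventually_elim (simp add: rk)
  qed simp
  show thesis
  proof (rule that[OF r g])
    have "L2sq M g \<le> 2 * L2sq M (\<lambda>x. g x - f (r 0) x) + 2 * L2sq M (f (r 0))"
      using L2sq_diff_le[of g M "\<lambda>_. 0" "f (r 0)"] by simp
    also have "\<dots> \<le> 2 * ennreal 1 + 2 * L2sq M (f (r 0))"
      using le[of 0] by (subst L2sq_minus_commute) (intro add_mono mult_left_mono, simp_all)
    also have "\<dots> < \<infinity>" using fin[of "r 0"] by (simp add: ennreal_mult_less_top)
    finally show "L2sq M g < \<infinity>" .
    have "(\<lambda>k. ennreal ((1/4)^k)) \<longlonglongrightarrow> ennreal 0"
      by (rule tendsto_ennrealI, rule LIMSEQ_power_zero) simp
    then show "(\<lambda>n. L2sq M (\<lambda>x. f (r n) x - g x)) \<longlonglongrightarrow> 0"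
      by (intro ennreal_tendsto_0_le[OF le]) simp
  qed
qed


section \<open>Interpolation between moments and uniform integrability\<close>

lemma power2_le_min_plus_powr:
  fixes x K p :: real
  assumes "0 \<le> x" "0 < K" "2 < p"
  shows "x\<^sup>2 \<le> (min x K)\<^sup>2 + K powr (2 - p) * x powr p"
proof (cases "x \<le> K")
  case False
  \<comment> \<open>Above K the power x^(2-p) is at most K^(2-p), because its exponent is negative;
    this is where p > 2 is used.\<close>
  have "x\<^sup>2 = x powr (2 - p) * x powr p"
    using False assms by (simp add: powr_add[symmetric])
  also have "\<dots> \<le> K powr (2 - p) * x powr p"
    using False assms by (intro mult_right_mono powr_mono2') auto
  finally show ?thesis
    by (rule order_trans) simp
qed (use assms in \<open>simp add: min_def\<close>)

text \<open>Here the truncated part is weakened further by min(x,K)^2 \<le> K x, which brings in the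
  first power.\<close>

lemma power2_le_interpolation:
  fixes x K p :: real
  assumes "0 \<le> x" "0 < K" "2 < p"
  shows "x\<^sup>2 \<le> K * x + K powr (2 - p) * x powr p"
proof -
  have "(min x K)\<^sup>2 \<le> K * x"
    unfolding power2_eq_square using assms by (subst mult.commute) (intro mult_mono, auto)
  then show ?thesis
    using power2_le_min_plus_powr[OF assms] by linarith
qed

lemma powr_add_le:
  fixes x y p :: real
  assumes "0 \<le> x" "0 \<le> y" "0 \<le> p"
  shows "(x + y) powr p \<le> 2 powr p * (x powr p + y powr p)"
proof -
  have "(x + y) powr p \<le> (2 * max x y) powr p"
    using assms by (intro powr_mono2) auto
  also have "\<dots> = 2 powr p * max x y powr p"
    using assms by (simp add: powr_mult)
  also have "\<dots> \<le> 2 powr p * (x powr p + y powr p)"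
    by (intro mult_left_mono) (auto simp: max_def)
  finally show ?thesis .
qed

lemma powr_neg_tendsto_0:
  fixes q B :: real
  assumes "q < 0" "0 < e"
  shows "\<exists>K>0. B * K powr q < e"
proof -
  have "((\<lambda>K. B * K powr q) \<longlongrightarrow> B * 0) at_top"
    by (intro tendsto_intros tendsto_neg_powr filterlim_ident) fact
  then have "\<forall>\<^sub>F K in at_top. B * K powr q < e"
    using assms by (intro order_tendstoD(2)[where a=e]) auto
  then have "\<forall>\<^sub>F K in at_top. B * K powr q < e \<and> 0 < K"
    by (intro eventually_conj eventually_gt_at_top)
  then show ?thesis
    using eventually_happens[of _ "at_top::real filter"] by (auto simp: conj_commute)
qed

lemma nn_integral_Fatou_le:
  fixes f :: "nat \<Rightarrow> 'a \<Rightarrow> ennreal"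
  assumes [measurable]: "\<And>n. f n \<in> borel_measurable M"
    and le: "AE x in M. g x \<le> liminf (\<lambda>n. f n x)"
    and bound: "\<And>n. (\<integral>\<^sup>+x. f n x \<partial>M) \<le> c"
  shows "(\<integral>\<^sup>+x. g x \<partial>M) \<le> c"
proof -
  have "(\<integral>\<^sup>+x. g x \<partial>M) \<le> (\<integral>\<^sup>+x. liminf (\<lambda>n. f n x) \<partial>M)"
    by (intro nn_integral_mono_AE le)
  also have "\<dots> \<le> liminf (\<lambda>n. \<integral>\<^sup>+x. f n x \<partial>M)"
    by (intro nn_integral_liminf) simp
  also have "\<dots> \<le> limsup (\<lambda>n. \<integral>\<^sup>+x. f n x \<partial>M)"
    by (rule Liminf_le_Limsup) simp
  also have "\<dots> \<le> c"
    using bound by (intro Limsup_bounded always_eventually) auto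
  finally show ?thesis .
qed

lemma ennreal_le_mult_add:
  assumes "a \<le> b * (x + y)" "0 \<le> b" "0 \<le> x" "0 \<le> y"
  shows "ennreal a \<le> ennreal b * (ennreal x + ennreal y)"
proof -
  have "ennreal a \<le> ennreal (b * (x + y))" by (rule ennreal_leI) fact
  also have "\<dots> = ennreal b * (ennreal x + ennreal y)"
    using assms by (simp add: ennreal_mult)
  finally show ?thesis .
qed

lemma ennreal_le_add_mult:
  assumes "a \<le> x + b * y" "0 \<le> b" "0 \<le> x" "0 \<le> y"
  shows "ennreal a \<le> ennreal x + ennreal b * ennreal y"
proof -
  have "ennreal a \<le> ennreal (x + b * y)" by (rule ennreal_leI) fact
  also have "\<dots> = ennreal x + ennreal b * ennreal y"
    using assms by (simp add: ennreal_mult)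
  finally show ?thesis .
qed

lemma nn_integral_cmult_add:
  assumes "f \<in> borel_measurable M" "g \<in> borel_measurable M"
  shows "(\<integral>\<^sup>+x. c * (f x + g x) \<partial>M) = c * ((\<integral>\<^sup>+x. f x \<partial>M) + (\<integral>\<^sup>+x. g x \<partial>M))"
  using assms by (simp add: nn_integral_cmult nn_integral_add)

text \<open>Vitali: the \<open>p\<close>-bound makes the squares uniformly integrable.\<close>

lemma (in finite_measure) L2sq_tendsto_0_if_powr_bounded:
  fixes X :: "nat \<Rightarrow> 'a \<Rightarrow> real"
  assumes [measurable]: "\<And>n. X n \<in> borel_measurable M" "Y \<in> borel_measurable M"
    and lim: "AE x in M. (\<lambda>n. X n x) \<longlonglongrightarrow> Y x"
    and p: "p > 2" and bound: "\<And>n. (\<integral>\<^sup>+x. ennreal (\<bar>X n x\<bar> powr p) \<partial>M) \<le> ennreal C"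
  shows "(\<lambda>n. L2sq M (\<lambda>x. X n x - Y x)) \<longlonglongrightarrow> 0"
proof -
  define D where "D n x = \<bar>X n x - Y x\<bar>" for n x
  have [measurable]: "D n \<in> borel_measurable M" for n by (simp add: D_def[abs_def])
  \<comment> \<open>The sign of C is left open, and \<open>ennreal C\<close> is 0 for negative C,
    hence the maximum.\<close>
  define C' where "C' = 2 powr p * (2 * max 0 C)"
  have Y: "(\<integral>\<^sup>+x. ennreal (\<bar>Y x\<bar> powr p) \<partial>M) \<le> ennreal C"
  proof (rule nn_integral_Fatou_le[where f="\<lambda>n x. ennreal (\<bar>X n x\<bar> powr p)"])
    show "AE x in M. ennreal (\<bar>Y x\<bar> powr p) \<le> liminf (\<lambda>n. ennreal (\<bar>X n x\<bar> powr p))"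
      using lim
    proof eventually_elim
      case (elim x)
      have "(\<lambda>n. ennreal (\<bar>X n x\<bar> powr p)) \<longlonglongrightarrow> ennreal (\<bar>Y x\<bar> powr p)"
        using p by (intro tendsto_ennrealI tendsto_powr'[OF tendsto_rabs[OF elim] tendsto_const]) auto
      from lim_imp_Liminf[OF sequentially_bot this] show ?case
        by simp
    qed
  qed (use bound in auto)
  have D: "(\<integral>\<^sup>+x. ennreal (D n x powr p) \<partial>M) \<le> ennreal C'" for n
  proof -
    have s1: "(\<integral>\<^sup>+x. ennreal (D n x powr p) \<partial>M) \<le>
        (\<integral>\<^sup>+x. ennreal (2 powr p) * (ennreal (\<bar>X n x\<bar> powr p) + ennreal (\<bar>Y x\<bar> powr p)) \<partial>M)"
    proof (intro nn_integral_mono)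
      fix x
      have "D n x powr p \<le> (\<bar>X n x\<bar> + \<bar>Y x\<bar>) powr p"
        using p by (intro powr_mono2) (auto simp: D_def)
      also have "\<dots> \<le> 2 powr p * (\<bar>X n x\<bar> powr p + \<bar>Y x\<bar> powr p)"
        using p by (intro powr_add_le) auto
      finally show "ennreal (D n x powr p) \<le> ennreal (2 powr p) * (ennreal (\<bar>X n x\<bar> powr p) + ennreal (\<bar>Y x\<bar> powr p))"
        by (intro ennreal_le_mult_add) auto
    qed
    have s2: "(\<integral>\<^sup>+x. ennreal (2 powr p) * (ennreal (\<bar>X n x\<bar> powr p) + ennreal (\<bar>Y x\<bar> powr p)) \<partial>M) =
        ennreal (2 powr p) * ((\<integral>\<^sup>+x. ennreal (\<bar>X n x\<bar> powr p) \<partial>M) + (\<integral>\<^sup>+x. ennreal (\<bar>Y x\<bar> powr p) \<partial>M))"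
      by (rule nn_integral_cmult_add) measurable
    have s3: "\<dots> \<le> ennreal (2 powr p) * (ennreal C + ennreal C)"
      using add_mono[OF bound[of n] Y] by (rule mult_left_mono) simp
    have "ennreal C + ennreal C = ennreal (2 * max 0 C)"
      using ennreal_plus[of "max 0 C" "max 0 C"] by (cases "0 \<le> C") (simp_all add: ennreal_neg max_def)
    then have s4: "ennreal (2 powr p) * (ennreal C + ennreal C) = ennreal C'"
      unfolding C'_def by (simp only: ennreal_mult'')
    show ?thesis
      using s3 unfolding s2[symmetric] s4 by (rule order_trans[OF s1])
  qed
  \<comment> \<open>The truncated differences tend to 0 almost everywhere, and finiteness of the
    measure makes the constant K^2 an integrable majorant.\<close>
  have lim0: "(\<lambda>n. \<integral>\<^sup>+x. ennreal ((min (D n x) K)\<^sup>2) \<partial>M) \<longlonglongrightarrow> 0" if "K > 0" for K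
  proof -
    have "(\<lambda>n. \<integral>\<^sup>+x. ennreal ((min (D n x) K)\<^sup>2) \<partial>M) \<longlonglongrightarrow> (\<integral>\<^sup>+x. 0 \<partial>M)"
    proof (rule nn_integral_dominated_convergence[where w="\<lambda>_. ennreal (K\<^sup>2)"])
      show "AE x in M. (\<lambda>n. ennreal ((min (D n x) K)\<^sup>2)) \<longlonglongrightarrow> 0"
        using lim
      proof eventually_elim
        case (elim x)
        have "(\<lambda>n. ennreal ((min \<bar>X n x - Y x\<bar> K)\<^sup>2)) \<longlonglongrightarrow> ennreal ((min \<bar>Y x - Y x\<bar> K)\<^sup>2)"
          by (intro tendsto_ennrealI tendsto_power tendsto_min tendsto_rabs tendsto_diff elim tendsto_const)
        then show ?case using \<open>K > 0\<close> by (simp add: D_def)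
      qed
      show "AE x in M. ennreal ((min (D n x) K)\<^sup>2) \<le> ennreal (K\<^sup>2)" for n
        using \<open>K > 0\<close> by (intro always_eventually allI ennreal_leI power_mono) (auto simp: D_def)
      show "(\<integral>\<^sup>+x. ennreal (K\<^sup>2) \<partial>M) < \<infinity>"
        by (simp add: ennreal_mult_less_top emeasure_finite less_top[symmetric] ennreal_mult_eq_top_iff)
    qed auto
    then show ?thesis by simp
  qed
  have le: "L2sq M (\<lambda>x. X n x - Y x) \<le> (\<integral>\<^sup>+x. ennreal ((min (D n x) K)\<^sup>2) \<partial>M) + ennreal (C' * K powr (2 - p))"
    if "K > 0" for K n
  proof -
    have "L2sq M (\<lambda>x. X n x - Y x) \<le>
      (\<integral>\<^sup>+x. ennreal ((min (D n x) K)\<^sup>2) + ennreal (K powr (2 - p)) * ennreal (D n x powr p) \<partial>M)"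
      unfolding L2sq_def
    proof (intro nn_integral_mono)
      fix x
      have "(norm (X n x - Y x))\<^sup>2 \<le> (min (D n x) K)\<^sup>2 + K powr (2 - p) * D n x powr p"
        using power2_le_min_plus_powr[of "D n x" K p] p \<open>K > 0\<close> by (simp add: D_def)
      then show "ennreal ((norm (X n x - Y x))\<^sup>2) \<le> ennreal ((min (D n x) K)\<^sup>2) + ennreal (K powr (2 - p)) * ennreal (D n x powr p)"
        by (intro ennreal_le_add_mult) (auto simp: D_def)
    qed
    also have "\<dots> = (\<integral>\<^sup>+x. ennreal ((min (D n x) K)\<^sup>2) \<partial>M) + ennreal (K powr (2 - p)) * (\<integral>\<^sup>+x. ennreal (D n x powr p) \<partial>M)"
      by (simp add: nn_integral_add nn_integral_cmult)
    also have "\<dots> \<le> (\<integral>\<^sup>+x. ennreal ((min (D n x) K)\<^sup>2) \<partial>M) + ennreal (K powr (2 - p)) * ennreal C'"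
      by (intro add_mono mult_left_mono D) auto
    finally show ?thesis by (simp add: ennreal_mult'' mult.commute C'_def)
  qed
  show ?thesis
  proof (rule tendsto_zero_ennreal)
    fix e :: real assume "0 < e"
    \<comment> \<open>K is fixed first, which makes the tail small for all n at once; only then is n
      taken large.\<close>
    obtain K where K: "K > 0" "C' * K powr (2 - p) < e / 2"
      using powr_neg_tendsto_0[of "2 - p" "e / 2" C'] p \<open>0 < e\<close> by auto
    have "\<forall>\<^sub>F n in sequentially. (\<integral>\<^sup>+x. ennreal ((min (D n x) K)\<^sup>2) \<partial>M) < ennreal (e / 2)"
      using lim0[OF K(1)] \<open>0 < e\<close> by (intro order_tendstoD) auto
    then show "\<forall>\<^sub>F n in sequentially. L2sq M (\<lambda>x. X n x - Y x) < ennreal e"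
    proof eventually_elim
      case (elim n)
      have "L2sq M (\<lambda>x. X n x - Y x) \<le> (\<integral>\<^sup>+x. ennreal ((min (D n x) K)\<^sup>2) \<partial>M) + ennreal (C' * K powr (2 - p))"
        by (rule le[OF K(1)])
      also have "\<dots> < ennreal (e / 2) + ennreal (e / 2)"
        using K(2) \<open>0 < e\<close> by (intro add_strict_mono elim ennreal_lessI) simp_all
      also have "\<dots> = ennreal e"
        using \<open>0 < e\<close> by (simp add: ennreal_plus[symmetric] del: ennreal_plus)
      finally show ?case .
    qed
  qed
qed

section \<open>Increments of a Wiener process\<close>

text \<open>Lebesgue measure on \<open>real ^ 'k\<close> is the image of the product measure over
  \<open>Basis\<close>; reindexing the basis by coordinates turns this into Fubini for functions of
  single coordinates.\<close>

lemma
  fixes g :: "'k::finite \<Rightarrow> real \<Rightarrow> real"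
  assumes int: "\<And>j. integrable lborel (g j)"
  shows integrable_lborel_vec_prod: "integrable lborel (\<lambda>x::real ^ 'k. \<Prod>j\<in>UNIV. g j (x $ j))" (is ?I)
    and integral_lborel_vec_prod: "(\<integral>x. (\<Prod>j\<in>UNIV. g j (x $ j)) \<partial>(lborel :: (real ^ 'k) measure)) = (\<Prod>j\<in>UNIV. \<integral>x. g j x \<partial>lborel)" (is ?E)
proof -
  interpret P: product_sigma_finite "\<lambda>_::real ^ 'k. lborel :: real measure" ..
  let ?B = "Basis :: (real ^ 'k) set"
  have [measurable]: "g j \<in> borel_measurable borel" for j
    using int[of j] by auto
  have bij: "bij_betw (\<lambda>j. axis j 1) UNIV ?B"
    by (auto simp: bij_betw_def inj_on_def axis_eq_axis Basis_vec_def)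
  have *: "(\<Prod>j\<in>UNIV. g j ((\<Sum>b\<in>?B. f b *\<^sub>R b) $ j)) = (\<Prod>b\<in>?B. g (axis_index b) (f b))" for f
  proof -
    have "(\<Prod>b\<in>?B. g (axis_index b) (f b)) = (\<Prod>j\<in>UNIV. g j (f (axis j 1)))"
      by (subst prod.reindex_bij_betw[OF bij, symmetric]) (simp add: axis_index_axis)
    moreover have "(\<Sum>b\<in>?B. f b *\<^sub>R b) $ j = f (axis j 1)" for j
      by (subst cart_eq_inner_axis, subst inner_sum_left_Basis) auto
    ultimately show ?thesis by presburger
  qed
  have meas: "(\<lambda>f. \<Sum>b\<in>?B. f b *\<^sub>R b) \<in> (\<Pi>\<^sub>M b\<in>?B. lborel) \<rightarrow>\<^sub>M borel"
    by measurable
  have mf: "(\<lambda>x::real ^ 'k. \<Prod>j\<in>UNIV. g j (x $ j)) \<in> borel_measurable borel"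
    by measurable
  show ?I
    by (subst lborel_eq, subst integrable_distr_eq[OF meas mf], subst *, rule P.product_integrable_prod)
      (use int in simp_all)
  have "(\<integral>x. (\<Prod>j\<in>UNIV. g j (x $ j)) \<partial>(lborel :: (real ^ 'k) measure)) = (\<Prod>b\<in>?B. \<integral>x. g (axis_index b) x \<partial>lborel)"
    by (subst lborel_eq, subst integral_distr[OF meas mf], subst *, rule P.product_integral_prod)
      (use int in simp_all)
  also have "\<dots> = (\<Prod>j\<in>UNIV. \<integral>x. g j x \<partial>lborel)"
    by (subst prod.reindex_bij_betw[OF bij, symmetric]) (simp add: axis_index_axis)
  finally show ?E .
qed

lemma borel_measurable_vec_nth [measurable (raw)]:
  fixes f :: "'a \<Rightarrow> 'b::topological_space ^ 'n"
  assumes "f \<in> borel_measurable M"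
  shows "(\<lambda>x. f x $ i) \<in> borel_measurable M"
proof -
  have "(\<lambda>v::'b ^ 'n. v $ i) \<in> borel_measurable borel"
    by (intro borel_measurable_continuous_onI continuous_intros)
  then show ?thesis by (rule measurable_compose[OF assms])
qed

lemma power2_norm_vec: "(norm x)\<^sup>2 = (\<Sum>i\<in>UNIV. (norm (x $ i))\<^sup>2)"
  by (simp add: norm_vec_def L2_set_def sum_nonneg)

lemma integrable_mult_sq:
  fixes f g :: "'a \<Rightarrow> real"
  assumes [measurable]: "f \<in> borel_measurable M" "g \<in> borel_measurable M"
    and int: "integrable M (\<lambda>x. (f x)\<^sup>2)" "integrable M (\<lambda>x. (g x)\<^sup>2)"
  shows "integrable M (\<lambda>x. f x * g x)"
proof (rule Bochner_Integration.integrable_bound[OF Bochner_Integration.integrable_add[OF int]])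
  have "\<bar>a * b\<bar> \<le> a\<^sup>2 + b\<^sup>2" for a b :: real
    using sum_squares_bound[of "\<bar>a\<bar>" "\<bar>b\<bar>"] abs_ge_zero[of "a * b"]
    unfolding power2_abs abs_mult mult.assoc by linarith
  then show "AE x in M. norm (f x * g x) \<le> norm ((f x)\<^sup>2 + (g x)\<^sup>2)"
    by auto
qed simp

definition gauss_moment :: "real \<Rightarrow> nat \<Rightarrow> real" where
  "gauss_moment \<sigma> q = (\<integral>x. normal_density 0 \<sigma> x * x ^ q \<partial>lborel)"

locale wiener_space = prob_space M for M :: "'w measure" +
  fixes T :: real and F :: "real \<Rightarrow> 'w measure" and W :: "real \<Rightarrow> 'w \<Rightarrow> real ^ 'k"
  assumes filtration: "filtration_on M T F" and wiener: "wiener_process M T F W"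
begin

abbreviation "incr s t \<omega> \<equiv> W t \<omega> - W s \<omega>"

abbreviation "gauss s t \<equiv> normal_density 0 (sqrt (t - s))"


lemma space_F: "0 \<le> s \<Longrightarrow> s \<le> T \<Longrightarrow> space (F s) = space M"
  using filtration unfolding filtration_on_def subalgebra_def by simp

lemma sets_F_mono: "0 \<le> s \<Longrightarrow> s \<le> t \<Longrightarrow> t \<le> T \<Longrightarrow> sets (F s) \<subseteq> sets (F t)"
  using filtration unfolding filtration_on_def by blast

lemma measurable_F_mono:
  assumes "f \<in> F s \<rightarrow>\<^sub>M N" "0 \<le> s" "s \<le> t" "t \<le> T"
  shows "f \<in> F t \<rightarrow>\<^sub>M N"
proof -
  have "subalgebra (F t) (F s)"
    using sets_F_mono[of s t] space_F[of s] space_F[of t] assms by (simp add: subalgebra_def)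
  then show ?thesis using assms(1) by (rule measurable_from_subalg)
qed

lemma measurable_F_M:
  assumes "f \<in> F s \<rightarrow>\<^sub>M N" "0 \<le> s" "s \<le> T"
  shows "f \<in> M \<rightarrow>\<^sub>M N"
proof -
  have "subalgebra M (F s)"
    using filtration assms unfolding filtration_on_def by simp
  then show ?thesis using assms(1) by (rule measurable_from_subalg)
qed

lemma wienerD:
  shows "0 \<le> t \<Longrightarrow> t \<le> T \<Longrightarrow> W t \<in> borel_measurable (F t)"
    and "0 \<le> s \<Longrightarrow> s < t \<Longrightarrow> t \<le> T \<Longrightarrow> distributed M lborel (\<lambda>\<omega>. W t \<omega> - W s \<omega>)
          (\<lambda>x. ennreal (\<Prod>j\<in>UNIV. gauss s t (x $ j)))"
    and "0 \<le> s \<Longrightarrow> s < t \<Longrightarrow> t \<le> T \<Longrightarrow> indep_set (sets (F s))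
          (sets (vimage_algebra (space M) (\<lambda>\<omega>. W t \<omega> - W s \<omega>) borel))"
  using wiener unfolding wiener_process_def by (simp_all only: atLeastAtMost_iff Ball_def simp_thms)

lemma W_measurable_F: "0 \<le> s \<Longrightarrow> s \<le> t \<Longrightarrow> t \<le> T \<Longrightarrow> W s \<in> borel_measurable (F t)"
  by (rule measurable_F_mono[OF wienerD(1)]) auto

lemma W_measurable: "0 \<le> s \<Longrightarrow> s \<le> T \<Longrightarrow> W s \<in> borel_measurable M"
  using measurable_F_M[OF W_measurable_F[of s s]] by simp

text \<open>Independence passes to smaller sigma-algebras: preimages under Y lie in
  \<open>F s\<close>, and preimages under f of the increment lie in the sigma-algebra generated by
  the increment.\<close>

lemma indep_increment:
  assumes "0 \<le> s" "s < t" "t \<le> T" and Y: "Y \<in> borel_measurable (F s)" and f: "f \<in> borel_measurable borel"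
  shows "indep_var borel Y borel (\<lambda>\<omega>. f (incr s t \<omega>))"
proof -
  let ?D = "\<lambda>\<omega>. incr s t \<omega>"
  have ind: "indep_set (sets (F s)) (sets (vimage_algebra (space M) ?D borel))"
    using wienerD(3) assms by simp
  have [measurable]: "W t \<in> borel_measurable M" "W s \<in> borel_measurable M"
    using assms by (auto intro: W_measurable)
  note [measurable] = f
  have "sigma_sets (space M) {Y -` A \<inter> space M |A. A \<in> sets borel} \<subseteq> sets (F s)"
    using sets.sigma_sets_subset[of "{Y -` A \<inter> space M |A. A \<in> sets borel}" "F s"] space_F[of s] assms
      measurable_sets[OF Y] by auto
  moreover have "sigma_sets (space M) {(\<lambda>\<omega>. f (?D \<omega>)) -` A \<inter> space M |A. A \<in> sets borel}
      \<subseteq> sets (vimage_algebra (space M) ?D borel)"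
  proof -
    have "(\<lambda>\<omega>. f (?D \<omega>)) -` A \<inter> space M \<in> sets (vimage_algebra (space M) ?D borel)" if "A \<in> sets borel" for A
    proof -
      have "(\<lambda>\<omega>. f (?D \<omega>)) -` A \<inter> space M = ?D -` (f -` A) \<inter> space M" by auto
      moreover have "f -` A \<in> sets borel"
        using measurable_sets[OF f that] by simp
      ultimately show ?thesis by (auto intro: in_vimage_algebra)
    qed
    then show ?thesis
      using sets.sigma_sets_subset[of "{(\<lambda>\<omega>. f (?D \<omega>)) -` A \<inter> space M |A. A \<in> sets borel}"
        "vimage_algebra (space M) ?D borel"] unfolding space_vimage_algebra by blast
  qed
  ultimately have "indep_set (sigma_sets (space M) {Y -` A \<inter> space M |A. A \<in> sets borel})
      (sigma_sets (space M) {(\<lambda>\<omega>. f (?D \<omega>)) -` A \<inter> space M |A. A \<in> sets borel})"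
    using ind unfolding indep_sets2_eq by blast
  then show ?thesis
    using assms measurable_F_M[OF Y] by (simp add: indep_var_eq)
qed

text \<open>The Gaussian density is a product over the coordinates, so the expectation factors. The
  moments of an increment follow by choosing \<open>g\<close> to be 1 away from the coordinates in
  question.\<close>

lemma
  assumes st: "0 \<le> s" "s < t" "t \<le> T"
    and [measurable]: "\<And>j. g j \<in> borel_measurable borel"
    and int: "\<And>j. integrable lborel (\<lambda>x. gauss s t x * g j x)"
  shows integrable_increment_prod: "integrable M (\<lambda>\<omega>. \<Prod>j\<in>UNIV. g j ((incr s t \<omega>) $ j))" (is ?I)
    and expectation_increment_prod: "expectation (\<lambda>\<omega>. \<Prod>j\<in>UNIV. g j ((incr s t \<omega>) $ j)) =
      (\<Prod>j\<in>UNIV. \<integral>x. gauss s t x * g j x \<partial>lborel)" (is ?E)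
proof -
  let ?\<phi> = "gauss s t"
  have D: "distributed M lborel (\<lambda>\<omega>. W t \<omega> - W s \<omega>) (\<lambda>x. ennreal (\<Prod>j\<in>UNIV. ?\<phi> (x $ j)))"
    using wienerD(2) st by simp
  have nn: "0 \<le> (\<Prod>j\<in>UNIV. ?\<phi> (x $ j))" for x :: "real ^ 'k"
    by (intro prod_nonneg) auto
  show ?I
    using distributed_integrable[OF D, of "\<lambda>x. \<Prod>j\<in>UNIV. g j (x $ j)"] nn integrable_lborel_vec_prod[of "\<lambda>j x. gauss s t x * g j x", OF int]
    by (simp add: prod.distrib)
  show ?E
    using distributed_integral[OF D, of "\<lambda>x. \<Prod>j\<in>UNIV. g j (x $ j)"] nn integral_lborel_vec_prod[of "\<lambda>j x. gauss s t x * g j x", OF int]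
    by (simp add: prod.distrib)
qed

lemma normal_density_power_integrable:
  "0 < \<sigma> \<Longrightarrow> integrable lborel (\<lambda>x. normal_density 0 \<sigma> x * x ^ q)"
  using integrable_normal_moment[of \<sigma> 0 q] by simp

lemma
  assumes st: "0 \<le> s" "s < t" "t \<le> T"
  shows integrable_increment_power: "integrable M (\<lambda>\<omega>. ((incr s t \<omega>) $ j) ^ q)" (is ?I)
    and expectation_increment_power:
      "expectation (\<lambda>\<omega>. ((incr s t \<omega>) $ j) ^ q) = gauss_moment (sqrt (t - s)) q" (is ?E)
proof -
  have \<sigma>: "sqrt (t - s) > 0" using st by simp
  let ?g = "\<lambda>i x. if i = j then x ^ q else (1::real)"
  have eq: "(\<Prod>i\<in>UNIV. ?g i (x $ i)) = (x $ j) ^ q" for x :: "real ^ 'k"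
    by (subst prod.remove[of _ j]) (auto intro!: prod.neutral)
  have int: "integrable lborel (\<lambda>x. gauss s t x * ?g i x)" for i
    using normal_density_power_integrable[OF \<sigma>, of q] normal_density_power_integrable[OF \<sigma>, of 0] by (cases "i = j") simp_all
  show ?I
    using integrable_increment_prod[OF st, of ?g] int by (simp add: eq del: vector_minus_component)
  have "(\<integral>x. gauss s t x * ?g i x \<partial>lborel) =
      (if i = j then gauss_moment (sqrt (t - s)) q else 1)" for i
    using integral_normal_density[OF \<sigma>, of 0] by (cases "i = j") (simp_all add: gauss_moment_def)
  then show ?E
    using expectation_increment_prod[OF st, of ?g] int unfolding eq by simp
qed

lemma
  assumes st: "0 \<le> s" "s < t" "t \<le> T"
  shows integrable_increment_mult: "integrable M (\<lambda>\<omega>. (incr s t \<omega>) $ j * (incr s t \<omega>) $ l)" (is ?I)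
    and expectation_increment_mult:
      "expectation (\<lambda>\<omega>. (incr s t \<omega>) $ j * (incr s t \<omega>) $ l) = (if j = l then t - s else 0)" (is ?E)
proof -
  have \<sigma>: "sqrt (t - s) > 0" using st by simp
  \<comment> \<open>The i-th factor is 1, x or x^2, so one choice of \<open>?g\<close> covers both
    equal and distinct coordinates.\<close>
  let ?g = "\<lambda>i x. (if i = j then x else 1) * (if i = l then x else (1::real))"
  have eq: "(\<Prod>i\<in>UNIV. ?g i (x $ i)) = x $ j * x $ l" for x :: "real ^ 'k"
    by (subst prod.distrib) simp
  have int: "integrable lborel (\<lambda>x. gauss s t x * ?g i x)" for i
    using normal_density_power_integrable[OF \<sigma>, of 0] normal_density_power_integrable[OF \<sigma>, of 1]
      normal_density_power_integrable[OF \<sigma>, of 2]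
    by (cases "i = j"; cases "i = l") (simp_all add: power2_eq_square)
  show ?I
    using integrable_increment_prod[OF st, of ?g] int by (simp add: eq del: vector_minus_component)
  have E: "expectation (\<lambda>\<omega>. (incr s t \<omega>) $ j * (incr s t \<omega>) $ l) =
      (\<Prod>i\<in>UNIV. \<integral>x. gauss s t x * ?g i x \<partial>lborel)"
    using expectation_increment_prod[OF st, of ?g] int unfolding eq by simp
  show ?E
  proof (cases "j = l")
    case True
    have "(\<integral>x. gauss s t x * ?g i x \<partial>lborel) = (if i = j then t - s else 1)" for i
      using integral_normal_moment_even[OF \<sigma>, of 0 1] integral_normal_density[OF \<sigma>, of 0] st True
      by (auto simp: power2_eq_square fact_numeral)
    with E True show ?thesis by simp
  next
    case False
    have z: "(\<integral>x. gauss s t x * ?g j x \<partial>lborel) = 0"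
      using integral_normal_moment_nz_1[OF \<sigma>, of 0] False by simp
    show ?thesis
      unfolding E using False by (subst prod_zero[OF finite]) (rule bexI[of _ j], rule z, simp_all)
  qed
qed

lemma times_function_of_increment:
  fixes f :: "real ^ 'k \<Rightarrow> real"
  assumes st: "0 \<le> s" "s < t" "t \<le> T" and Y: "Y \<in> borel_measurable (F s)" "integrable M Y"
    and f: "f \<in> borel_measurable borel" "integrable M (\<lambda>\<omega>. f (incr s t \<omega>))"
  shows "integrable M (\<lambda>\<omega>. Y \<omega> * f (incr s t \<omega>))"
    and "expectation (\<lambda>\<omega>. Y \<omega> * f (incr s t \<omega>)) = expectation Y * expectation (\<lambda>\<omega>. f (incr s t \<omega>))"
proof -
  note ind = indep_increment[OF st Y(1) f(1)]
  show "integrable M (\<lambda>\<omega>. Y \<omega> * f (incr s t \<omega>))"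
    by (rule indep_var_integrable[OF ind Y(2) f(2)])
  show "expectation (\<lambda>\<omega>. Y \<omega> * f (incr s t \<omega>)) = expectation Y * expectation (\<lambda>\<omega>. f (incr s t \<omega>))"
    by (rule indep_var_lebesgue_integral[OF ind Y(2) f(2)])
qed

lemma
  assumes st: "0 \<le> s" "s \<le> t" "t \<le> T" and Y: "Y \<in> borel_measurable (F s)" "integrable M Y"
  shows integrable_times_increment: "integrable M (\<lambda>\<omega>. Y \<omega> * (incr s t \<omega>) $ j)" (is ?I)
    and expectation_times_increment: "expectation (\<lambda>\<omega>. Y \<omega> * (incr s t \<omega>) $ j) = 0" (is ?E)
proof -
  have "?I \<and> ?E"
  proof (cases "s = t")
    case False
    with st have lt: "s < t" by simp
    have int: "integrable M (\<lambda>\<omega>. (incr s t \<omega>) $ j)"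
      using integrable_increment_power[of s t j 1] st lt by simp
    have E: "expectation (\<lambda>\<omega>. (incr s t \<omega>) $ j) = 0"
      using expectation_increment_power[of s t j 1] integral_normal_moment_nz_1[of "sqrt (t - s)" 0] st lt
      by (simp add: gauss_moment_def)
    show ?thesis
      using times_function_of_increment[OF st(1) lt st(3) Y _ int] E by simp
  qed simp
  then show ?I ?E by auto
qed

lemma
  assumes st: "0 \<le> s" "s \<le> t" "t \<le> T" and Y: "Y \<in> borel_measurable (F s)" "integrable M Y"
  shows integrable_times_increment_mult:
      "integrable M (\<lambda>\<omega>. Y \<omega> * ((incr s t \<omega>) $ j * (incr s t \<omega>) $ l))" (is ?I)
    and expectation_times_increment_mult:
      "expectation (\<lambda>\<omega>. Y \<omega> * ((incr s t \<omega>) $ j * (incr s t \<omega>) $ l)) =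
        (if j = l then t - s else 0) * expectation Y" (is ?E)
proof -
  have "?I \<and> ?E"
  proof (cases "s = t")
    case False
    with st have lt: "s < t" by simp
    show ?thesis
      using times_function_of_increment[OF st(1) lt st(3) Y _ integrable_increment_mult[OF st(1) lt st(3), of j l]]
        expectation_increment_mult[OF st(1) lt st(3), of j l] by simp
  qed simp
  then show ?I ?E by auto
qed

text \<open>The longer increment is split at the earlier endpoint. The common part gives the length,
  and the rest is orthogonal to everything known at that endpoint.\<close>

lemma expectation_increments_common_start:
  assumes "0 \<le> c" "c \<le> b" "b \<le> T" "c \<le> d" "d \<le> T" and Y: "Y \<in> borel_measurable (F c)" "integrable M Y"
  shows "integrable M (\<lambda>\<omega>. Y \<omega> * ((incr c b \<omega>) $ j * (incr c d \<omega>) $ l)) \<and>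
    expectation (\<lambda>\<omega>. Y \<omega> * ((incr c b \<omega>) $ j * (incr c d \<omega>) $ l)) =
      (if j = l then min b d - c else 0) * expectation Y"
  using assms(1-5)
proof (induction b d arbitrary: j l rule: linorder_wlog)
  case (le b d)
  have Wc: "W c \<in> borel_measurable (F b)" and Wb: "W b \<in> borel_measurable (F b)"
    using le by (auto intro: W_measurable_F)
  have Z: "(\<lambda>\<omega>. Y \<omega> * (incr c b \<omega>) $ j) \<in> borel_measurable (F b)"
    using measurable_F_mono[OF Y(1), of b] le Wc Wb by measurable
  have iZ: "integrable M (\<lambda>\<omega>. Y \<omega> * (incr c b \<omega>) $ j)"
    using le Y by (intro integrable_times_increment) auto
  note A = integrable_times_increment[OF _ _ _ Z iZ, of d l] expectation_times_increment[OF _ _ _ Z iZ, of d l]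
  note B = integrable_times_increment_mult[OF _ _ _ Y, of b j l] expectation_times_increment_mult[OF _ _ _ Y, of b j l]
  have eq: "(\<lambda>\<omega>. Y \<omega> * ((incr c b \<omega>) $ j * (incr c d \<omega>) $ l)) =
    (\<lambda>\<omega>. Y \<omega> * ((incr c b \<omega>) $ j * (incr c b \<omega>) $ l) + Y \<omega> * (incr c b \<omega>) $ j * (incr b d \<omega>) $ l)"
    by (simp add: algebra_simps)
  show ?case
    unfolding eq using A B le by (simp add: min_def del: vector_minus_component)
next
  case (sym b d)
  then show ?case
    by (simp add: mult.commute[of "(W b _ - W c _) $ _"] min.commute eq_commute[of j l] del: vector_minus_component)
qed

text \<open>Empty intervals carry no adaptedness condition, so that a partition may be cut off at any time.\<close>

definition adapted_coeff :: "real \<Rightarrow> real \<Rightarrow> ('w \<Rightarrow> real) \<Rightarrow> bool" where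
  "adapted_coeff a b \<xi> \<longleftrightarrow> 0 \<le> a \<and> a \<le> b \<and> b \<le> T \<and> \<xi> \<in> borel_measurable M \<and>
     integrable M (\<lambda>\<omega>. (\<xi> \<omega>)\<^sup>2) \<and> (a < b \<longrightarrow> \<xi> \<in> borel_measurable (F a))"

text \<open>Lets the coefficient and the increment of an earlier interval serve, together with the
  next coefficient, as a single coefficient for a later increment. The product of \<xi> with its
  increment is square integrable by independence, so the triple product is integrable by
  Cauchy-Schwarz.\<close>

lemma adapted_coeff_product:
  fixes j :: 'k
  assumes \<xi>: "adapted_coeff a b \<xi>" and \<eta>: "adapted_coeff c d \<eta>" and lt: "a < b" "c < d"
    and u: "a \<le> u" "u \<le> c"
  defines "Y \<equiv> \<lambda>\<omega>. (\<xi> \<omega> * (incr a u \<omega>) $ j) * \<eta> \<omega>"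
  shows "Y \<in> borel_measurable (F c)" and "integrable M Y"
proof -
  note \<xi>' = \<xi>[unfolded adapted_coeff_def] and \<eta>' = \<eta>[unfolded adapted_coeff_def]
  have m: "\<xi> \<in> borel_measurable (F c)" "\<eta> \<in> borel_measurable (F c)" "W u \<in> borel_measurable (F c)" "W a \<in> borel_measurable (F c)"
    using \<xi>' \<eta>' lt u by (auto intro: W_measurable_F measurable_F_mono[of _ a])
  then show "Y \<in> borel_measurable (F c)" unfolding Y_def by measurable
  have \<xi>a: "\<xi> \<in> borel_measurable (F a)" using \<xi>' lt by auto
  have [measurable]: "\<xi> \<in> borel_measurable M" "\<eta> \<in> borel_measurable M" "W u \<in> borel_measurable M" "W a \<in> borel_measurable M"
    using \<xi>' \<eta>' u by (auto intro: W_measurable)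
  have "integrable M (\<lambda>\<omega>. (\<xi> \<omega> * (incr a u \<omega>) $ j)\<^sup>2)"
    using integrable_times_increment_mult[of a u "\<lambda>\<omega>. (\<xi> \<omega>)\<^sup>2" j j] \<xi>' \<eta>' \<xi>a u
    by (simp add: power2_eq_square algebra_simps)
  then show "integrable M Y"
    unfolding Y_def using \<eta>' by (intro integrable_mult_sq) auto
qed

text \<open>The polarised Ito isometry for two single increments. If the earlier interval reaches
  beyond c, it is split there: its part before c is absorbed into the coefficient and has
  expectation zero against the later increment, its part after c shares the starting point of the
  other interval.\<close>

lemma expectation_increments:
  assumes "adapted_coeff a b \<xi>" "adapted_coeff c d \<eta>"
  shows "integrable M (\<lambda>\<omega>. (\<xi> \<omega> * (incr a b \<omega>) $ j) * (\<eta> \<omega> * (incr c d \<omega>) $ l)) \<and>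
    expectation (\<lambda>\<omega>. (\<xi> \<omega> * (incr a b \<omega>) $ j) * (\<eta> \<omega> * (incr c d \<omega>) $ l)) =
      (if j = l then max 0 (min b d - max a c) else 0) * expectation (\<lambda>\<omega>. \<xi> \<omega> * \<eta> \<omega>)"
  using assms
proof (induction a c arbitrary: b d j l \<xi> \<eta> rule: linorder_wlog)
  case (le a c)
  note \<xi> = le(2)[unfolded adapted_coeff_def] and \<eta> = le(3)[unfolded adapted_coeff_def]
  consider "a = b" | "c = d" | "a < b" "c < d" "b \<le> c" | "a < b" "c < d" "c < b"
    using \<xi> \<eta> by force
  then show ?case
  proof cases
    case 1
    then show ?thesis by simp
  next
    case 2
    then show ?thesis by simp
  next
    case 3
    note Y = adapted_coeff_product[OF le(2,3) 3(1,2) less_imp_le[OF 3(1)] 3(3), of j]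
    show ?thesis
      using integrable_times_increment[OF _ _ _ Y, of d l] expectation_times_increment[OF _ _ _ Y, of d l] \<xi> \<eta> 3
      by (simp add: mult.assoc max_def min_def del: vector_minus_component)
  next
    case 4
    let ?Y = "\<lambda>\<omega>. (\<xi> \<omega> * (incr a c \<omega>) $ j) * \<eta> \<omega>"
    note Y = adapted_coeff_product[OF le(2,3) 4(1,2) le(1) order_refl, of j]
    have m: "\<xi> \<in> borel_measurable (F c)" "\<eta> \<in> borel_measurable (F c)"
      using \<xi> \<eta> 4 le(1) by (auto intro: measurable_F_mono[of _ a])
    have \<xi>\<eta>: "(\<lambda>\<omega>. \<xi> \<omega> * \<eta> \<omega>) \<in> borel_measurable (F c)" using m by measurable
    have i\<xi>\<eta>: "integrable M (\<lambda>\<omega>. \<xi> \<omega> * \<eta> \<omega>)"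
      using \<xi> \<eta> by (intro integrable_mult_sq) auto
    note A = integrable_times_increment[OF _ _ _ Y, of d l] expectation_times_increment[OF _ _ _ Y, of d l]
    note B = expectation_increments_common_start[OF _ _ _ _ _ \<xi>\<eta> i\<xi>\<eta>, of b d j l]
    have eq: "(\<lambda>\<omega>. (\<xi> \<omega> * (incr a b \<omega>) $ j) * (\<eta> \<omega> * (incr c d \<omega>) $ l)) =
      (\<lambda>\<omega>. \<xi> \<omega> * \<eta> \<omega> * ((incr c b \<omega>) $ j * (incr c d \<omega>) $ l) + ?Y \<omega> * (incr c d \<omega>) $ l)"
      by (simp add: algebra_simps)
    show ?thesis
      unfolding eq using A B \<xi> \<eta> 4 le(1) by (simp add: max_def del: vector_minus_component)
  qed
next
  case (sym a c)
  show ?case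
    using sym(1)[OF sym(3) sym(2), of l j]
    by (simp add: mult.commute[of "\<xi> _ * _"] mult.commute[of "\<xi> _" "\<eta> _"] min.commute max.commute eq_commute[of j l] del: vector_minus_component)
qed

end

section \<open>The Ito isometry\<close>

text \<open>The overlap length of \<open>expectation_increments\<close> reappears as a time
  integral; this agreement is the core of the isometry.\<close>

lemma
  fixes a b c d :: real
  shows integrable_indicator_Ioc_mult: "integrable lborel (\<lambda>s. indicator {a<..b} s * indicator {c<..d} s :: real)" (is ?I)
    and integral_indicator_Ioc_mult:
      "(\<integral>s. indicator {a<..b} s * indicator {c<..d} s \<partial>lborel) = max 0 (min b d - max a c)" (is ?E)
proof -
  have eq: "(\<lambda>s. indicator {a<..b} s * indicator {c<..d} s :: real) = indicator {max a c<..min b d}"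
    by (auto simp: indicator_def)
  have Ioc: "integrable lborel (indicator {u<..v} :: real \<Rightarrow> real)"
      "(\<integral>s. indicator {u<..v} s \<partial>lborel) = max 0 (v - u)" for u v :: real
    by (cases "u \<le> v"; simp add: measure_def)+
  show ?I ?E unfolding eq by (rule Ioc)+
qed

lemma integrable_norm_sq_iff_L2sq:
  fixes f :: "'a \<Rightarrow> 'b::{real_normed_vector, second_countable_topology}"
  assumes [measurable]: "f \<in> borel_measurable M"
  shows "integrable M (\<lambda>x. (norm (f x))\<^sup>2) \<longleftrightarrow> L2sq M f < \<infinity>"
  by (simp add: integrable_iff_bounded L2sq_def)

lemma norm_vec_nth_nth_le: "\<bar>x $ a $ b\<bar> \<le> norm (x :: real ^ 'k ^ 'm)"
  using Finite_Cartesian_Product.norm_nth_le[of x a] Finite_Cartesian_Product.norm_nth_le[of "x $ a" b] by simp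

context wiener_space
begin

lemma second_moment_increment_sum:
  fixes lo hi :: "'i \<Rightarrow> real" and \<xi> :: "'i \<Rightarrow> 'w \<Rightarrow> real" and J :: "'i \<Rightarrow> 'k"
  assumes "finite A" and ad: "\<And>i. i \<in> A \<Longrightarrow> adapted_coeff (lo i) (hi i) (\<xi> i)"
  shows "integrable M (\<lambda>\<omega>. (\<Sum>i\<in>A. \<xi> i \<omega> * (W (hi i) \<omega> - W (lo i) \<omega>) $ J i)\<^sup>2) \<and>
    expectation (\<lambda>\<omega>. (\<Sum>i\<in>A. \<xi> i \<omega> * (W (hi i) \<omega> - W (lo i) \<omega>) $ J i)\<^sup>2) =
    (\<Sum>i\<in>A. \<Sum>i'\<in>A. (if J i = J i' then max 0 (min (hi i) (hi i') - max (lo i) (lo i')) else 0) *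
      expectation (\<lambda>\<omega>. \<xi> i \<omega> * \<xi> i' \<omega>))"
proof -
  note E = expectation_increments[OF ad ad]
  show ?thesis
    unfolding power2_eq_square sum_product
    using E by (simp add: Bochner_Integration.integrable_sum Bochner_Integration.integral_sum del: vector_minus_component)
qed

text \<open>The intervals may overlap arbitrarily. A difference of two elementary processes on
  different partitions is thus a single family, which avoids building a common refinement.\<close>

lemma
  fixes lo hi :: "'i \<Rightarrow> real" and \<xi> :: "'i \<Rightarrow> 'w \<Rightarrow> real ^ 'k ^ 'm"
  assumes fin: "finite A"
    and le: "\<And>i. i \<in> A \<Longrightarrow> 0 \<le> lo i \<and> lo i \<le> hi i \<and> hi i \<le> T"
    and meas[measurable]: "\<And>i. i \<in> A \<Longrightarrow> \<xi> i \<in> borel_measurable M"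
    and L2: "\<And>i. i \<in> A \<Longrightarrow> L2sq M (\<xi> i) < \<infinity>"
    and adapted: "\<And>i. i \<in> A \<Longrightarrow> lo i < hi i \<Longrightarrow> \<xi> i \<in> borel_measurable (F (lo i))"
  shows isometry_family: "L2sq M (\<lambda>\<omega>. \<Sum>i\<in>A. \<xi> i \<omega> *v (W (hi i) \<omega> - W (lo i) \<omega>)) =
    (\<integral>\<^sup>+\<omega>. (\<integral>\<^sup>+s. ennreal ((norm (\<Sum>i\<in>A. indicator {lo i<..hi i} s *\<^sub>R \<xi> i \<omega>))\<^sup>2) \<partial>lborel) \<partial>M)"
proof -
  let ?f = "\<lambda>s \<omega>. (norm (\<Sum>i\<in>A. indicator {lo i<..hi i} s *\<^sub>R \<xi> i \<omega>))\<^sup>2"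
  let ?o = "\<lambda>i i'. max 0 (min (hi i) (hi i') - max (lo i) (lo i'))"
  have ad: "adapted_coeff (lo i) (hi i) (\<lambda>\<omega>. \<xi> i \<omega> $ a $ b)" if "i \<in> A" for i a b
  proof -
    have "integrable M (\<lambda>\<omega>. (\<xi> i \<omega> $ a $ b)\<^sup>2)"
    proof (rule Bochner_Integration.integrable_bound)
      show "integrable M (\<lambda>\<omega>. (norm (\<xi> i \<omega>))\<^sup>2)"
        using L2[OF that] meas[OF that] by (simp add: integrable_norm_sq_iff_L2sq)
      show "(\<lambda>\<omega>. (\<xi> i \<omega> $ a $ b)\<^sup>2) \<in> borel_measurable M"
        using meas[OF that] by measurable
      show "AE \<omega> in M. norm ((\<xi> i \<omega> $ a $ b)\<^sup>2) \<le> norm ((norm (\<xi> i \<omega>))\<^sup>2)"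
        by (auto simp: norm_vec_nth_nth_le intro!: AE_I2 abs_le_square_iff[THEN iffD1] simp: abs_le_square_iff[symmetric])
    qed
    moreover have "(\<lambda>\<omega>. \<xi> i \<omega> $ a $ b) \<in> borel_measurable M"
      using meas[OF that] by measurable
    moreover have "(\<lambda>\<omega>. \<xi> i \<omega> $ a $ b) \<in> borel_measurable (F (lo i))" if "lo i < hi i"
      using adapted[OF \<open>i \<in> A\<close> that] by measurable
    ultimately show ?thesis
      using le[OF that] by (simp add: adapted_coeff_def)
  qed
  have int: "integrable M (\<lambda>\<omega>. \<xi> i \<omega> $ a $ b * \<xi> i' \<omega> $ a $ b)" if "i \<in> A" "i' \<in> A" for i i' a b
    using ad[OF that(1), of a b] ad[OF that(2), of a b] by (intro integrable_mult_sq) (auto simp: adapted_coeff_def)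
  \<comment> \<open>Both sides reduce to this double sum over pairs of intervals weighted by their
    overlap; the matrix norm is the Frobenius norm, so the entries (a, b) simply add up.\<close>
  define R where "R \<omega> = (\<Sum>a\<in>UNIV. \<Sum>b\<in>UNIV. \<Sum>i\<in>A. \<Sum>i'\<in>A. ?o i i' * (\<xi> i \<omega> $ a $ b * \<xi> i' \<omega> $ a $ b))" for \<omega>
  have inner: "(\<integral>\<^sup>+s. ennreal (?f s \<omega>) \<partial>lborel) = ennreal (R \<omega>) \<and> 0 \<le> R \<omega>" for \<omega>
  proof -
    have eq: "?f s \<omega> =
      (\<Sum>a\<in>UNIV. \<Sum>b\<in>UNIV. \<Sum>i\<in>A. \<Sum>i'\<in>A. (indicator {lo i<..hi i} s * indicator {lo i'<..hi i'} s) * (\<xi> i \<omega> $ a $ b * \<xi> i' \<omega> $ a $ b))" for s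
      by (simp only: power2_norm_vec sum_component vector_scaleR_component real_norm_def power2_abs real_scaleR_def
            power2_eq_square[of "sum _ _"] sum_product)
         (simp add: mult_ac)
    have I: "integrable lborel (\<lambda>s. ?f s \<omega>)"
      unfolding eq by (intro Bochner_Integration.integrable_sum integrable_mult_left integrable_indicator_Ioc_mult)
    have E: "(\<integral>s. ?f s \<omega> \<partial>lborel) = R \<omega>"
      unfolding eq R_def
      by (simp add: Bochner_Integration.integral_sum Bochner_Integration.integrable_sum
        integrable_indicator_Ioc_mult integral_indicator_Ioc_mult)
    show ?thesis
      using nn_integral_eq_integral[OF I] E Bochner_Integration.integral_nonneg[of lborel "\<lambda>s. ?f s \<omega>"]
      by simp
  qed
  have iR: "integrable M R"
    unfolding R_def by (intro Bochner_Integration.integrable_sum integrable_mult_right int) auto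
  have ER: "expectation R = (\<Sum>a\<in>UNIV. \<Sum>b\<in>UNIV. \<Sum>i\<in>A. \<Sum>i'\<in>A. ?o i i' * expectation (\<lambda>\<omega>. \<xi> i \<omega> $ a $ b * \<xi> i' \<omega> $ a $ b))"
    unfolding R_def by (simp add: Bochner_Integration.integral_sum Bochner_Integration.integrable_sum int)
  have rhs: "(\<integral>\<^sup>+\<omega>. (\<integral>\<^sup>+s. ennreal (?f s \<omega>) \<partial>lborel) \<partial>M) = ennreal (expectation R)"
    using inner nn_integral_eq_integral[OF iR] by simp
  \<comment> \<open>Row a of the integral is a scalar sum indexed by interval and Wiener coordinate,
    the shape required by \<open>second_moment_increment_sum\<close>.\<close>
  let ?v = "\<lambda>a \<omega>. \<Sum>\<kappa>\<in>A \<times> UNIV. \<xi> (fst \<kappa>) \<omega> $ a $ snd \<kappa> * (W (hi (fst \<kappa>)) \<omega> - W (lo (fst \<kappa>)) \<omega>) $ snd \<kappa>"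
  have comp: "(\<Sum>i\<in>A. \<xi> i \<omega> *v (W (hi i) \<omega> - W (lo i) \<omega>)) $ a = ?v a \<omega>" for a \<omega>
    by (simp add: sum_component matrix_vector_mult_def sum.cartesian_product split_beta)
  have V: "integrable M (\<lambda>\<omega>. (?v a \<omega>)\<^sup>2) \<and> expectation (\<lambda>\<omega>. (?v a \<omega>)\<^sup>2) =
      (\<Sum>\<kappa>\<in>A \<times> UNIV. \<Sum>\<kappa>'\<in>A \<times> UNIV. (if snd \<kappa> = snd \<kappa>' then ?o (fst \<kappa>) (fst \<kappa>') else 0) *
        expectation (\<lambda>\<omega>. \<xi> (fst \<kappa>) \<omega> $ a $ snd \<kappa> * \<xi> (fst \<kappa>') \<omega> $ a $ snd \<kappa>'))" for a
    using fin ad by (intro second_moment_increment_sum[where lo="\<lambda>\<kappa>. lo (fst \<kappa>)" and hi="\<lambda>\<kappa>. hi (fst \<kappa>)"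
      and \<xi>="\<lambda>\<kappa> \<omega>. \<xi> (fst \<kappa>) \<omega> $ a $ snd \<kappa>"]) auto
  \<comment> \<open>Distinct Wiener coordinates drop out, which leaves the diagonal of the double
    sum over coordinates.\<close>
  have reorder: "(\<Sum>\<kappa>\<in>A \<times> UNIV. \<Sum>\<kappa>'\<in>A \<times> UNIV. (if snd \<kappa> = snd \<kappa>' then ?o (fst \<kappa>) (fst \<kappa>') else 0) * g (fst \<kappa>) (snd \<kappa>) (fst \<kappa>') (snd \<kappa>'))
    = (\<Sum>b\<in>UNIV. \<Sum>i\<in>A. \<Sum>i'\<in>A. ?o i i' * g i b i' b)" for g :: "'i \<Rightarrow> 'k \<Rightarrow> 'i \<Rightarrow> 'k \<Rightarrow> real"
  proof -
    have "(\<Sum>\<kappa>\<in>A \<times> UNIV. \<Sum>\<kappa>'\<in>A \<times> UNIV. (if snd \<kappa> = snd \<kappa>' then ?o (fst \<kappa>) (fst \<kappa>') else 0) * g (fst \<kappa>) (snd \<kappa>) (fst \<kappa>') (snd \<kappa>'))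
      = (\<Sum>i\<in>A. \<Sum>b\<in>UNIV. \<Sum>i'\<in>A. \<Sum>b'\<in>UNIV. (if b = b' then ?o i i' else 0) * g i b i' b')"
      by (simp add: sum.cartesian_product' cong: if_cong)
    also have "\<dots> = (\<Sum>i\<in>A. \<Sum>b\<in>UNIV. \<Sum>i'\<in>A. \<Sum>b'\<in>UNIV. if b = b' then ?o i i' * g i b i' b' else 0)"
      by (intro sum.cong) auto
    also have "\<dots> = (\<Sum>i\<in>A. \<Sum>b\<in>UNIV. \<Sum>i'\<in>A. ?o i i' * g i b i' b)"
      by (intro sum.cong refl) (subst sum.delta', auto)
    also have "\<dots> = (\<Sum>b\<in>UNIV. \<Sum>i\<in>A. \<Sum>i'\<in>A. ?o i i' * g i b i' b)"
      by (rule sum.swap)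
    finally show ?thesis .
  qed
  have "L2sq M (\<lambda>\<omega>. \<Sum>i\<in>A. \<xi> i \<omega> *v (W (hi i) \<omega> - W (lo i) \<omega>)) = (\<integral>\<^sup>+\<omega>. ennreal (\<Sum>a\<in>UNIV. (?v a \<omega>)\<^sup>2) \<partial>M)"
    unfolding L2sq_def by (simp only: power2_norm_vec comp real_norm_def power2_abs)
  also have "\<dots> = ennreal (expectation (\<lambda>\<omega>. \<Sum>a\<in>UNIV. (?v a \<omega>)\<^sup>2))"
    using V by (intro nn_integral_eq_integral Bochner_Integration.integrable_sum AE_I2 sum_nonneg) auto
  also have "expectation (\<lambda>\<omega>. \<Sum>a\<in>UNIV. (?v a \<omega>)\<^sup>2) = (\<Sum>a\<in>UNIV. expectation (\<lambda>\<omega>. (?v a \<omega>)\<^sup>2))"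
    using V by (intro Bochner_Integration.integral_sum) auto
  also have "\<dots> = expectation R"
    unfolding ER
  proof (intro sum.cong refl)
    fix a
    show "expectation (\<lambda>\<omega>. (?v a \<omega>)\<^sup>2) =
      (\<Sum>b\<in>UNIV. \<Sum>i\<in>A. \<Sum>i'\<in>A. ?o i i' * expectation (\<lambda>\<omega>. \<xi> i \<omega> $ a $ b * \<xi> i' \<omega> $ a $ b))"
      using V[of a] reorder[of "\<lambda>i b i' b'. expectation (\<lambda>\<omega>. \<xi> i \<omega> $ a $ b * \<xi> i' \<omega> $ a $ b')"]
      by (simp only:)
  qed
  finally show ?thesis unfolding rhs .
qed

end

lemma minus_matrix_vector_mult: "(- A) *v x = - (A *v (x :: 'a::comm_ring_1 ^ 'n))"
  by (simp add: matrix_vector_mult_def vec_eq_iff sum_negf)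

lemma borel_measurable_matrix_vector_mult [measurable (raw)]:
  fixes A :: "'a \<Rightarrow> real ^ 'k ^ 'm" and x :: "'a \<Rightarrow> real ^ 'k"
  assumes "A \<in> borel_measurable M" "x \<in> borel_measurable M"
  shows "(\<lambda>\<omega>. A \<omega> *v x \<omega>) \<in> borel_measurable M"
  by (rule borel_measurable_continuous_Pair[OF assms])
    (auto simp: matrix_vector_mult_def intro!: continuous_intros)

lemma mono_partition_le:
  fixes \<tau> :: "nat \<Rightarrow> real"
  assumes "\<forall>i<N. \<tau> i \<le> \<tau> (Suc i)" "i \<le> j" "j \<le> N"
  shows "\<tau> i \<le> \<tau> j"
  using assms(2,3)
proof (induction j rule: dec_induct)
  case (step n)
  then have "\<tau> i \<le> \<tau> n" "\<tau> n \<le> \<tau> (Suc n)" using assms(1) by auto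
  then show ?case by simp
qed simp

section \<open>The product of time and probability space\<close>

lemma sigma_finite_time_measure: "sigma_finite_measure (time_measure T)"
  by (intro sigma_finite_measure_restrict_space sigma_finite_lborel) simp

context prob_space
begin

abbreviation "time_space t \<equiv> time_measure t \<Otimes>\<^sub>M M"

lemma pair_sigma_finite_time: "pair_sigma_finite (time_measure t) M"
  by (intro pair_sigma_finite.intro sigma_finite_time_measure sigma_finite_measure_axioms)

lemma nn_integral_time_pair:
  assumes f: "f \<in> borel_measurable (time_space t)"
  shows "(\<integral>\<^sup>+x. f x \<partial>time_space t) = (\<integral>\<^sup>+\<omega>. (\<integral>\<^sup>+s. f (s, \<omega>) * indicator {0..t} s \<partial>lborel) \<partial>M)"
  using pair_sigma_finite.nn_integral_snd[OF pair_sigma_finite_time f]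
  by (simp add: nn_integral_restrict_space)

lemma L2sq_time_pair:
  fixes f :: "real \<times> 'a \<Rightarrow> 'b::{real_normed_vector, second_countable_topology}"
  assumes [measurable]: "f \<in> borel_measurable (time_space t)"
  shows "L2sq (time_space t) f =
    (\<integral>\<^sup>+\<omega>. (\<integral>\<^sup>+s. ennreal ((norm (f (s, \<omega>)))\<^sup>2) * indicator {0..t} s \<partial>lborel) \<partial>M)"
  unfolding L2sq_def by (subst nn_integral_time_pair) auto

lemma measurable_time_pair_mono:
  assumes "f \<in> borel_measurable (time_space T)" "t \<le> T"
  shows "f \<in> borel_measurable (time_space t)"
proof (rule measurable_compose[OF _ assms(1), of "\<lambda>x. x", simplified])
  have "(\<lambda>s. s) \<in> time_measure t \<rightarrow>\<^sub>M time_measure T"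
    using assms(2) by (intro measurable_restrict_space3) auto
  then have "(\<lambda>x. (fst x, snd x)) \<in> (time_space t) \<rightarrow>\<^sub>M (time_space T)"
    by (intro measurable_Pair measurable_compose[OF measurable_fst] measurable_snd)
  then show "(\<lambda>x. x) \<in> (time_space t) \<rightarrow>\<^sub>M (time_space T)"
    by simp
qed

lemma L2sq_time_pair_mono:
  fixes f :: "real \<times> 'a \<Rightarrow> 'b::{real_normed_vector, second_countable_topology}"
  assumes f: "f \<in> borel_measurable (time_space T)" and le: "t \<le> T"
  shows "L2sq (time_space t) f \<le> L2sq (time_space T) f"
  unfolding L2sq_time_pair[OF f] L2sq_time_pair[OF measurable_time_pair_mono[OF f le]]
  using le by (intro nn_integral_mono) (auto simp: indicator_def)

end

section \<open>Elementary processes with square integrable coefficients\<close>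

context wiener_space
begin

text \<open>Boundedness of the coefficients is relaxed to square integrability: cell averages are in
  general unbounded, and the isometry holds for them all the same.\<close>

fun sq_elementary :: "('w, real ^ 'k ^ 'm) elementary \<Rightarrow> bool" where
  "sq_elementary (N, \<tau>, \<xi>) \<longleftrightarrow>
     0 \<le> \<tau> 0 \<and> \<tau> N \<le> T \<and> (\<forall>i<N. \<tau> i \<le> \<tau> (Suc i)) \<and>
     (\<forall>i<N. \<xi> i \<in> borel_measurable (F (\<tau> i)) \<and> L2sq M (\<xi> i) < \<infinity>)"

lemma sq_elementaryD:
  assumes "sq_elementary (N, \<tau>, \<xi>)" "i < N"
  shows "0 \<le> \<tau> i" "\<tau> i \<le> T" "\<tau> i \<le> \<tau> (Suc i)" "0 \<le> \<tau> (Suc i)" "\<tau> (Suc i) \<le> T"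
    "\<xi> i \<in> borel_measurable (F (\<tau> i))" "\<xi> i \<in> borel_measurable M" "L2sq M (\<xi> i) < \<infinity>"
proof -
  have m: "\<forall>i<N. \<tau> i \<le> \<tau> (Suc i)" using assms(1) by simp
  have "\<tau> 0 \<le> \<tau> i" "\<tau> i \<le> \<tau> (Suc i)" "\<tau> (Suc i) \<le> \<tau> N"
    using assms(2) by (auto intro!: mono_partition_le[OF m])
  then show *: "0 \<le> \<tau> i" "\<tau> i \<le> T" "\<tau> i \<le> \<tau> (Suc i)" "0 \<le> \<tau> (Suc i)" "\<tau> (Suc i) \<le> T"
    using assms(1) by auto
  show "\<xi> i \<in> borel_measurable (F (\<tau> i))" "L2sq M (\<xi> i) < \<infinity>"
    using assms by auto
  then show "\<xi> i \<in> borel_measurable M"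
    using * by (auto intro: measurable_F_M)
qed

lemma sq_elementary_if_elementary_on:
  assumes "elementary_on M T F S"
  shows "sq_elementary S"
proof -
  obtain N \<tau> \<xi> where S: "S = (N, \<tau>, \<xi>)" by (cases S)
  have "L2sq M (\<xi> i) < \<infinity>" if "i < N" for i
  proof -
    have "bounded (\<xi> i ` space M)" using assms S that by simp
    then obtain B where B: "\<And>\<omega>. \<omega> \<in> space M \<Longrightarrow> norm (\<xi> i \<omega>) \<le> B"
      by (auto simp: bounded_iff)
    have "L2sq M (\<xi> i) \<le> (\<integral>\<^sup>+\<omega>. ennreal (B\<^sup>2) \<partial>M)"
      unfolding L2sq_def by (intro nn_integral_mono ennreal_leI power_mono B) auto
    also have "\<dots> < \<infinity>" by (simp add: emeasure_space_1)
    finally show ?thesis .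
  qed
  then show ?thesis using assms S by simp
qed

lemma elementary_process_measurable:
  assumes "sq_elementary S"
  shows "(\<lambda>(s, \<omega>). elementary_process S s \<omega>) \<in> borel_measurable (time_space t)"
proof -
  obtain N \<tau> \<xi> where S: "S = (N, \<tau>, \<xi>)" by (cases S)
  have [measurable]: "fst \<in> borel_measurable (time_space t)"
    by (rule measurable_compose[OF measurable_fst]) (intro measurable_restrict_space1, simp)
  have [measurable]: "(\<lambda>x. \<xi> i (snd x)) \<in> borel_measurable (time_space t)" if "i < N" for i
    using sq_elementaryD(7)[OF assms[unfolded S] that] by (rule measurable_compose[OF measurable_snd])
  show ?thesis
    unfolding S split_beta elementary_process.simps
    by (intro borel_measurable_sum borel_measurable_scaleR borel_measurable_indicator') simp_all
qed

lemma elementary_integral_measurable: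
  assumes "sq_elementary S" "0 \<le> t" "t \<le> T"
  shows "elementary_integral W S t \<in> borel_measurable M"
proof -
  obtain N \<tau> \<xi> where S: "S = (N, \<tau>, \<xi>)" by (cases S)
  have "elementary_integral W S t = (\<lambda>\<omega>. \<Sum>i<N. \<xi> i \<omega> *v (W (min t (\<tau> (Suc i))) \<omega> - W (min t (\<tau> i)) \<omega>))"
    by (auto simp: S)
  moreover have "\<dots> \<in> borel_measurable M"
    using sq_elementaryD[OF assms(1)[unfolded S]] assms(2,3)
    by (intro borel_measurable_sum borel_measurable_matrix_vector_mult borel_measurable_diff W_measurable) auto
  ultimately show ?thesis by simp
qed

text \<open>The difference becomes one family over the disjoint sum of both index sets, with the
  second coefficients negated and all intervals cut off at t, so that \<open>isometry_family\<close>
  applies.\<close>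

lemma elementary_isometry:
  assumes S: "sq_elementary S" and S': "sq_elementary S'" and t: "0 \<le> t" "t \<le> T"
  shows "L2sq M (\<lambda>\<omega>. elementary_integral W S t \<omega> - elementary_integral W S' t \<omega>) =
    L2sq (time_space t) (\<lambda>(s, \<omega>). elementary_process S s \<omega> - elementary_process S' s \<omega>)"
proof -
  obtain N \<tau> \<xi> where S_eq: "S = (N, \<tau>, \<xi>)" by (cases S)
  obtain N' \<tau>' \<xi>' where S'_eq: "S' = (N', \<tau>', \<xi>')" by (cases S')
  note D = sq_elementaryD[OF S[unfolded S_eq]] and D' = sq_elementaryD[OF S'[unfolded S'_eq]]
  define A where "A = {..<N} <+> {..<N'}"
  define lo where "lo = case_sum (\<lambda>i. min t (\<tau> i)) (\<lambda>i. min t (\<tau>' i))"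
  define hi where "hi = case_sum (\<lambda>i. min t (\<tau> (Suc i))) (\<lambda>i. min t (\<tau>' (Suc i)))"
  define \<zeta> where "\<zeta> = case_sum \<xi> (\<lambda>i \<omega>. - \<xi>' i \<omega>)"
  have sumA: "(\<Sum>i\<in>A. g i) = (\<Sum>i<N. g (Inl i)) + (\<Sum>i<N'. g (Inr i))" for g :: "nat + nat \<Rightarrow> 'c::comm_monoid_add"
    unfolding A_def by (subst sum.Plus) auto
  have iso: "L2sq M (\<lambda>\<omega>. \<Sum>i\<in>A. \<zeta> i \<omega> *v (W (hi i) \<omega> - W (lo i) \<omega>)) =
    (\<integral>\<^sup>+\<omega>. (\<integral>\<^sup>+s. ennreal ((norm (\<Sum>i\<in>A. indicator {lo i<..hi i} s *\<^sub>R \<zeta> i \<omega>))\<^sup>2) \<partial>lborel) \<partial>M)"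
  proof (rule isometry_family)
    show "finite A" by (simp add: A_def)
    fix i assume "i \<in> A"
    then consider k where "i = Inl k" "k < N" | k where "i = Inr k" "k < N'"
      by (auto simp: A_def)
    note cs = this
    show "0 \<le> lo i \<and> lo i \<le> hi i \<and> hi i \<le> T"
      using cs
    proof cases
      case 1 with D[of k] t show ?thesis by (auto simp: lo_def hi_def)
    next
      case 2 with D'[of k] t show ?thesis by (auto simp: lo_def hi_def)
    qed
    show "\<zeta> i \<in> borel_measurable M"
      using cs by cases (use D(7) D'(7) in \<open>simp_all add: \<zeta>_def\<close>)
    show "L2sq M (\<zeta> i) < \<infinity>"
      using cs by cases (use D(8) D'(8) in \<open>simp_all add: \<zeta>_def L2sq_def\<close>)
    \<comment> \<open>A nonempty cut-off interval starts before t, so its left end is still the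
      original partition point and the coefficient is adapted there.\<close>
    assume lt: "lo i < hi i"
    show "\<zeta> i \<in> borel_measurable (F (lo i))"
      using cs
    proof cases
      case 1
      then have "lo i = \<tau> k" using lt by (auto simp: lo_def hi_def min_def split: if_splits)
      then show ?thesis using 1 D(6) by (simp add: \<zeta>_def)
    next
      case 2
      then have "lo i = \<tau>' k" using lt by (auto simp: lo_def hi_def min_def split: if_splits)
      then show ?thesis using 2 D'(6) by (simp add: \<zeta>_def)
    qed
  qed
  have I: "(\<Sum>i\<in>A. \<zeta> i \<omega> *v (W (hi i) \<omega> - W (lo i) \<omega>)) = elementary_integral W S t \<omega> - elementary_integral W S' t \<omega>" for \<omega>
    by (simp add: sumA S_eq S'_eq \<zeta>_def lo_def hi_def minus_matrix_vector_mult sum_negf)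
  \<comment> \<open>Cutting both endpoints at t amounts to intersecting with [0,t]; the condition 0
    \<le> a rules out negative times.\<close>
  have ind: "indicator {min t a<..min t b} s = (indicator {0..t} s * indicator {a<..b} s :: real)" if "0 \<le> a" for a b s :: real
    using that t by (auto simp: indicator_def)
  have s1: "(\<Sum>i<N. indicator {min t (\<tau> i)<..min t (\<tau> (Suc i))} s *\<^sub>R \<xi> i \<omega>) =
      indicator {0..t} s *\<^sub>R (\<Sum>i<N. indicator {\<tau> i<..\<tau> (Suc i)} s *\<^sub>R \<xi> i \<omega>)" for s \<omega>
    unfolding scaleR_sum_right scaleR_scaleR by (intro sum.cong refl) (subst ind, auto simp: D)
  have s2: "(\<Sum>i<N'. indicator {min t (\<tau>' i)<..min t (\<tau>' (Suc i))} s *\<^sub>R \<xi>' i \<omega>) =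
      indicator {0..t} s *\<^sub>R (\<Sum>i<N'. indicator {\<tau>' i<..\<tau>' (Suc i)} s *\<^sub>R \<xi>' i \<omega>)" for s \<omega>
    unfolding scaleR_sum_right scaleR_scaleR by (intro sum.cong refl) (subst ind, auto simp: D')
  have "(\<Sum>i\<in>A. indicator {lo i<..hi i} s *\<^sub>R \<zeta> i \<omega>) =
      indicator {0..t} s *\<^sub>R (elementary_process S s \<omega> - elementary_process S' s \<omega>)" for s \<omega>
    by (simp only: sumA \<zeta>_def lo_def hi_def sum.case S_eq S'_eq elementary_process.simps scaleR_minus_right
      sum_negf s1 s2 scaleR_diff_right add_uminus_conv_diff)
  then have P: "ennreal ((norm (\<Sum>i\<in>A. indicator {lo i<..hi i} s *\<^sub>R \<zeta> i \<omega>))\<^sup>2) =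
      ennreal ((norm (elementary_process S s \<omega> - elementary_process S' s \<omega>))\<^sup>2) * indicator {0..t} s" for s \<omega>
    by (simp add: indicator_def)
  have [measurable]: "(\<lambda>(s, \<omega>). elementary_process S s \<omega>) \<in> borel_measurable (time_space t)"
    "(\<lambda>(s, \<omega>). elementary_process S' s \<omega>) \<in> borel_measurable (time_space t)"
    using S S' by (auto intro: elementary_process_measurable)
  have "(\<lambda>(s, \<omega>). elementary_process S s \<omega> - elementary_process S' s \<omega>) \<in> borel_measurable (time_space t)"
    using borel_measurable_diff[OF elementary_process_measurable[OF S, of t] elementary_process_measurable[OF S', of t]]
    by (simp add: case_prod_beta')
  then show ?thesis
    using iso unfolding I P by (simp add: L2sq_time_pair)
qed

lemma has_ito_integral_bound:
  assumes ito: "has_ito_integral M T F W G t I" and S: "sq_elementary S" and t: "0 \<le> t" "t \<le> T"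
  shows "L2sq M (\<lambda>\<omega>. I \<omega> - elementary_integral W S t \<omega>) \<le>
    4 * L2sq (time_space t) (\<lambda>(s, \<omega>). G s \<omega> - elementary_process S s \<omega>)"
proof -
  let ?P = "time_space t"
  obtain R where R: "\<And>j. elementary_on M T F (R j)"
    and P: "Lp_strong_convergence ?P 2 (\<lambda>j (s, \<omega>). elementary_process (R j) s \<omega>) (\<lambda>(s, \<omega>). G s \<omega>)"
    and I: "Lp_strong_convergence M 2 (\<lambda>j. elementary_integral W (R j) t) I"
    using ito unfolding has_ito_integral_def by blast
  note R' = sq_elementary_if_elementary_on[OF R]
  note Pc = P[unfolded Lp_strong_convergence_2_iff] and Ic = I[unfolded Lp_strong_convergence_2_iff]
  let ?G = "\<lambda>(s, \<omega>). G s \<omega>" and ?E = "\<lambda>S (s, \<omega>). elementary_process S s \<omega>"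
  have mG: "?G \<in> borel_measurable ?P" using Pc by blast
  have mE: "?E S \<in> borel_measurable ?P" if "sq_elementary S" for S
    using elementary_process_measurable[OF that] .
  have mI: "I \<in> borel_measurable M" using Ic by blast
  have bound: "L2sq M (\<lambda>\<omega>. I \<omega> - elementary_integral W S t \<omega>) \<le>
     2 * L2sq M (\<lambda>\<omega>. elementary_integral W (R j) t \<omega> - I \<omega>) +
     2 * (2 * L2sq ?P (\<lambda>x. ?E (R j) x - ?G x) + 2 * L2sq ?P (\<lambda>x. ?G x - ?E S x))" (is "_ \<le> ?u j") for j
  proof -
    have s1: "L2sq M (\<lambda>\<omega>. I \<omega> - elementary_integral W S t \<omega>) \<le>
      2 * L2sq M (\<lambda>\<omega>. I \<omega> - elementary_integral W (R j) t \<omega>) +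
      2 * L2sq M (\<lambda>\<omega>. elementary_integral W (R j) t \<omega> - elementary_integral W S t \<omega>)"
      by (rule L2sq_diff_le[OF mI elementary_integral_measurable[OF S t] elementary_integral_measurable[OF R' t]])
    have s2: "L2sq M (\<lambda>\<omega>. I \<omega> - elementary_integral W (R j) t \<omega>) =
      L2sq M (\<lambda>\<omega>. elementary_integral W (R j) t \<omega> - I \<omega>)"
      by (rule L2sq_minus_commute)
    have s3: "L2sq M (\<lambda>\<omega>. elementary_integral W (R j) t \<omega> - elementary_integral W S t \<omega>) =
      L2sq ?P (\<lambda>x. ?E (R j) x - ?E S x)"
      unfolding elementary_isometry[OF R' S t] by (simp add: case_prod_beta')
    have s4: "L2sq ?P (\<lambda>x. ?E (R j) x - ?E S x) \<le>
        2 * L2sq ?P (\<lambda>x. ?E (R j) x - ?G x) + 2 * L2sq ?P (\<lambda>x. ?G x - ?E S x)"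
      by (rule L2sq_diff_le[OF mE[OF R'] mE[OF S] mG])
    show ?thesis
      by (rule order_trans[OF s1]) (unfold s2 s3, intro add_mono mult_left_mono s4 order_refl, simp)
  qed
  have "?u \<longlonglongrightarrow> 2 * 0 + 2 * (2 * 0 + 2 * L2sq ?P (\<lambda>x. ?G x - ?E S x))"
    using Pc Ic by (intro tendsto_add tendsto_const ennreal_tendsto_cmult) auto
  then have "L2sq M (\<lambda>\<omega>. I \<omega> - elementary_integral W S t \<omega>) \<le> 2 * 0 + 2 * (2 * 0 + 2 * L2sq ?P (\<lambda>x. ?G x - ?E S x))"
    using bound by (intro LIMSEQ_le_const) auto
  also have "\<dots> = 4 * L2sq ?P (\<lambda>x. ?G x - ?E S x)"
    by (simp add: mult.assoc[symmetric])
  finally show ?thesis by (simp add: case_prod_beta')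
qed

end

section \<open>Existence of the Ito integral\<close>

lemma ennreal_quarters: "0 \<le> e \<Longrightarrow> 2 * ennreal (e / 4) + 2 * ennreal (e / 4) = ennreal e"
  using ennreal_mult[of 2 "e / 4"] ennreal_plus[of "e / 2" "e / 2"] by simp

context wiener_space
begin

text \<open>Pointwise the difference is eventually 0, and the squared norm of \<xi> is an integrable
  majorant.\<close>

lemma L2sq_truncation_small:
  fixes \<xi> :: "'w \<Rightarrow> 'b::{real_normed_vector, second_countable_topology}"
  assumes [measurable]: "\<xi> \<in> borel_measurable M" and fin: "L2sq M \<xi> < \<infinity>" and "0 < (e::real)"
  shows "\<forall>\<^sub>F K in sequentially. L2sq M (\<lambda>\<omega>. \<xi> \<omega> - (if norm (\<xi> \<omega>) \<le> real K then \<xi> \<omega> else 0)) < ennreal e"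
proof -
  have "(\<lambda>K. L2sq M (\<lambda>\<omega>. \<xi> \<omega> - (if norm (\<xi> \<omega>) \<le> real K then \<xi> \<omega> else 0))) \<longlonglongrightarrow> (\<integral>\<^sup>+\<omega>. 0 \<partial>M)"
    unfolding L2sq_def
  proof (rule nn_integral_dominated_convergence[where w="\<lambda>\<omega>. ennreal ((norm (\<xi> \<omega>))\<^sup>2)"])
    show "AE \<omega> in M. (\<lambda>K. ennreal ((norm (\<xi> \<omega> - (if norm (\<xi> \<omega>) \<le> real K then \<xi> \<omega> else 0)))\<^sup>2)) \<longlonglongrightarrow> 0"
    proof (intro AE_I2 tendsto_eventually)
      fix \<omega>
      obtain K0 where K0: "norm (\<xi> \<omega>) \<le> real K0" using real_arch_simple by blast
      show "\<forall>\<^sub>F K in sequentially. ennreal ((norm (\<xi> \<omega> - (if norm (\<xi> \<omega>) \<le> real K then \<xi> \<omega> else 0)))\<^sup>2) = 0"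
        using eventually_ge_at_top[of K0]
      proof eventually_elim
        case (elim K)
        then have "norm (\<xi> \<omega>) \<le> real K" using K0 by linarith
        then show ?case by simp
      qed
    qed
    show "(\<integral>\<^sup>+\<omega>. ennreal ((norm (\<xi> \<omega>))\<^sup>2) \<partial>M) < \<infinity>" using fin by (simp add: L2sq_def)
  qed auto
  then show ?thesis using \<open>0 < e\<close> by (intro order_tendstoD) auto
qed

text \<open>Truncating the values of the coefficients preserves partition and adaptedness and yields
  the bounded coefficients that the definition of the Ito integral demands.\<close>

lemma elementary_on_approximates:
  assumes S: "sq_elementary S" and e: "0 < (e::real)"
  obtains S' where "elementary_on M T F S'"
    "L2sq (time_space T) (\<lambda>(s, \<omega>). elementary_process S s \<omega> - elementary_process S' s \<omega>) \<le> ennreal e"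
proof -
  obtain N \<tau> \<xi> where S_eq: "S = (N, \<tau>, \<xi>)" by (cases S)
  note D = sq_elementaryD[OF S[unfolded S_eq]]
  let ?P = "time_space T"
  have "0 \<le> T"
    using S mono_partition_le[of N \<tau> 0 N] unfolding S_eq by auto
  \<comment> \<open>One factor N comes from Cauchy-Schwarz for N summands, the other from adding N
    equal bounds; T bounds the length of each interval, and the 1 keeps the denominator
    positive.\<close>
  define d where "d = e / (real (N * N) * T + 1)"
  have d: "d > 0" "real (N * N) * (T * d) \<le> e"
    using e \<open>0 \<le> T\<close> by (auto simp: d_def field_simps add_pos_nonneg intro!: divide_pos_pos add_nonneg_pos)
  define tr where "tr K i \<omega> = (if norm (\<xi> i \<omega>) \<le> real K then \<xi> i \<omega> else 0)" for K i \<omega>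
  have "\<forall>\<^sub>F K in sequentially. \<forall>i\<in>{..<N}. L2sq M (\<lambda>\<omega>. \<xi> i \<omega> - tr K i \<omega>) < ennreal d"
    unfolding tr_def using D(7,8) d(1) by (intro eventually_ball_finite ballI L2sq_truncation_small) auto
  then obtain K where K: "\<And>i. i < N \<Longrightarrow> L2sq M (\<lambda>\<omega>. \<xi> i \<omega> - tr K i \<omega>) < ennreal d"
    using eventually_happens[of _ sequentially] by (auto simp: Ball_def)
  have mtr: "tr K i \<in> borel_measurable (F (\<tau> i))" if "i < N" for i
    using D(6)[OF that] unfolding tr_def[abs_def] by measurable
  have mtr': "tr K i \<in> borel_measurable M" if "i < N" for i
    using D(7)[OF that] unfolding tr_def[abs_def] by measurable
  have "bounded (tr K i ` space M)" for i
    by (auto simp: bounded_iff tr_def intro!: exI[of _ "real K"])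
  then have S': "elementary_on M T F (N, \<tau>, tr K)"
    using S mtr by (simp add: S_eq)
  have fstm: "fst \<in> borel_measurable ?P"
    by (rule measurable_compose[OF measurable_fst]) (intro measurable_restrict_space1, simp)
  let ?f = "\<lambda>i (s, \<omega>). indicator {\<tau> i<..\<tau> (Suc i)} s *\<^sub>R (\<xi> i \<omega> - tr K i \<omega>)"
  have mf: "?f i \<in> borel_measurable ?P" if "i < N" for i
    unfolding split_beta using D(7)[OF that] mtr'[OF that] fstm
    by (intro borel_measurable_scaleR borel_measurable_indicator' borel_measurable_diff measurable_compose[OF measurable_snd]) auto
  have fi: "L2sq ?P (?f i) \<le> ennreal (T * d)" if i: "i < N" for i
  proof -
    have "L2sq ?P (?f i) \<le> (\<integral>\<^sup>+\<omega>. (\<integral>\<^sup>+s. ennreal ((norm (\<xi> i \<omega> - tr K i \<omega>))\<^sup>2) * indicator {0..T} s \<partial>lborel) \<partial>M)"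
      unfolding L2sq_time_pair[OF mf[OF i]] by (intro nn_integral_mono) (auto simp: indicator_def)
    also have "\<dots> = (\<integral>\<^sup>+\<omega>. ennreal T * ennreal ((norm (\<xi> i \<omega> - tr K i \<omega>))\<^sup>2) \<partial>M)"
      using \<open>0 \<le> T\<close> by (subst nn_integral_cmult_indicator) (simp, simp add: mult.commute)
    also have "\<dots> = ennreal T * L2sq M (\<lambda>\<omega>. \<xi> i \<omega> - tr K i \<omega>)"
      unfolding L2sq_def using D(7)[OF i] mtr'[OF i] by (intro nn_integral_cmult) measurable
    also have "\<dots> \<le> ennreal T * ennreal d"
      by (intro mult_left_mono less_imp_le[OF K[OF i]]) simp
    finally show ?thesis using \<open>0 \<le> T\<close> d by (simp add: ennreal_mult)
  qed
  have eq: "(\<lambda>(s, \<omega>). elementary_process S s \<omega> - elementary_process (N, \<tau>, tr K) s \<omega>) = (\<lambda>x. \<Sum>i<N. ?f i x)"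
    by (auto simp only: fun_eq_iff S_eq elementary_process.simps sum_subtractf[symmetric] scaleR_diff_right split_beta split: prod.split)
  have "L2sq ?P (\<lambda>x. \<Sum>i<N. ?f i x) \<le> of_nat (card {..<N}) * (\<Sum>i<N. L2sq ?P (?f i))"
    using mf by (intro L2sq_sum_le) auto
  also have "\<dots> \<le> of_nat (card {..<N}) * (\<Sum>i<N. ennreal (T * d))"
    by (intro mult_left_mono sum_mono fi) auto
  also have "\<dots> = ennreal (real (N * N) * (T * d))"
    using \<open>0 \<le> T\<close> d(1) by (simp add: ennreal_of_nat_eq_real_of_nat ennreal_mult[symmetric] mult.assoc)
  also have "\<dots> \<le> ennreal e" by (intro ennreal_leI d)
  finally show thesis using that[OF S'] eq by simp
qed

text \<open>Approximants are truncated to bounded ones, and the isometry makes their integrals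
  Cauchy in mean square. Approximation on [0,T] serves every t by restriction.\<close>

lemma has_ito_integral_exists:
  fixes G :: "real \<Rightarrow> 'w \<Rightarrow> real ^ 'k ^ 'm"
  assumes pred: "predictable_process M T F G"
    and mG: "(\<lambda>(s, \<omega>). G s \<omega>) \<in> borel_measurable (time_space T)"
    and fin: "L2sq (time_space T) (\<lambda>(s, \<omega>). G s \<omega>) < \<infinity>"
    and approx: "\<And>e::real. e > 0 \<Longrightarrow> \<exists>S. sq_elementary S \<and>
      L2sq (time_space T) (\<lambda>(s, \<omega>). G s \<omega> - elementary_process S s \<omega>) \<le> ennreal e"
    and t: "0 \<le> t" "t \<le> T"
  shows "\<exists>I. has_ito_integral M T F W G t I"
proof -
  let ?Q = "time_space T" and ?P = "time_space t"
  let ?G = "\<lambda>(s, \<omega>). G s \<omega>" and ?E = "\<lambda>S (s, \<omega>). elementary_process S s \<omega>"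
  have mE: "sq_elementary S \<Longrightarrow> ?E S \<in> borel_measurable (time_space u)" for S :: "('w, real ^ 'k ^ 'm) elementary" and u
    by (rule elementary_process_measurable)
  have "\<exists>S. elementary_on M T F S \<and> L2sq ?Q (\<lambda>x. ?G x - ?E S x) \<le> ennreal e" if "e > 0" for e
  proof -
    have e4: "e / 4 > 0" using that by simp
    have split_diff: "(\<lambda>(s, \<omega>). f s \<omega> - g s \<omega>) = (\<lambda>x. (case x of (s, \<omega>) \<Rightarrow> f s \<omega>) - (case x of (s, \<omega>) \<Rightarrow> g s \<omega>))"
      for f g :: "real \<Rightarrow> 'w \<Rightarrow> real ^ 'k ^ 'm"
      by auto
    obtain S where S: "sq_elementary S" "L2sq ?Q (\<lambda>x. ?G x - ?E S x) \<le> ennreal (e/4)"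
      using approx[OF e4, unfolded split_diff] by blast
    obtain S' where S': "elementary_on M T F S'" "L2sq ?Q (\<lambda>x. ?E S x - ?E S' x) \<le> ennreal (e/4)"
      using elementary_on_approximates[OF S(1) e4, unfolded split_diff] by blast
    have "L2sq ?Q (\<lambda>x. ?G x - ?E S' x) \<le> 2 * L2sq ?Q (\<lambda>x. ?G x - ?E S x) + 2 * L2sq ?Q (\<lambda>x. ?E S x - ?E S' x)"
      by (rule L2sq_diff_le[OF mG mE[OF sq_elementary_if_elementary_on[OF S'(1)]] mE[OF S(1)]])
    also have "\<dots> \<le> 2 * ennreal (e/4) + 2 * ennreal (e/4)"
      by (intro add_mono mult_left_mono S S') auto
    also have "\<dots> = ennreal e"
      by (rule ennreal_quarters) (use that in simp)
    finally show ?thesis using S'(1) by blast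
  qed
  then have "\<forall>j. \<exists>S. elementary_on M T F S \<and> L2sq ?Q (\<lambda>x. ?G x - ?E S x) \<le> ennreal ((1/2)^j)"
    by simp
  from choice[OF this]
  obtain S where S0: "\<forall>j. elementary_on M T F (S j) \<and> L2sq ?Q (\<lambda>x. ?G x - ?E (S j) x) \<le> ennreal ((1/2)^j)" ..
  have S: "elementary_on M T F (S j)" and SG: "L2sq ?Q (\<lambda>x. ?G x - ?E (S j) x) \<le> ennreal ((1/2)^j)" for j
    using spec[OF S0, of j] by (rule conjunct1, rule conjunct2)
  note S' = sq_elementary_if_elementary_on[OF S]
  have mG': "?G \<in> borel_measurable ?P" by (rule measurable_time_pair_mono[OF mG t(2)])
  have SG': "L2sq ?P (\<lambda>x. ?G x - ?E (S j) x) \<le> ennreal ((1/2)^j)" for j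
    using L2sq_time_pair_mono[OF borel_measurable_diff[OF mG mE[OF S']] t(2)] SG by (rule order_trans)
  have finG: "L2sq ?P ?G < \<infinity>"
    using L2sq_time_pair_mono[OF mG t(2)] fin by (rule le_less_trans)
  have finE: "L2sq ?P (?E (S j)) < \<infinity>" for j
  proof -
    have "L2sq ?P (?E (S j)) \<le> 2 * L2sq ?P (\<lambda>x. ?E (S j) x - ?G x) + 2 * L2sq ?P ?G"
      using L2sq_diff_le[of "?E (S j)" ?P "\<lambda>_. 0" ?G, OF mE[OF S'] borel_measurable_const mG'] by simp
    also have "\<dots> \<le> 2 * ennreal ((1/2)^j) + 2 * L2sq ?P ?G"
      by (subst L2sq_minus_commute) (intro add_mono mult_left_mono SG' order_refl, simp_all)
    also have "\<dots> < \<infinity>" using finG by (simp add: ennreal_mult_less_top)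
    finally show ?thesis .
  qed
  have iso: "L2sq M (\<lambda>\<omega>. elementary_integral W (S i) t \<omega> - elementary_integral W (S j) t \<omega>) =
    L2sq ?P (\<lambda>x. ?E (S i) x - ?E (S j) x)" for i j
    unfolding elementary_isometry[OF S' S' t] by (simp add: case_prod_beta')
  have mI: "elementary_integral W (S j) t \<in> borel_measurable M" for j
    by (rule elementary_integral_measurable[OF S' t])
  have finI: "L2sq M (elementary_integral W (S j) t) < \<infinity>" for j
  proof -
    \<comment> \<open>Comparison with the empty elementary process turns the isometry for
      differences into one for a single integral.\<close>
    have "sq_elementary (0, \<lambda>_. 0, \<lambda>_ _. 0 :: real ^ 'k ^ 'm)" using t by simp
    from elementary_isometry[OF S' this t, of j] show ?thesis
      using finE[of j] by simp
  qed
  have "\<exists>N. \<forall>m\<ge>N. \<forall>n\<ge>N. L2sq M (\<lambda>\<omega>. elementary_integral W (S m) t \<omega> - elementary_integral W (S n) t \<omega>) \<le> ennreal e"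
    if "e > 0" for e
  proof -
    obtain N where N: "(1/2::real)^N < e/4"
      using real_arch_pow_inv[of "e/4" "1/2"] \<open>e > 0\<close> by auto
    have "L2sq M (\<lambda>\<omega>. elementary_integral W (S m) t \<omega> - elementary_integral W (S n) t \<omega>) \<le> ennreal e"
      if mn: "m \<ge> N" "n \<ge> N" for m n
    proof -
      have le: "L2sq ?P (\<lambda>x. ?G x - ?E (S k) x) \<le> ennreal (e/4)" if "k \<ge> N" for k
      proof -
        have "(1/2::real)^k \<le> (1/2)^N" using that by (intro power_decreasing) auto
        then show ?thesis using SG'[of k] N by (intro order_trans[OF SG'] ennreal_leI) linarith
      qed
      have "L2sq ?P (\<lambda>x. ?E (S m) x - ?E (S n) x) \<le> 2 * L2sq ?P (\<lambda>x. ?E (S m) x - ?G x) + 2 * L2sq ?P (\<lambda>x. ?G x - ?E (S n) x)"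
        by (rule L2sq_diff_le[OF mE[OF S'] mE[OF S'] mG'])
      also have "\<dots> \<le> 2 * ennreal (e/4) + 2 * ennreal (e/4)"
        using le[OF mn(1)] le[OF mn(2)] by (subst L2sq_minus_commute) (intro add_mono mult_left_mono, simp_all)
      also have "\<dots> = ennreal e"
        by (rule ennreal_quarters) (use \<open>e > 0\<close> in simp)
      finally show ?thesis unfolding iso by simp
    qed
    then show ?thesis by blast
  qed
  note Cauchy = this
  obtain r I where r: "strict_mono r" and I: "I \<in> borel_measurable M" "L2sq M I < \<infinity>"
    "(\<lambda>n. L2sq M (\<lambda>\<omega>. elementary_integral W (S (r n)) t \<omega> - I \<omega>)) \<longlonglongrightarrow> 0"
    by (rule L2sq_Cauchy_subseq_converges[where f="\<lambda>j. elementary_integral W (S j) t", OF mI finI Cauchy])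
  have "(\<lambda>n. L2sq ?P (\<lambda>x. ?E (S (r n)) x - ?G x)) \<longlonglongrightarrow> 0"
  proof (rule ennreal_tendsto_0_le)
    fix n
    \<comment> \<open>Strict monotonicity gives \<open>r n \<ge> n\<close>, so the rate survives the
      passage to the subsequence.\<close>
    have "(1/2::real)^(r n) \<le> (1/2)^n"
      using seq_suble[OF r, of n] by (intro power_decreasing) auto
    then show "L2sq ?P (\<lambda>x. ?E (S (r n)) x - ?G x) \<le> ennreal ((1/2)^n)"
      by (subst L2sq_minus_commute) (rule order_trans[OF SG' ennreal_leI])
    have "(\<lambda>k. ennreal ((1/2)^k)) \<longlonglongrightarrow> ennreal 0"
      by (rule tendsto_ennrealI, rule LIMSEQ_power_zero) simp
    then show "(\<lambda>k. ennreal ((1/2)^k)) \<longlonglongrightarrow> 0" by simp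
  qed
  then have "has_ito_integral M T F W G t I"
    unfolding has_ito_integral_def Lp_strong_convergence_2_iff
    using pred S mE[OF S'] finE mG' finG mI finI I
    by (intro conjI exI[of _ "\<lambda>n. S (r n)"]) (auto simp: case_prod_beta')
  then show ?thesis by blast
qed

end

section \<open>Averages over cells\<close>

text \<open>Values outside [0,T] are arbitrary, but translates and the delayed cell before time 0
  reach there; this fixes them.\<close>

definition zero_ext :: "real \<Rightarrow> (real \<Rightarrow> 'w \<Rightarrow> 'b::real_vector) \<Rightarrow> real \<Rightarrow> 'w \<Rightarrow> 'b" where
  "zero_ext T G s \<omega> = indicator {0..T} s *\<^sub>R G s \<omega>"

text \<open>The times before h are included, where the translate is zero. For h > T the translate
  vanishes altogether and the squared norm itself is left.\<close>

definition translation_modulus ::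
  "'w measure \<Rightarrow> real \<Rightarrow> (real \<Rightarrow> 'w \<Rightarrow> 'b::real_normed_vector) \<Rightarrow> real \<Rightarrow> ennreal" where
  "translation_modulus M T G h = (\<integral>\<^sup>+\<omega>. (\<integral>\<^sup>+s. ennreal ((norm (zero_ext T G s \<omega> - zero_ext T G (s - h) \<omega>))\<^sup>2)
      * indicator {0..T} s \<partial>lborel) \<partial>M)"

text \<open>Ends where the i-th cell of the step process begins. For i = 0 it meets [0,T] only in
  the point 0, so the first average is 0.\<close>

abbreviation "delayed_cell T N i \<equiv> {real i * (T / real N) - T / real N<..real i * (T / real N)}"

text \<open>The cell averages are delayed by one cell, which makes them adapted.\<close>

definition cell_average :: "real \<Rightarrow> nat \<Rightarrow> (real \<Rightarrow> 'w \<Rightarrow> 'b) \<Rightarrow> nat \<Rightarrow> 'w \<Rightarrow> 'b::{banach, second_countable_topology}" where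
  "cell_average T N G i \<omega> = (real N / T) *\<^sub>R
     (\<integral>s. indicator (delayed_cell T N i) s *\<^sub>R zero_ext T G s \<omega> \<partial>lborel)"

definition averaged :: "real \<Rightarrow> nat \<Rightarrow> (real \<Rightarrow> 'w \<Rightarrow> 'b) \<Rightarrow> ('w, 'b::{banach, second_countable_topology}) elementary" where
  "averaged T N G = (N, \<lambda>i. real i * (T / N), cell_average T N G)"

text \<open>Jensen's inequality for the square, obtained from Cauchy-Schwarz on the interval; the
  right side may be infinite.\<close>

lemma norm_average_diff_sq_le:
  fixes f :: "real \<Rightarrow> 'b::{banach, second_countable_topology}"
  assumes cd: "c < d" and int: "integrable lborel (\<lambda>s. indicator {c<..d} s *\<^sub>R f s)"
    and [measurable]: "f \<in> borel_measurable borel"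
  shows "ennreal ((norm ((1 / (d - c)) *\<^sub>R (\<integral>s. indicator {c<..d} s *\<^sub>R f s \<partial>lborel) - x))\<^sup>2) \<le>
    ennreal (1 / (d - c)) * (\<integral>\<^sup>+s. ennreal ((norm (f s - x))\<^sup>2) * indicator {c<..d} s \<partial>lborel)"
proof -
  let ?L = "d - c"
  define g where "g s = indicator {c<..d} s *\<^sub>R f s - indicator {c<..d} s *\<^sub>R x" for s
  have L: "?L > 0" using cd by simp
  have ix: "integrable lborel (\<lambda>s. indicator {c<..d} s *\<^sub>R x)"
    using cd by (intro integrable_scaleR_left integrable_real_indicator) auto
  have ig: "integrable lborel g"
    unfolding g_def by (intro Bochner_Integration.integrable_diff int ix)
  have "(\<integral>s. g s \<partial>lborel) = (\<integral>s. indicator {c<..d} s *\<^sub>R f s \<partial>lborel) - ?L *\<^sub>R x"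
    unfolding g_def using int ix cd by (simp add: measure_def)
  then have eq: "(1 / ?L) *\<^sub>R (\<integral>s. indicator {c<..d} s *\<^sub>R f s \<partial>lborel) - x = (1 / ?L) *\<^sub>R (\<integral>s. g s \<partial>lborel)"
    using L by (simp add: scaleR_diff_right)
  let ?X = "\<integral>\<^sup>+s. ennreal ((norm (f s - x))\<^sup>2) * indicator {c<..d} s \<partial>lborel"
  have "(ennreal (norm (\<integral>s. g s \<partial>lborel)))\<^sup>2 \<le> (\<integral>\<^sup>+s. ennreal (norm (g s)) \<partial>lborel)\<^sup>2"
    by (intro power_mono integral_norm_bound_ennreal ig) simp
  also have "(\<integral>\<^sup>+s. ennreal (norm (g s)) \<partial>lborel) = (\<integral>\<^sup>+s. indicator {c<..d} s * ennreal (norm (f s - x)) \<partial>lborel)"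
    by (intro nn_integral_cong) (auto simp: g_def indicator_def)
  also have "\<dots>\<^sup>2 \<le> (\<integral>\<^sup>+s. (indicator {c<..d} s)\<^sup>2 \<partial>lborel) * (\<integral>\<^sup>+s. (indicator {c<..d} s * ennreal (norm (f s - x)))\<^sup>2 \<partial>lborel)"
  proof -
    have "(\<integral>\<^sup>+s. indicator {c<..d} s * ennreal (norm (f s - x)) \<partial>lborel) =
      (\<integral>\<^sup>+s. indicator {c<..d} s * (indicator {c<..d} s * ennreal (norm (f s - x))) \<partial>lborel)"
      by (intro nn_integral_cong) (auto simp: indicator_def)
    then show ?thesis
      using Cauchy_Schwarz_nn_integral[of "indicator {c<..d}" lborel "\<lambda>s. indicator {c<..d} s * ennreal (norm (f s - x))"]
      by simp
  qed
  also have "(\<integral>\<^sup>+s. (indicator {c<..d} s)\<^sup>2 \<partial>lborel) = (\<integral>\<^sup>+s. indicator {c<..d} s \<partial>lborel)"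
    by (intro nn_integral_cong) (auto simp: indicator_def)
  also have "\<dots> = ennreal ?L" using cd by simp
  also have "(\<integral>\<^sup>+s. (indicator {c<..d} s * ennreal (norm (f s - x)))\<^sup>2 \<partial>lborel) = ?X"
    by (intro nn_integral_cong) (auto simp: indicator_def ennreal_power)
  finally have *: "ennreal ((norm (\<integral>s. g s \<partial>lborel))\<^sup>2) \<le> ennreal ?L * ?X"
    by (simp add: ennreal_power)
  have "ennreal ((norm ((1 / ?L) *\<^sub>R (\<integral>s. g s \<partial>lborel)))\<^sup>2) = ennreal ((1 / ?L)\<^sup>2) * ennreal ((norm (\<integral>s. g s \<partial>lborel))\<^sup>2)"
    using L by (simp add: power_mult_distrib ennreal_mult[symmetric] power_divide)
  also have "\<dots> \<le> ennreal ((1 / ?L)\<^sup>2) * (ennreal ?L * ?X)"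
    by (intro mult_left_mono *) simp
  also have "\<dots> = ennreal (1 / ?L) * ?X"
  proof -
    have "ennreal ((1 / ?L)\<^sup>2) * ennreal ?L = ennreal (1 / ?L)"
      using L by (subst ennreal_mult[symmetric]) (auto simp: power2_eq_square)
    then show ?thesis by (simp add: mult.assoc[symmetric])
  qed
  finally show ?thesis unfolding eq .
qed

lemma partition_cell_exists:
  fixes t \<delta> :: real
  assumes "0 < t" "t \<le> real N * \<delta>" "0 < \<delta>"
  obtains i where "i < N" "real i * \<delta> < t" "t \<le> real (Suc i) * \<delta>"
proof -
  \<comment> \<open>Cells are open on the left, so the index i with i \<delta> < t \<le> (i + 1)
    \<delta> is one less than the ceiling of t / \<delta>.\<close>
  define n where "n = nat \<lceil>t / \<delta>\<rceil>"
  have n: "real n = \<lceil>t / \<delta>\<rceil>" using assms by (simp add: n_def)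
  have "n > 0" using assms by (simp add: n_def)
  then obtain i where i: "n = Suc i" by (cases n) auto
  have "t / \<delta> \<le> real (Suc i)" "real (Suc i) - 1 < t / \<delta>"
    using n unfolding i by linarith+
  then have 1: "t \<le> real (Suc i) * \<delta>" "real i * \<delta> < t"
    using assms by (simp_all add: field_simps)
  then have "real i * \<delta> < real N * \<delta>" using assms by linarith
  then have "i < N" using assms by simp
  then show thesis using that 1 by blast
qed

lemma elementary_process_averaged:
  assumes "0 < t" "t \<le> T" "N > 0"
  obtains i where "i < N" "real i * (T / N) < t" "t \<le> real (Suc i) * (T / N)"
    "elementary_process (averaged T N G) t \<omega> = cell_average T N G i \<omega>"
proof -
  let ?\<delta> = "T / N"
  have \<delta>: "?\<delta> > 0" "real N * ?\<delta> = T" using assms by auto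
  obtain i where i: "i < N" "real i * ?\<delta> < t" "t \<le> real (Suc i) * ?\<delta>"
    using partition_cell_exists[of t N ?\<delta>] assms \<delta> by auto
  have "indicator {real j * ?\<delta><..real (Suc j) * ?\<delta>} t = (if j = i then 1 else 0 :: real)" for j
  proof (cases j i rule: linorder_cases)
    case less
    then have "real (Suc j) * ?\<delta> \<le> real i * ?\<delta>" using \<delta> by (intro mult_right_mono) auto
    then show ?thesis using i less by (auto simp: indicator_def)
  next
    case greater
    then have "real (Suc i) * ?\<delta> \<le> real j * ?\<delta>" using \<delta> by (intro mult_right_mono) auto
    then show ?thesis using i greater by (auto simp: indicator_def)
  qed (use i in auto)
  then have "elementary_process (averaged T N G) t \<omega> = (\<Sum>j<N. (if j = i then 1 else 0) *\<^sub>R cell_average T N G j \<omega>)"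
    unfolding averaged_def elementary_process.simps by (simp only:)
  also have "\<dots> = (\<Sum>j<N. if j = i then cell_average T N G j \<omega> else 0)"
    by (intro sum.cong) auto
  also have "\<dots> = cell_average T N G i \<omega>" using i by simp
  finally show thesis using that i by blast
qed

section \<open>Progressive measurability and adaptedness of the averages\<close>

context wiener_space
begin

text \<open>It suffices to restrict the generating rectangles to [0,u]: one that starts after u has
  empty trace, any other has its event in \<open>F u\<close>. The sigma-algebra \<open>N\<close> is
  left open because it is taken to be \<open>F u\<close> for the adaptedness of averages and
  \<open>M\<close> for joint measurability.\<close>

lemma predictable_progressive:
  assumes G: "predictable_process M T F G" and u: "0 \<le> u" "u \<le> T"
    and N: "space N = space M" "sets (F u) \<subseteq> sets N"
  shows "(\<lambda>(s, \<omega>). G s \<omega>) \<in> borel_measurable (time_measure u \<Otimes>\<^sub>M N)"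
proof -
  have sp: "space (time_measure u \<Otimes>\<^sub>M N) = {0..u} \<times> space M"
    by (simp add: space_pair_measure N(1) space_restrict_space)
  have tm: "X \<inter> {0..u} \<in> sets (time_measure u)" if "X \<in> sets borel" for X
    using that by (auto simp: sets_restrict_space)
  have "(\<lambda>x. x) \<in> (time_measure u \<Otimes>\<^sub>M N) \<rightarrow>\<^sub>M predictable_algebra M T F"
    unfolding predictable_algebra_def
  proof (rule measurable_measure_of)
    show "(\<lambda>x. x) \<in> space (time_measure u \<Otimes>\<^sub>M N) \<rightarrow> {0..T} \<times> space M"
      unfolding sp using u by auto
    have sub: "A \<subseteq> space M" if "A \<in> sets (F s)" "0 \<le> s" "s \<le> T" for A s
      using sets.sets_into_space[OF that(1)] space_F[OF that(2,3)] by simp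
    show "{{0} \<times> A |A. A \<in> sets (F 0)} \<union> {{s<..t} \<times> A |s t A. 0 \<le> s \<and> s \<le> t \<and> t \<le> T \<and> A \<in> sets (F s)} \<subseteq> Pow ({0..T} \<times> space M)"
      using u sub by (auto; force)
    fix y
    assume "y \<in> {{0} \<times> A |A. A \<in> sets (F 0)} \<union> {{s<..t} \<times> A |s t A. 0 \<le> s \<and> s \<le> t \<and> t \<le> T \<and> A \<in> sets (F s)}"
    then consider A where "y = {0} \<times> A" "A \<in> sets (F 0)"
      | s t A where "y = {s<..t} \<times> A" "0 \<le> s" "s \<le> t" "t \<le> T" "A \<in> sets (F s)"
      by blast
    then show "(\<lambda>x. x) -` y \<inter> space (time_measure u \<Otimes>\<^sub>M N) \<in> sets (time_measure u \<Otimes>\<^sub>M N)"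
    proof cases
      case 1
      then have "A \<in> sets N" using sets_F_mono[of 0 u] u N(2) by auto
      moreover have "(\<lambda>x. x) -` y \<inter> space (time_measure u \<Otimes>\<^sub>M N) = ({0} \<inter> {0..u}) \<times> A"
        using 1 u sub[of A 0] unfolding sp by auto
      ultimately show ?thesis using tm[of "{0}"] by (simp del: Int_insert_left_if1)
    next
      case 2
      have eq: "(\<lambda>x. x) -` y \<inter> space (time_measure u \<Otimes>\<^sub>M N) = ({s<..t} \<inter> {0..u}) \<times> A"
        using 2 u sub[of A s] unfolding sp by auto
      show ?thesis
      proof (cases "s \<le> u")
        case True
        then have "A \<in> sets N" using sets_F_mono[of s u] 2 u N(2) by auto
        then show ?thesis unfolding eq using tm[of "{s<..t}"] by simp
      next
        case False
        then have empty: "({s<..t} \<inter> {0..u}) \<times> A = {}" by auto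
        show ?thesis unfolding eq empty by simp
      qed
    qed
  qed
  from measurable_compose[OF this G[unfolded predictable_process_def]]
  show ?thesis by simp
qed

lemma zero_ext_measurable:
  fixes G :: "real \<Rightarrow> 'w \<Rightarrow> 'b::{real_normed_vector, second_countable_topology}"
  assumes G: "(\<lambda>(s, \<omega>). G s \<omega>) \<in> borel_measurable (time_space T)" and T: "0 \<le> T"
    and f: "f \<in> borel_measurable N" and g: "g \<in> N \<rightarrow>\<^sub>M M"
  shows "(\<lambda>x. zero_ext T G (f x) (g x)) \<in> borel_measurable N"
proof -
  \<comment> \<open>Clamping the time to [0,T] keeps the argument where G is known to be measurable;
    the indicator hides the altered values.\<close>
  have "(\<lambda>s. max 0 (min T s)) \<in> borel \<rightarrow>\<^sub>M time_measure T"
    using T by (intro measurable_restrict_space2) auto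
  then have "(\<lambda>x. (max 0 (min T (f x)), g x)) \<in> N \<rightarrow>\<^sub>M time_space T"
    using measurable_compose[OF f] g by (intro measurable_Pair) auto
  from measurable_compose[OF this G]
  have "(\<lambda>x. G (max 0 (min T (f x))) (g x)) \<in> borel_measurable N" by simp
  moreover have "(\<lambda>x. zero_ext T G (f x) (g x)) = (\<lambda>x. indicator {0..T} (f x) *\<^sub>R G (max 0 (min T (f x))) (g x))"
    by (intro ext) (auto simp: zero_ext_def indicator_def max_def min_def)
  ultimately show ?thesis
    using f by simp
qed

text \<open>The integral sees only times up to the left end of the i-th cell, so progressive
  measurability up to that time and Fubini give measurability in \<omega>. This is the benefit of
  the delay.\<close>

lemma cell_average_measurable:
  fixes G :: "real \<Rightarrow> 'w \<Rightarrow> 'b::{banach, second_countable_topology}"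
  assumes G: "predictable_process M T F G" and T: "0 < T" and i: "i < N"
  shows "cell_average T N G i \<in> borel_measurable (F (real i * (T / N)))"
proof -
  let ?u = "real i * (T / N)"
  have u: "0 \<le> ?u" "?u \<le> T" using T i by (auto simp: field_simps)
  have eq: "cell_average T N G i = (\<lambda>\<omega>. (real N / T) *\<^sub>R (\<integral>s. indicator {?u - T / N<..?u} s *\<^sub>R G s \<omega> \<partial>time_measure ?u))"
    unfolding cell_average_def fun_eq_iff using u
    by (auto simp: integral_restrict_space zero_ext_def indicator_def intro!: Bochner_Integration.integral_cong arg_cong2[where f=scaleR])
  have m: "(\<lambda>(s, \<omega>). G s \<omega>) \<in> borel_measurable (time_measure ?u \<Otimes>\<^sub>M F ?u)"
    using u by (intro predictable_progressive[OF G] space_F) auto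
  have "(\<lambda>(\<omega>, s). indicator {?u - T / N<..?u} s *\<^sub>R G s \<omega>) \<in> borel_measurable (F ?u \<Otimes>\<^sub>M time_measure ?u)"
    unfolding split_beta
  proof (intro borel_measurable_scaleR)
    show "(\<lambda>x. indicator {?u - T / N<..?u} (snd x)) \<in> borel_measurable (F ?u \<Otimes>\<^sub>M time_measure ?u)"
      by (rule measurable_compose[OF measurable_snd]) (intro measurable_restrict_space1, simp)
    show "(\<lambda>x. G (snd x) (fst x)) \<in> borel_measurable (F ?u \<Otimes>\<^sub>M time_measure ?u)"
      using measurable_compose[OF measurable_pair_swap' m] by (simp add: split_beta)
  qed
  then show ?thesis
    unfolding eq
    by (intro borel_measurable_scaleR borel_measurable_const
      sigma_finite_measure.borel_measurable_lebesgue_integral[OF sigma_finite_time_measure])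
qed

end

section \<open>The averaging error in terms of translations\<close>

context wiener_space
begin

lemma predictable_joint:
  assumes "predictable_process M T F G" "0 < T"
  shows "(\<lambda>(s, \<omega>). G s \<omega>) \<in> borel_measurable (time_space T)"
  using assms filtration
  by (intro predictable_progressive[OF assms(1)]) (auto simp: filtration_on_def subalgebra_def)

context
  fixes G :: "real \<Rightarrow> 'w \<Rightarrow> real ^ 'k ^ 'm"
  assumes G: "predictable_process M T F G" and T: "0 < T"
    and fin: "L2sq (time_space T) (\<lambda>(s, \<omega>). G s \<omega>) < \<infinity>"
begin

abbreviation "energy \<omega> \<equiv> \<integral>\<^sup>+s. ennreal ((norm (zero_ext T G s \<omega>))\<^sup>2) \<partial>lborel"

lemmas joint = predictable_joint[OF G T]

lemma G_zero_ext_measurable [measurable (raw)]: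
  "f \<in> borel_measurable N \<Longrightarrow> g \<in> N \<rightarrow>\<^sub>M M \<Longrightarrow> (\<lambda>x. zero_ext T G (f x) (g x)) \<in> borel_measurable N"
  using T by (intro zero_ext_measurable[OF joint]) auto

lemma G_section_measurable: "\<omega> \<in> space M \<Longrightarrow> (\<lambda>s. zero_ext T G s \<omega>) \<in> borel_measurable borel"
  by measurable

lemma L2sq_zero_ext: "L2sq (time_space T) (\<lambda>(s, \<omega>). G s \<omega>) =
    (\<integral>\<^sup>+\<omega>. energy \<omega> \<partial>M)"
  unfolding L2sq_time_pair[OF joint]
  by (intro nn_integral_cong) (auto simp: zero_ext_def indicator_def)

lemma AE_zero_ext_sq: "AE \<omega> in M. energy \<omega> \<noteq> \<infinity>"
  using fin unfolding L2sq_zero_ext by (intro nn_integral_noteq_infinite) (auto simp: top.not_eq_extremum)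

lemma integrable_zero_ext:
  assumes \<omega>: "\<omega> \<in> space M" and "energy \<omega> \<noteq> \<infinity>"
  shows "integrable lborel (\<lambda>s. zero_ext T G s \<omega>)"
proof (rule Bochner_Integration.integrable_bound)
  have "integrable lborel (\<lambda>s. (norm (zero_ext T G s \<omega>))\<^sup>2)"
    using assms G_section_measurable[OF \<omega>] by (auto simp: integrable_iff_bounded less_top[symmetric])
  then show "integrable lborel (\<lambda>s. indicator {0..T} s + (norm (zero_ext T G s \<omega>))\<^sup>2 :: real)"
    using T by (intro Bochner_Integration.integrable_add integrable_real_indicator) auto
  have "a \<le> 1 + a\<^sup>2" for a :: real
    using sum_squares_bound[of a 1] zero_le_power2[of a] unfolding power_one mult_1_right by linarith
  then show "AE s in lborel. norm (zero_ext T G s \<omega>) \<le> norm (indicator {0..T} s + (norm (zero_ext T G s \<omega>))\<^sup>2 :: real)"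
    by (intro AE_I2) (auto simp: zero_ext_def indicator_def)
qed (use G_section_measurable[OF \<omega>] in simp)

lemma cell_average_diff_le:
  assumes \<omega>: "\<omega> \<in> space M" "energy \<omega> \<noteq> \<infinity>" and N: "0 < N"
  shows "ennreal ((norm (cell_average T N G i \<omega> - x))\<^sup>2) \<le> ennreal (N / T) *
    (\<integral>\<^sup>+s. ennreal ((norm (zero_ext T G s \<omega> - x))\<^sup>2) * indicator (delayed_cell T N i) s \<partial>lborel)"
proof -
  have "T / N > 0" using T N by simp
  then have lt: "real i * (T / N) - T / N < real i * (T / N)" by linarith
  have int: "integrable lborel (\<lambda>s. indicator (delayed_cell T N i) s *\<^sub>R zero_ext T G s \<omega>)"
    by (intro integrable_mult_indicator integrable_zero_ext \<omega>) simp
  show ?thesis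
    using norm_average_diff_sq_le[OF lt int G_section_measurable[OF \<omega>(1)], of x] by (simp add: cell_average_def)
qed

text \<open>The case x = 0 of \<open>cell_average_diff_le\<close> bounds each average by the energy
  of its path.\<close>

lemma sq_elementary_averaged:
  assumes N: "0 < N"
  shows "sq_elementary (averaged T N G)"
proof -
  have "L2sq M (cell_average T N G i) < \<infinity>" for i
  proof -
    have "L2sq M (cell_average T N G i) \<le>
      (\<integral>\<^sup>+\<omega>. ennreal (N / T) * energy \<omega> \<partial>M)"
      unfolding L2sq_def
    proof (intro nn_integral_mono_AE)
      show "AE \<omega> in M. ennreal ((norm (cell_average T N G i \<omega>))\<^sup>2) \<le>
        ennreal (N / T) * energy \<omega>"
        using AE_zero_ext_sq AE_space
      proof eventually_elim
        case (elim \<omega>)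
        have "ennreal ((norm (cell_average T N G i \<omega>))\<^sup>2) \<le> ennreal (N / T) *
            (\<integral>\<^sup>+s. ennreal ((norm (zero_ext T G s \<omega>))\<^sup>2) * indicator (delayed_cell T N i) s \<partial>lborel)"
          using cell_average_diff_le[OF elim(2,1) N, of i 0] by simp
        also have "\<dots> \<le> ennreal (N / T) * energy \<omega>"
          by (intro mult_left_mono nn_integral_mono) (auto simp: indicator_def)
        finally show ?case .
      qed
    qed
    also have "\<dots> = ennreal (N / T) * L2sq (time_space T) (\<lambda>(s, \<omega>). G s \<omega>)"
      unfolding L2sq_zero_ext by (intro nn_integral_cmult) measurable
    also have "\<dots> < \<infinity>" using fin by (simp add: ennreal_mult_less_top)
    finally show ?thesis .
  qed
  moreover have "real i * (T / N) \<le> real (Suc i) * (T / N)" for i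
    using T N by (intro mult_right_mono) auto
  ultimately show ?thesis
    using cell_average_measurable[OF G T] T N by (simp add: averaged_def)
qed

text \<open>By Jensen the error at time t is at most a mean of squared differences over the
  preceding cell, that is over shifts 0 < h < 2 T / N. Exchanging integrals leaves N / T times the
  integral of the modulus over these shifts, at most (N / T) (2 T / N) c = 2 c.\<close>

lemma averaged_error_le:
  assumes N: "0 < N" and mod: "\<And>h. 0 < h \<Longrightarrow> h < 2 * (T / N) \<Longrightarrow> translation_modulus M T G h \<le> ennreal c" and c: "0 \<le> c"
  shows "L2sq (time_space T) (\<lambda>(s, \<omega>). G s \<omega> - elementary_process (averaged T N G) s \<omega>) \<le> ennreal (2 * c)"
proof -
  let ?\<delta> = "T / N" and ?E = "elementary_process (averaged T N G)"
  let ?D = "\<lambda>\<omega> s h. ennreal ((norm (zero_ext T G s \<omega> - zero_ext T G (s - h) \<omega>))\<^sup>2)"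
  let ?g = "\<lambda>\<omega> s h. ennreal (N / T) * (?D \<omega> s h * indicator {0..T} s * indicator {0<..<2 * ?\<delta>} h)"
  have \<delta>: "?\<delta> > 0" using T N by simp
  note S = sq_elementary_averaged[OF N]
  have pointwise: "ennreal ((norm (G t \<omega> - ?E t \<omega>))\<^sup>2) \<le>
      ennreal (N / T) * (\<integral>\<^sup>+h. ?D \<omega> t h * indicator {0<..<2 * ?\<delta>} h \<partial>lborel)"
    if \<omega>: "\<omega> \<in> space M" "energy \<omega> \<noteq> \<infinity>" and t: "0 < t" "t \<le> T" for t \<omega>
  proof -
    obtain i where i: "i < N" "real i * ?\<delta> < t" "t \<le> real (Suc i) * ?\<delta>"
      and E: "?E t \<omega> = cell_average T N G i \<omega>"
      by (rule elementary_process_averaged[OF t N])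
    let ?x = "zero_ext T G t \<omega>"
    have x: "G t \<omega> = ?x" using t by (simp add: zero_ext_def)
    have [measurable]: "(\<lambda>s. zero_ext T G s \<omega>) \<in> borel_measurable borel"
      by (rule G_section_measurable[OF \<omega>(1)])
    have "(\<integral>\<^sup>+s. ennreal ((norm (zero_ext T G s \<omega> - ?x))\<^sup>2) * indicator (delayed_cell T N i) s \<partial>lborel)
      = (\<integral>\<^sup>+h. ennreal ((norm (zero_ext T G (t + (-1) * h) \<omega> - ?x))\<^sup>2) * indicator (delayed_cell T N i) (t + (-1) * h) \<partial>lborel)"
      by (subst nn_integral_real_affine[where c="-1" and t=t]) simp_all
    also have "\<dots> \<le> (\<integral>\<^sup>+h. ?D \<omega> t h * indicator {0<..<2 * ?\<delta>} h \<partial>lborel)"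
    proof (intro nn_integral_mono)
      fix h
      \<comment> \<open>Here t lies in (i \<delta>, (i + 1) \<delta>] and t - h in ((i - 1)
        \<delta>, i \<delta>]; the open left ends make both bounds on h strict.\<close>
      have "0 < h \<and> h < 2 * ?\<delta>" if "real i * ?\<delta> - ?\<delta> < t - h" "t - h \<le> real i * ?\<delta>"
      proof -
        have "real (Suc i) * ?\<delta> = real i * ?\<delta> + ?\<delta>" unfolding of_nat_Suc distrib_right by linarith
        then show ?thesis using that i(2,3) by linarith
      qed
      then show "ennreal ((norm (zero_ext T G (t + (-1) * h) \<omega> - ?x))\<^sup>2) * indicator (delayed_cell T N i) (t + (-1) * h)
          \<le> ?D \<omega> t h * indicator {0<..<2 * ?\<delta>} h"
        by (auto simp: indicator_def norm_minus_commute)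
    qed
    finally have "ennreal ((norm (cell_average T N G i \<omega> - ?x))\<^sup>2) \<le>
        ennreal (N / T) * (\<integral>\<^sup>+h. ?D \<omega> t h * indicator {0<..<2 * ?\<delta>} h \<partial>lborel)"
      by (intro order_trans[OF cell_average_diff_le[OF \<omega> N]] mult_left_mono) auto
    then show ?thesis unfolding E x by (simp add: norm_minus_commute)
  qed
  interpret P: pair_sigma_finite "lborel :: real measure" M
    by (intro pair_sigma_finite.intro sigma_finite_lborel sigma_finite_measure_axioms)
  have "L2sq (time_space T) (\<lambda>(s, \<omega>). G s \<omega> - ?E s \<omega>) =
      (\<integral>\<^sup>+\<omega>. (\<integral>\<^sup>+s. ennreal ((norm (G s \<omega> - ?E s \<omega>))\<^sup>2) * indicator {0..T} s \<partial>lborel) \<partial>M)"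
    using borel_measurable_diff[OF joint elementary_process_measurable[OF S, of T]]
    by (subst L2sq_time_pair) (simp_all add: case_prod_beta')
  also have "\<dots> \<le> (\<integral>\<^sup>+\<omega>. (\<integral>\<^sup>+s. (ennreal (N / T) * (\<integral>\<^sup>+h. ?D \<omega> s h * indicator {0<..<2 * ?\<delta>} h \<partial>lborel)) * indicator {0..T} s \<partial>lborel) \<partial>M)"
  proof (intro nn_integral_mono_AE)
    show "AE \<omega> in M. (\<integral>\<^sup>+s. ennreal ((norm (G s \<omega> - ?E s \<omega>))\<^sup>2) * indicator {0..T} s \<partial>lborel) \<le>
      (\<integral>\<^sup>+s. (ennreal (N / T) * (\<integral>\<^sup>+h. ?D \<omega> s h * indicator {0<..<2 * ?\<delta>} h \<partial>lborel)) * indicator {0..T} s \<partial>lborel)"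
      using AE_zero_ext_sq AE_space
    proof eventually_elim
      case (elim \<omega>)
      \<comment> \<open>Time 0 belongs to no cell and is discarded as a null set.\<close>
      show ?case
        using AE_lborel_singleton[of "0::real"]
      proof (intro nn_integral_mono_AE, eventually_elim)
        case (elim s)
        then show ?case
          using pointwise[OF \<open>\<omega> \<in> space M\<close> \<open>_ \<noteq> \<infinity>\<close>, of s] by (cases "s \<in> {0..T}") auto
      qed
    qed
  qed
  also have "\<dots> = (\<integral>\<^sup>+\<omega>. (\<integral>\<^sup>+s. (\<integral>\<^sup>+h. ?g \<omega> s h \<partial>lborel) \<partial>lborel) \<partial>M)"
    by (intro nn_integral_cong, subst nn_integral_cmult) (auto simp: indicator_def)
  \<comment> \<open>The shift h is moved outermost in two exchanges, past the time integral and then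
    past the expectation.\<close>
  also have "\<dots> = (\<integral>\<^sup>+\<omega>. (\<integral>\<^sup>+h. (\<integral>\<^sup>+s. ?g \<omega> s h \<partial>lborel) \<partial>lborel) \<partial>M)"
    by (rule nn_integral_cong, rule lborel_pair.Fubini') measurable
  also have "\<dots> = (\<integral>\<^sup>+h. (\<integral>\<^sup>+\<omega>. (\<integral>\<^sup>+s. ?g \<omega> s h \<partial>lborel) \<partial>M) \<partial>lborel)"
    by (rule P.Fubini') measurable
  also have "\<dots> = (\<integral>\<^sup>+h. (ennreal (N / T) * translation_modulus M T G h) * indicator {0<..<2 * ?\<delta>} h \<partial>lborel)"
  proof (rule nn_integral_cong)
    fix h
    let ?k = "ennreal (N / T) * indicator {0<..<2 * ?\<delta>} h"
    have "(\<integral>\<^sup>+\<omega>. (\<integral>\<^sup>+s. ?g \<omega> s h \<partial>lborel) \<partial>M)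
      = (\<integral>\<^sup>+\<omega>. (\<integral>\<^sup>+s. ?k * (?D \<omega> s h * indicator {0..T} s) \<partial>lborel) \<partial>M)"
      by (simp only: mult_ac)
    also have "\<dots> = (\<integral>\<^sup>+\<omega>. ?k * (\<integral>\<^sup>+s. ?D \<omega> s h * indicator {0..T} s \<partial>lborel) \<partial>M)"
      by (rule nn_integral_cong, rule nn_integral_cmult) measurable
    also have "\<dots> = ?k * translation_modulus M T G h"
      unfolding translation_modulus_def by (rule nn_integral_cmult) measurable
    finally show "(\<integral>\<^sup>+\<omega>. (\<integral>\<^sup>+s. ?g \<omega> s h \<partial>lborel) \<partial>M)
      = ennreal (N / T) * translation_modulus M T G h * indicator {0<..<2 * ?\<delta>} h"
      by (simp only: mult_ac)
  qed
  also have "\<dots> \<le> (\<integral>\<^sup>+h. ennreal (N / T * c) * indicator {0<..<2 * ?\<delta>} h \<partial>lborel)"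
  proof (rule nn_integral_mono)
    fix h
    have eq: "ennreal (N / T * c) = ennreal (N / T) * ennreal c"
      using T c by (intro ennreal_mult) auto
    show "ennreal (N / T) * translation_modulus M T G h * indicator {0<..<2 * ?\<delta>} h
        \<le> ennreal (N / T * c) * indicator {0<..<2 * ?\<delta>} h"
    proof (cases "h \<in> {0<..<2 * ?\<delta>}")
      case True
      then show ?thesis
        unfolding eq using mod[of h] by (simp add: mult_left_mono)
    qed simp
  qed
  also have "\<dots> = ennreal (N / T * c) * ennreal (2 * ?\<delta>)"
    using \<delta> by (subst nn_integral_cmult_indicator) auto
  also have "\<dots> = ennreal (2 * c)"
    using T N c by (subst ennreal_mult[symmetric]) (auto simp: field_simps)
  finally show ?thesis .
qed

end

end

section \<open>Functionals of the bracket\<close>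

lemma bracket_add: "bracket \<beta> (x + y) = bracket \<beta> x + bracket \<beta> y"
  by (simp add: bracket_def vec_eq_iff blinfun.add_right)

lemma bracket_scaleR: "bracket \<beta> (c *\<^sub>R x) = c *\<^sub>R bracket \<beta> x"
  by (simp add: bracket_def vec_eq_iff blinfun.scaleR_right)

lemma norm_bracket_le: "norm (bracket \<beta> A) \<le> norm \<beta> * norm A"
proof -
  have "norm (bracket \<beta> A $ i) \<le> norm \<beta> * norm (A $ i)" for i
  proof -
    have "norm (bracket \<beta> A $ i) \<le> L2_set (\<lambda>j. norm \<beta> * norm (A $ i $ j)) UNIV"
      unfolding norm_vec_def by (intro L2_set_mono) (simp_all add: bracket_def norm_blinfun[of \<beta>, unfolded real_norm_def])
    then show ?thesis by (simp add: norm_vec_def L2_set_right_distrib)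
  qed
  then have "norm (bracket \<beta> A) \<le> L2_set (\<lambda>i. norm \<beta> * norm (A $ i)) UNIV"
    unfolding norm_vec_def[of "bracket \<beta> A"] by (intro L2_set_mono) simp_all
  then show ?thesis by (simp add: norm_vec_def[of A] L2_set_right_distrib)
qed

lemma borel_measurable_bracket [measurable]: "bracket \<beta> \<in> borel_measurable borel"
  unfolding bracket_def[abs_def] by (intro borel_measurable_continuous_onI continuous_intros)

lemma predictable_bracket:
  assumes "predictable_process M T F V"
  shows "predictable_process M T F (\<lambda>s \<omega>. bracket \<beta> (V s \<omega>))"
  using measurable_compose[OF assms[unfolded predictable_process_def] borel_measurable_bracket, of \<beta>]
  by (simp add: predictable_process_def split_beta')

lemma power2_le_1_plus_powr:
  assumes "0 \<le> x" "2 < (p::real)"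
  shows "x\<^sup>2 \<le> 1 + x powr p"
proof -
  have "(min x 1)\<^sup>2 \<le> 1" using assms by (intro power_le_one) auto
  then show ?thesis using power2_le_min_plus_powr[of x 1 p] assms by simp
qed

lemma abs_inner_le: "\<bar>x \<bullet> y\<bar> \<le> (norm x)\<^sup>2 + (norm (y :: 'a::real_inner))\<^sup>2"
  using Cauchy_Schwarz_ineq2[of x y] sum_squares_bound[of "norm x" "norm y"]
    mult_nonneg_nonneg[OF norm_ge_zero[of x] norm_ge_zero[of y]] by linarith

lemma integrable_inner_sq:
  fixes f g :: "'a \<Rightarrow> 'b::euclidean_space"
  assumes [measurable]: "f \<in> borel_measurable M" "g \<in> borel_measurable M"
    and int: "integrable M (\<lambda>x. (norm (f x))\<^sup>2)" "integrable M (\<lambda>x. (norm (g x))\<^sup>2)"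
  shows "integrable M (\<lambda>x. f x \<bullet> g x)"
  by (rule Bochner_Integration.integrable_bound[OF Bochner_Integration.integrable_add[OF int]])
    (simp_all add: abs_inner_le)

lemma Lp_integrable_norm_sq:
  fixes f :: "'a \<Rightarrow> 'b::real_normed_vector"
  assumes f: "f \<in> Lp M p" and p: "2 < p" and M: "finite_measure M"
  shows "integrable M (\<lambda>x. (norm (f x))\<^sup>2)"
proof -
  interpret finite_measure M by fact
  have [measurable]: "f \<in> borel_measurable M" and int: "integrable M (\<lambda>x. norm (f x) powr p)"
    using f by (auto simp: Lp_def)
  show ?thesis
    by (rule Bochner_Integration.integrable_bound[where f="\<lambda>x. 1 + norm (f x) powr p"])
      (use int p power2_le_1_plus_powr in \<open>auto intro!: AE_I2\<close>)
qed

lemma finite_time_measure: "finite_measure (time_measure T)"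
  by (rule finite_measureI, cases "0 \<le> T") (simp_all add: emeasure_restrict_space)

text \<open>A linear functional with \<open>\<bar>\<phi> f\<bar> \<le> A + B \<parallel>f\<parallel>\<^sup>p\<close> is bounded by homogeneity, so Hoelder's inequality
  is not needed.\<close>

lemma Lp_dualI_homogeneous:
  assumes p: "0 < p"
    and add: "\<And>f g. f \<in> Lp \<mu> p \<Longrightarrow> g \<in> Lp \<mu> p \<Longrightarrow> \<phi> (\<lambda>x. f x + g x) = \<phi> f + \<phi> g"
    and scale: "\<And>c f. f \<in> Lp \<mu> p \<Longrightarrow> \<phi> (\<lambda>x. c *\<^sub>R f x) = c * \<phi> f"
    and bound: "\<And>f. f \<in> Lp \<mu> p \<Longrightarrow> \<bar>\<phi> f\<bar> \<le> A + B * (\<integral>x. norm (f x) powr p \<partial>\<mu>)"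
  shows "\<phi> \<in> Lp_dual \<mu> p"
proof -
  have "\<bar>\<phi> f\<bar> \<le> (A + B) * Lp_norm \<mu> p f" if f: "f \<in> Lp \<mu> p" for f
  proof -
    have cf: "(\<lambda>x. c *\<^sub>R f x) \<in> Lp \<mu> p" and
      icf: "(\<integral>x. norm (c *\<^sub>R f x) powr p \<partial>\<mu>) = \<bar>c\<bar> powr p * (\<integral>x. norm (f x) powr p \<partial>\<mu>)" for c
      using f by (auto simp: Lp_def powr_mult)
    have cb: "\<bar>c\<bar> * \<bar>\<phi> f\<bar> \<le> A + B * (\<bar>c\<bar> powr p * (\<integral>x. norm (f x) powr p \<partial>\<mu>))" for c
      using bound[OF cf, of c] unfolding scale[OF f] icf by (simp add: abs_mult)
    let ?I = "\<integral>x. norm (f x) powr p \<partial>\<mu>" and ?n = "Lp_norm \<mu> p f"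
    have I0: "?I \<ge> 0" by (intro Bochner_Integration.integral_nonneg) simp
    have np: "?n powr p = ?I" using p I0 by (simp add: Lp_norm_def powr_powr)
    have n0: "?n \<ge> 0" by (simp add: Lp_norm_def)
    show ?thesis
    proof (cases "?n = 0")
      case True
      then have I: "?I = 0" using np p by simp
      have "\<phi> f = 0"
      proof (rule ccontr)
        assume "\<phi> f \<noteq> 0"
        \<comment> \<open>For vanishing seminorm the bound on c * \<open>\<phi> f\<close> is A for
          every c, and a multiple of size \<bar>A\<bar> + 1 exceeds it.\<close>
        then have "\<bar>(\<bar>A\<bar> + 1) / \<phi> f\<bar> * \<bar>\<phi> f\<bar> = \<bar>A\<bar> + 1" by (simp add: abs_mult[symmetric])
        with cb[of "(\<bar>A\<bar> + 1) / \<phi> f"] I show False by simp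
      qed
      then show ?thesis using True by simp
    next
      case False
      then have n: "?n > 0" using n0 by simp
      \<comment> \<open>Normalising f to norm 1 turns the bound into the constant A + B.\<close>
      have "\<bar>1 / ?n\<bar> powr p * ?I = 1"
        unfolding np[symmetric] using n by (simp add: powr_divide)
      with cb[of "1 / ?n"] n show ?thesis by (simp add: field_simps)
    qed
  qed
  then show ?thesis using add scale unfolding Lp_dual_def by blast
qed

section \<open>Test functionals for weak convergence\<close>

lemma bracket_Lp_sq:
  fixes f :: "real \<Rightarrow> 'x::real_normed_vector ^ 'k ^ 'm"
  assumes f: "f \<in> Lp (time_measure T) p" and p: "2 < p"
  shows "(\<lambda>t. bracket \<beta> (f t)) \<in> borel_measurable (time_measure T)"
    and "integrable (time_measure T) (\<lambda>t. (norm (bracket \<beta> (f t)))\<^sup>2)"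
    and "(norm (bracket \<beta> (f t)))\<^sup>2 \<le> (norm \<beta>)\<^sup>2 * (norm (f t))\<^sup>2"
proof -
  show m: "(\<lambda>t. bracket \<beta> (f t)) \<in> borel_measurable (time_measure T)"
    using f by (intro measurable_compose[OF _ borel_measurable_bracket]) (simp add: Lp_def)
  show le: "(norm (bracket \<beta> (f t)))\<^sup>2 \<le> (norm \<beta>)\<^sup>2 * (norm (f t))\<^sup>2" for t
    using norm_bracket_le[of \<beta> "f t"] by (metis norm_ge_zero power_mono power_mult_distrib)
  show "integrable (time_measure T) (\<lambda>t. (norm (bracket \<beta> (f t)))\<^sup>2)"
    by (rule Bochner_Integration.integrable_bound[OF integrable_mult_right[OF Lp_integrable_norm_sq[OF f p finite_time_measure], of "(norm \<beta>)\<^sup>2"]])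
      (use m le in \<open>auto intro!: AE_I2\<close>)
qed

text \<open>Weak convergence is exploited only through functionals of this form. Splitting the inner
  product into |\<theta>|^2 and |\<beta>|^2 (1 + |f|^p) gives the bound that
  \<open>Lp_dualI_homogeneous\<close> asks for.\<close>

lemma bracket_functional_dual:
  fixes \<beta> :: "'x::real_normed_vector \<Rightarrow>\<^sub>L real" and \<theta> :: "real \<Rightarrow> real ^ 'k ^ 'm"
  assumes p: "2 < p" and \<theta>: "\<theta> \<in> borel_measurable (time_measure T)"
    "integrable (time_measure T) (\<lambda>t. (norm (\<theta> t))\<^sup>2)"
  shows "(\<lambda>f :: real \<Rightarrow> 'x ^ 'k ^ 'm. \<integral>t. \<theta> t \<bullet> bracket \<beta> (f t) \<partial>time_measure T) \<in> Lp_dual (time_measure T) p"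
proof -
  let ?\<mu> = "time_measure T"
  interpret finite_measure ?\<mu> by (rule finite_time_measure)
  have int: "integrable ?\<mu> (\<lambda>t. \<theta> t \<bullet> bracket \<beta> (f t))" if "f \<in> Lp ?\<mu> p" for f :: "real \<Rightarrow> 'x ^ 'k ^ 'm"
    using \<theta> bracket_Lp_sq[OF that p, of \<beta>] by (intro integrable_inner_sq)
  show ?thesis
  proof (rule Lp_dualI_homogeneous)
    fix f g :: "real \<Rightarrow> 'x ^ 'k ^ 'm" assume "f \<in> Lp ?\<mu> p" "g \<in> Lp ?\<mu> p"
    then show "(\<integral>t. \<theta> t \<bullet> bracket \<beta> (f t + g t) \<partial>?\<mu>) = (\<integral>t. \<theta> t \<bullet> bracket \<beta> (f t) \<partial>?\<mu>) + (\<integral>t. \<theta> t \<bullet> bracket \<beta> (g t) \<partial>?\<mu>)"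
      using int by (simp add: bracket_add inner_add_right Bochner_Integration.integral_add)
  next
    fix c and f :: "real \<Rightarrow> 'x ^ 'k ^ 'm" assume "f \<in> Lp ?\<mu> p"
    show "(\<integral>t. \<theta> t \<bullet> bracket \<beta> (c *\<^sub>R f t) \<partial>?\<mu>) = c * (\<integral>t. \<theta> t \<bullet> bracket \<beta> (f t) \<partial>?\<mu>)"
      by (simp add: bracket_scaleR)
  next
    fix f :: "real \<Rightarrow> 'x ^ 'k ^ 'm" assume f: "f \<in> Lp ?\<mu> p"
    then have fp: "integrable ?\<mu> (\<lambda>t. norm (f t) powr p)" by (simp add: Lp_def)
    have "\<bar>\<integral>t. \<theta> t \<bullet> bracket \<beta> (f t) \<partial>?\<mu>\<bar> \<le> (\<integral>t. \<bar>\<theta> t \<bullet> bracket \<beta> (f t)\<bar> \<partial>?\<mu>)"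
      by (rule integral_abs_bound)
    also have "\<dots> \<le> (\<integral>t. (norm (\<theta> t))\<^sup>2 + (norm \<beta>)\<^sup>2 * (1 + norm (f t) powr p) \<partial>?\<mu>)"
    proof (intro integral_mono)
      show "integrable ?\<mu> (\<lambda>t. (norm (\<theta> t))\<^sup>2 + (norm \<beta>)\<^sup>2 * (1 + norm (f t) powr p))"
        using \<theta>(2) fp by (intro Bochner_Integration.integrable_add integrable_mult_right) auto
      fix t
      have "(norm \<beta>)\<^sup>2 * (norm (f t))\<^sup>2 \<le> (norm \<beta>)\<^sup>2 * (1 + norm (f t) powr p)"
        using p by (intro mult_left_mono power2_le_1_plus_powr) auto
      then show "\<bar>\<theta> t \<bullet> bracket \<beta> (f t)\<bar> \<le> (norm (\<theta> t))\<^sup>2 + (norm \<beta>)\<^sup>2 * (1 + norm (f t) powr p)"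
        using abs_inner_le[of "\<theta> t" "bracket \<beta> (f t)"] bracket_Lp_sq(3)[OF f p, of \<beta> t] by linarith
    qed (use int[OF f] in simp)
    also have "\<dots> = (\<integral>t. (norm (\<theta> t))\<^sup>2 \<partial>?\<mu>) + (norm \<beta>)\<^sup>2 * measure ?\<mu> (space ?\<mu>) + (norm \<beta>)\<^sup>2 * (\<integral>t. norm (f t) powr p \<partial>?\<mu>)"
      using \<theta>(2) fp by (simp add: Bochner_Integration.integral_add algebra_simps)
    finally show "\<bar>\<integral>t. \<theta> t \<bullet> bracket \<beta> (f t) \<partial>?\<mu>\<bar> \<le>
      (\<integral>t. (norm (\<theta> t))\<^sup>2 \<partial>?\<mu>) + (norm \<beta>)\<^sup>2 * measure ?\<mu> (space ?\<mu>) + (norm \<beta>)\<^sup>2 * (\<integral>t. norm (f t) powr p \<partial>?\<mu>)" .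
  qed (use p in simp)
qed

lemma
  fixes f :: "real \<Rightarrow> 'b::{banach, second_countable_topology}"
  shows integrable_lborel_translate: "integrable lborel f \<Longrightarrow> integrable lborel (\<lambda>s. f (s + h))"
    and integral_lborel_translate: "(\<integral>s. f (s + h) \<partial>lborel) = (\<integral>s. f s \<partial>lborel)"
  using lborel_integrable_real_affine[of f 1 h] lborel_integral_real_affine[of 1 f h] by (simp_all add: add.commute)

text \<open>Lower semicontinuity by testing against the limit: if \<open>\<langle>\<psi>, \<psi>\<^sub>n\<rangle> \<rightarrow> \<parallel>\<psi>\<parallel>\<^sup>2\<close>, then
  \<open>\<parallel>\<psi>\<^sub>n\<parallel>\<^sup>2 \<ge> 2 \<langle>\<psi>, \<psi>\<^sub>n\<rangle> - \<parallel>\<psi>\<parallel>\<^sup>2\<close>.\<close>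

lemma translation_difference_lsc:
  fixes \<beta> :: "'x::real_normed_vector \<Rightarrow>\<^sub>L real" and v :: "nat \<Rightarrow> real \<Rightarrow> 'x ^ 'k ^ 'm"
  assumes p: "2 < p" and weak: "Lp_weak_convergence (time_measure T) p v u"
  defines "z \<equiv> \<lambda>w s. indicator {0..T} s *\<^sub>R bracket \<beta> (w s)"
  shows "(\<integral>\<^sup>+s. ennreal ((norm (z u s - z u (s - h)))\<^sup>2) * indicator {0..T} s \<partial>lborel) \<le>
    liminf (\<lambda>n. \<integral>\<^sup>+s. ennreal ((norm (z (v n) s - z (v n) (s - h)))\<^sup>2) * indicator {0..T} s \<partial>lborel)"
proof -
  let ?\<mu> = "time_measure T"
  have v: "v n \<in> Lp ?\<mu> p" and u: "u \<in> Lp ?\<mu> p" for n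
    using weak by (auto simp: Lp_weak_convergence_def)
  \<comment> \<open>The window [0,T] is built into d, so that all integrals can be taken over the
    whole line, where translation preserves them.\<close>
  define d where "d w s = indicator {0..T} s *\<^sub>R (z w s - z w (s - h))" for w s
  have z: "z w \<in> borel_measurable borel" "integrable lborel (\<lambda>s. (norm (z w s))\<^sup>2)" if "w \<in> Lp ?\<mu> p" for w
  proof -
    note B = bracket_Lp_sq[OF that p, of \<beta>]
    show "z w \<in> borel_measurable borel"
      using B(1) unfolding z_def by (simp add: borel_measurable_restrict_space_iff)
    have "integrable lborel (\<lambda>s. indicator {0..T} s *\<^sub>R (norm (bracket \<beta> (w s)))\<^sup>2)"
      using B(2) by (simp add: integrable_restrict_space)
    moreover have "(\<lambda>s. indicator {0..T} s *\<^sub>R (norm (bracket \<beta> (w s)))\<^sup>2) = (\<lambda>s. (norm (z w s))\<^sup>2)"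
      by (auto simp: z_def indicator_def)
    ultimately show "integrable lborel (\<lambda>s. (norm (z w s))\<^sup>2)" by simp
  qed
  have d: "d w \<in> borel_measurable borel" "integrable lborel (\<lambda>s. (norm (d w s))\<^sup>2)" if "w \<in> Lp ?\<mu> p" for w
  proof -
    note [measurable] = z(1)[OF that]
    show m: "d w \<in> borel_measurable borel" unfolding d_def[abs_def] by measurable
    have "integrable lborel (\<lambda>s. 2 * (norm (z w s))\<^sup>2 + 2 * (norm (z w (s + (- h))))\<^sup>2)"
      by (intro Bochner_Integration.integrable_add integrable_mult_right integrable_lborel_translate z(2)[OF that]
        integrable_lborel_translate[of "\<lambda>s. (norm (z w s))\<^sup>2"])
    moreover have "(norm (d w s))\<^sup>2 \<le> 2 * (norm (z w s))\<^sup>2 + 2 * (norm (z w (s - h)))\<^sup>2" for s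
      using norm_add_sq_le[of "z w s" "- z w (s - h)"] by (auto simp: d_def indicator_def)
    ultimately show "integrable lborel (\<lambda>s. (norm (d w s))\<^sup>2)"
      using m by (elim Bochner_Integration.integrable_bound) auto
  qed
  \<comment> \<open>This is the adjoint of the difference operator applied to \<open>d u\<close>:
    moving the shift to the other factor makes the pairing of \<theta> with \<open>z w\<close> equal
    to that of \<open>d u\<close> with \<open>d w\<close>.\<close>
  define \<theta> where "\<theta> s = d u s - d u (s + h)" for s
  have \<theta>m: "\<theta> \<in> borel_measurable borel"
    using d(1)[OF u] unfolding \<theta>_def[abs_def] by measurable
  have i\<theta>: "integrable lborel (\<lambda>s. (norm (\<theta> s))\<^sup>2)"
  proof -
    have "integrable lborel (\<lambda>s. 2 * (norm (d u s))\<^sup>2 + 2 * (norm (d u (s + h)))\<^sup>2)"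
      by (intro Bochner_Integration.integrable_add integrable_mult_right d(2)[OF u]
        integrable_lborel_translate[of "\<lambda>s. (norm (d u s))\<^sup>2"])
    moreover have "(norm (\<theta> s))\<^sup>2 \<le> 2 * (norm (d u s))\<^sup>2 + 2 * (norm (d u (s + h)))\<^sup>2" for s
      using norm_add_sq_le[of "d u s" "- d u (s + h)"] by (auto simp: \<theta>_def)
    ultimately show ?thesis
      using \<theta>m by (elim Bochner_Integration.integrable_bound) auto
  qed
  let ?\<Lambda> = "\<lambda>w. \<integral>t. \<theta> t \<bullet> bracket \<beta> (w t) \<partial>?\<mu>"
  have "\<theta> \<in> borel_measurable ?\<mu>" "integrable ?\<mu> (\<lambda>t. (norm (\<theta> t))\<^sup>2)"
    using \<theta>m integrable_mult_indicator[OF _ i\<theta>, of "{0..T}"]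
    by (auto simp: integrable_restrict_space intro: measurable_restrict_space1)
  then have "?\<Lambda> \<in> Lp_dual ?\<mu> p"
    by (rule bracket_functional_dual[OF p])
  then have lim: "(\<lambda>n. ?\<Lambda> (v n)) \<longlonglongrightarrow> ?\<Lambda> u"
    using weak by (auto simp: Lp_weak_convergence_def)
  have \<Lambda>: "?\<Lambda> w = (\<integral>s. d u s \<bullet> d w s \<partial>lborel)" and di: "integrable lborel (\<lambda>s. d u s \<bullet> d w s)" if w: "w \<in> Lp ?\<mu> p" for w
  proof -
    show "integrable lborel (\<lambda>s. d u s \<bullet> d w s)"
      using d[OF u] d[OF w] by (intro integrable_inner_sq) auto
    have i1: "integrable lborel (\<lambda>s. d u s \<bullet> z w s)"
      using d[OF u] z[OF w] by (intro integrable_inner_sq) auto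
    have i2: "integrable lborel (\<lambda>s. d u (s + h) \<bullet> z w s)"
      using measurable_compose[of "\<lambda>s. s + h" borel, OF _ d(1)[OF u]] z[OF w] integrable_lborel_translate[OF d(2)[OF u], of h]
      by (intro integrable_inner_sq) auto
    have i3: "integrable lborel (\<lambda>s. d u s \<bullet> z w (s - h))"
      using integrable_lborel_translate[OF i2, of "- h"] by simp
    have "?\<Lambda> w = (\<integral>s. \<theta> s \<bullet> z w s \<partial>lborel)"
      by (simp add: integral_restrict_space z_def)
    also have "\<dots> = (\<integral>s. d u s \<bullet> z w s \<partial>lborel) - (\<integral>s. d u (s + h) \<bullet> z w s \<partial>lborel)"
      using i1 i2 by (simp add: \<theta>_def inner_diff_left)
    also have "(\<integral>s. d u (s + h) \<bullet> z w s \<partial>lborel) = (\<integral>s. d u s \<bullet> z w (s - h) \<partial>lborel)"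
      using integral_lborel_translate[of "\<lambda>s. d u s \<bullet> z w (s - h)" h] by simp
    also have "(\<integral>s. d u s \<bullet> z w s \<partial>lborel) - \<dots> = (\<integral>s. d u s \<bullet> d w s \<partial>lborel)"
    proof -
      have "d u s \<bullet> d w s = d u s \<bullet> z w s - d u s \<bullet> z w (s - h)" for s
        by (cases "s \<in> {0..T}") (simp_all add: d_def inner_diff_right)
      then show ?thesis using i1 i3 by simp
    qed
    finally show "?\<Lambda> w = (\<integral>s. d u s \<bullet> d w s \<partial>lborel)" .
  qed
  have nn: "(\<integral>\<^sup>+s. ennreal ((norm (z w s - z w (s - h)))\<^sup>2) * indicator {0..T} s \<partial>lborel) = ennreal (\<integral>s. (norm (d w s))\<^sup>2 \<partial>lborel)"
    if w: "w \<in> Lp ?\<mu> p" for w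
    by (subst nn_integral_eq_integral[OF d(2)[OF w], symmetric])
      (auto intro!: nn_integral_cong simp: d_def indicator_def)
  let ?a = "\<integral>s. (norm (d u s))\<^sup>2 \<partial>lborel"
  have \<Lambda>u: "?\<Lambda> u = ?a" unfolding \<Lambda>[OF u] by (simp add: power2_norm_eq_inner)
  have le: "2 * ?\<Lambda> (v n) - ?a \<le> (\<integral>s. (norm (d (v n) s))\<^sup>2 \<partial>lborel)" for n
  proof -
    have "2 * (x \<bullet> y) \<le> (norm x)\<^sup>2 + (norm y)\<^sup>2" for x y :: "real ^ 'k ^ 'm"
      using norm_cauchy_schwarz[of x y] sum_squares_bound[of "norm x" "norm y"] by linarith
    then have "(\<integral>s. 2 * (d u s \<bullet> d (v n) s) \<partial>lborel) \<le> (\<integral>s. (norm (d u s))\<^sup>2 + (norm (d (v n) s))\<^sup>2 \<partial>lborel)"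
      using di[OF v] d(2)[OF u] d(2)[OF v] by (intro integral_mono) auto
    then show ?thesis
      unfolding \<Lambda>[OF v] using d(2)[OF u] d(2)[OF v] by simp
  qed
  have "(\<lambda>n. ennreal (2 * ?\<Lambda> (v n) - ?a)) \<longlonglongrightarrow> ennreal (2 * ?a - ?a)"
    using lim unfolding \<Lambda>u by (intro tendsto_ennrealI tendsto_diff tendsto_mult tendsto_const)
  then have "ennreal ?a = liminf (\<lambda>n. ennreal (2 * ?\<Lambda> (v n) - ?a))"
    using lim_imp_Liminf[OF sequentially_bot] by fastforce
  also have "\<dots> \<le> liminf (\<lambda>n. ennreal (\<integral>s. (norm (d (v n) s))\<^sup>2 \<partial>lborel))"
    using le by (intro Liminf_mono always_eventually allI ennreal_leI)
  finally show ?thesis unfolding nn[OF u] nn[OF v] .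
qed

section \<open>From translations in the mean to translations in mean square\<close>

lemma nn_integral_lborel_translate:
  fixes f :: "real \<Rightarrow> ennreal"
  assumes "f \<in> borel_measurable borel"
  shows "(\<integral>\<^sup>+s. f (s - h) \<partial>lborel) = (\<integral>\<^sup>+s. f s \<partial>lborel)"
  using nn_integral_real_affine[of f 1 "- h"] assms by simp

lemma nn_integral_linear4:
  assumes "f \<in> borel_measurable M" "g \<in> borel_measurable M" "d \<in> borel_measurable M" "e \<in> borel_measurable M"
  shows "(\<integral>\<^sup>+x. a * f x + g x + c * (d x + e x) \<partial>M) =
    a * (\<integral>\<^sup>+x. f x \<partial>M) + (\<integral>\<^sup>+x. g x \<partial>M) + c * ((\<integral>\<^sup>+x. d x \<partial>M) + (\<integral>\<^sup>+x. e x \<partial>M))"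
  using assms by (simp add: nn_integral_add nn_integral_cmult)

lemma bracket_nn_integral_powr_le:
  fixes f :: "real \<Rightarrow> 'x::real_normed_vector ^ 'k ^ 'm"
  assumes f: "f \<in> Lp (time_measure T) p" and p: "0 < p"
  shows "(\<integral>\<^sup>+s. ennreal (norm (indicator {0..T} s *\<^sub>R bracket \<beta> (f s)) powr p) \<partial>lborel) \<le>
    ennreal (norm \<beta> powr p) * ennreal (Lp_norm (time_measure T) p f powr p)"
proof -
  let ?\<mu> = "time_measure T"
  have int: "integrable ?\<mu> (\<lambda>t. norm (f t) powr p)" using f by (simp add: Lp_def)
  have "(\<integral>t. norm (f t) powr p \<partial>?\<mu>) \<ge> 0" by (intro Bochner_Integration.integral_nonneg) simp
  then have n: "Lp_norm ?\<mu> p f powr p = (\<integral>t. norm (f t) powr p \<partial>?\<mu>)"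
    using p by (simp add: Lp_norm_def powr_powr)
  have "(\<integral>\<^sup>+s. ennreal (norm (indicator {0..T} s *\<^sub>R bracket \<beta> (f s)) powr p) \<partial>lborel) =
      (\<integral>\<^sup>+s. ennreal (norm (bracket \<beta> (f s)) powr p) \<partial>?\<mu>)"
    by (subst nn_integral_restrict_space) (auto intro!: nn_integral_cong simp: indicator_def)
  also have "\<dots> \<le> (\<integral>\<^sup>+s. ennreal (norm \<beta> powr p) * ennreal (norm (f s) powr p) \<partial>?\<mu>)"
  proof (intro nn_integral_mono)
    fix s
    have "norm (bracket \<beta> (f s)) powr p \<le> (norm \<beta> * norm (f s)) powr p"
      using p by (intro powr_mono2 norm_bracket_le) auto
    then show "ennreal (norm (bracket \<beta> (f s)) powr p) \<le> ennreal (norm \<beta> powr p) * ennreal (norm (f s) powr p)"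
      by (simp add: powr_mult ennreal_mult[symmetric] ennreal_leI)
  qed
  also have "\<dots> = ennreal (norm \<beta> powr p) * ennreal (Lp_norm ?\<mu> p f powr p)"
    unfolding n using int by (subst nn_integral_cmult) (auto simp: nn_integral_eq_integral)
  finally show ?thesis .
qed

text \<open>For s \<ge> h the square is interpolated between the first and the p-th power. For s < h
  the integral over [h,T] gives no control, so the truncated square is bounded by K^2 instead, at a
  total cost of K^2 h.\<close>

lemma translation_square_le:
  fixes z :: "real \<Rightarrow> 'b::real_normed_vector"
  assumes p: "2 < p" and K: "0 < K" and h: "0 < h" and zero: "\<And>s. s < 0 \<Longrightarrow> z s = 0"
  shows "ennreal ((norm (z s - z (s - h)))\<^sup>2) * indicator {0..T} s \<le>
    ennreal K * (ennreal (norm (z s - z (s - h))) * indicator {h..T} s) + ennreal (K\<^sup>2) * indicator {0..h} s +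
    ennreal (K powr (2 - p) * 2 powr p) * (ennreal (norm (z s) powr p) + ennreal (norm (z (s - h)) powr p))"
proof (cases "s \<in> {0..T}")
  case True
  let ?x = "norm (z s - z (s - h))" and ?y = "K powr (2 - p) * 2 powr p * (norm (z s) powr p + norm (z (s - h)) powr p)"
  let ?r = "ennreal (K powr (2 - p) * 2 powr p) * (ennreal (norm (z s) powr p) + ennreal (norm (z (s - h)) powr p))"
  have "?x powr p \<le> (norm (z s) + norm (z (s - h))) powr p"
    using p by (intro powr_mono2 norm_triangle_ineq4) auto
  also have "\<dots> \<le> 2 powr p * (norm (z s) powr p + norm (z (s - h)) powr p)"
    using p by (intro powr_add_le) auto
  finally have y: "K powr (2 - p) * ?x powr p \<le> ?y"
    by (simp add: mult_left_mono mult.assoc)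
  have sum: "ennreal (a + ?y) = ennreal a + ?r"
    if "0 \<le> a" for a
    using that by (simp add: ennreal_mult)
  show ?thesis
  proof (cases "h \<le> s")
    case hs: True
    have "?x\<^sup>2 \<le> K * ?x + ?y"
      using power2_le_interpolation[OF norm_ge_zero K p, of "z s - z (s - h)"] y by linarith
    then have "ennreal (?x\<^sup>2) \<le> ennreal (K * ?x + ?y)" by (rule ennreal_leI)
    also have "\<dots> = ennreal K * ennreal ?x + ?r"
      using K by (subst sum) (auto simp: ennreal_mult)
    also have "\<dots> \<le> ennreal K * ennreal ?x + ennreal (K\<^sup>2) * indicator {0..h} s + ?r"
      by (intro add_mono order_refl) simp
    finally show ?thesis using True hs by simp
  next
    case hs: False
    have "?x\<^sup>2 \<le> (min ?x K)\<^sup>2 + K powr (2 - p) * ?x powr p"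
      using p K by (intro power2_le_min_plus_powr) auto
    also have "\<dots> \<le> K\<^sup>2 + ?y"
      using K by (intro add_mono y power_mono) auto
    finally have "ennreal (?x\<^sup>2) \<le> ennreal (K\<^sup>2 + ?y)" by (rule ennreal_leI)
    also have "\<dots> = ennreal (K\<^sup>2) + ?r"
      by (subst sum) auto
    finally show ?thesis using True hs by simp
  qed
qed simp

context wiener_space
begin

text \<open>The terms reflect the order of choices: K large makes the last one small for all h, then
  h small takes care of the first two. The moment bound occurs twice because the process and its
  translate contribute equally.\<close>

lemma translation_modulus_le:
  fixes G :: "real \<Rightarrow> 'w \<Rightarrow> real ^ 'k ^ 'm"
  assumes G: "predictable_process M T F G" and T: "0 < T" and p: "2 < p" and K: "0 < K" and h: "0 < h"
    and bound: "(\<integral>\<^sup>+\<omega>. (\<integral>\<^sup>+s. ennreal (norm (zero_ext T G s \<omega>) powr p) \<partial>lborel) \<partial>M) \<le> ennreal C" and C: "0 \<le> C"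
  shows "translation_modulus M T G h \<le>
    ennreal K * (\<integral>\<^sup>+\<omega>. (\<integral>\<^sup>+t\<in>{h..T}. ennreal (norm (G t \<omega> - G (t - h) \<omega>)) \<partial>lborel) \<partial>M) +
    ennreal (K\<^sup>2 * h) + ennreal (K powr (2 - p) * 2 powr p * (2 * C))"
proof -
  let ?z = "zero_ext T G" and ?c = "ennreal (K powr (2 - p) * 2 powr p)"
  let ?d = "\<lambda>\<omega> s. ennreal (norm (?z s \<omega> - ?z (s - h) \<omega>)) * indicator {h..T} s" and ?q = "\<lambda>\<omega> s. ennreal (norm (?z s \<omega>) powr p)"
  note [measurable (raw)] = zero_ext_measurable[OF predictable_joint[OF G T] less_imp_le[OF T]]
  have sec[measurable]: "(\<lambda>s. ?z s \<omega>) \<in> borel_measurable borel" if "\<omega> \<in> space M" for \<omega>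
    using that by measurable
  have const: "(\<integral>\<^sup>+\<omega>. ennreal (K\<^sup>2 * h) \<partial>M) = ennreal (K\<^sup>2 * h)"
    by (simp add: emeasure_space_1)
  \<comment> \<open>For t in [h,T] both t and t - h lie in [0,T], so the zero extension is
    invisible.\<close>
  have X: "(\<integral>\<^sup>+\<omega>. (\<integral>\<^sup>+t\<in>{h..T}. ennreal (norm (G t \<omega> - G (t - h) \<omega>)) \<partial>lborel) \<partial>M) =
      (\<integral>\<^sup>+\<omega>. (\<integral>\<^sup>+s. ?d \<omega> s \<partial>lborel) \<partial>M)"
    using h by (intro nn_integral_cong) (auto simp: zero_ext_def indicator_def)
  have "translation_modulus M T G h \<le> (\<integral>\<^sup>+\<omega>. (\<integral>\<^sup>+s.
      ennreal K * (?d \<omega> s) + ennreal (K\<^sup>2) * indicator {0..h} s +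
      ?c * (?q \<omega> s + ?q \<omega> (s - h)) \<partial>lborel) \<partial>M)"
    unfolding translation_modulus_def
    by (intro nn_integral_mono translation_square_le p K h) (simp add: zero_ext_def)
  also have "\<dots> = (\<integral>\<^sup>+\<omega>. ennreal K * (\<integral>\<^sup>+s. ?d \<omega> s \<partial>lborel) + ennreal (K\<^sup>2 * h) +
      ?c * ((\<integral>\<^sup>+s. ?q \<omega> s \<partial>lborel) + (\<integral>\<^sup>+s. ?q \<omega> s \<partial>lborel)) \<partial>M)"
  proof (intro nn_integral_cong)
    fix \<omega> assume \<omega>: "\<omega> \<in> space M"
    note [measurable] = sec[OF \<omega>]
    have m1: "(\<lambda>s. ?d \<omega> s) \<in> borel_measurable lborel"
      and m2: "(\<lambda>s. ennreal (K\<^sup>2) * indicator {0..h} s) \<in> borel_measurable lborel"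
      and m3: "(\<lambda>s. ?q \<omega> s) \<in> borel_measurable lborel"
      and m4: "(\<lambda>s. ?q \<omega> (s - h)) \<in> borel_measurable lborel"
      by measurable
    have shift: "(\<integral>\<^sup>+s. ?q \<omega> (s - h) \<partial>lborel) = (\<integral>\<^sup>+s. ?q \<omega> s \<partial>lborel)"
      by (rule nn_integral_lborel_translate[where f="\<lambda>s. ?q \<omega> s"]) measurable
    have const: "(\<integral>\<^sup>+s. ennreal (K\<^sup>2) * indicator {0..h} s \<partial>lborel) = ennreal (K\<^sup>2 * h)"
      using h by (subst nn_integral_cmult_indicator) (simp, simp add: ennreal_mult)
    show "(\<integral>\<^sup>+s.
      ennreal K * (?d \<omega> s) + ennreal (K\<^sup>2) * indicator {0..h} s +
      ?c * (?q \<omega> s + ?q \<omega> (s - h)) \<partial>lborel) =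
      ennreal K * (\<integral>\<^sup>+s. ?d \<omega> s \<partial>lborel) + ennreal (K\<^sup>2 * h) +
      ?c * ((\<integral>\<^sup>+s. ?q \<omega> s \<partial>lborel) + (\<integral>\<^sup>+s. ?q \<omega> s \<partial>lborel))"
      by (rule nn_integral_linear4[OF m1 m2 m3 m4, unfolded shift const])
  qed
  also have "\<dots> = ennreal K * (\<integral>\<^sup>+\<omega>. (\<integral>\<^sup>+s. ?d \<omega> s \<partial>lborel) \<partial>M) + ennreal (K\<^sup>2 * h) +
      ?c * ((\<integral>\<^sup>+\<omega>. (\<integral>\<^sup>+s. ?q \<omega> s \<partial>lborel) \<partial>M) + (\<integral>\<^sup>+\<omega>. (\<integral>\<^sup>+s. ?q \<omega> s \<partial>lborel) \<partial>M))"
  proof -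
    have mf: "(\<lambda>\<omega>. \<integral>\<^sup>+s. ?d \<omega> s \<partial>lborel) \<in> borel_measurable M"
      by measurable
    have md: "(\<lambda>\<omega>. \<integral>\<^sup>+s. ?q \<omega> s \<partial>lborel) \<in> borel_measurable M"
      by measurable
    show ?thesis
      by (rule nn_integral_linear4[OF mf borel_measurable_const[of "ennreal (K\<^sup>2 * h)"] md md, unfolded const])
  qed
  also have "\<dots> \<le> ennreal K * (\<integral>\<^sup>+\<omega>. (\<integral>\<^sup>+s. ?d \<omega> s \<partial>lborel) \<partial>M) + ennreal (K\<^sup>2 * h) +
      ?c * (ennreal C + ennreal C)"
    by (intro add_mono mult_left_mono order_refl bound) auto
  also have "?c * (ennreal C + ennreal C) = ennreal (K powr (2 - p) * 2 powr p * (2 * C))"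
    using C by (simp add: ennreal_plus[symmetric] ennreal_mult[symmetric] del: ennreal_plus)
  finally show ?thesis unfolding X .
qed

text \<open>A shift by T + 1 moves [0,T] off itself. Bounds on the modulus thereby give square
  integrability.\<close>

lemma L2sq_eq_translation_modulus:
  fixes G :: "real \<Rightarrow> 'w \<Rightarrow> real ^ 'k ^ 'm"
  assumes G: "predictable_process M T F G" and T: "0 < T"
  shows "L2sq (time_space T) (\<lambda>(s, \<omega>). G s \<omega>) = translation_modulus M T G (T + 1)"
  unfolding L2sq_time_pair[OF predictable_joint[OF G T]] translation_modulus_def
  by (intro nn_integral_cong) (auto simp: zero_ext_def indicator_def)

text \<open>Independence factors the p-th moment of the product. The Gaussian factor is compared
  with an even power through \<bar>x\<bar>^p \<le> 1 + x^(2q), whose expectation depends only on t -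
  s, not on the particular Wiener process.\<close>

lemma times_increment_powr_bound:
  assumes st: "0 \<le> s" "s < t" "t \<le> T" and c: "c \<in> borel_measurable (F s)"
    and bound: "(\<integral>\<^sup>+\<omega>. ennreal (\<bar>c \<omega>\<bar> powr p) \<partial>M) \<le> ennreal C" and C: "0 \<le> C" and p: "0 < p" "p \<le> real (2 * q)"
  shows "(\<integral>\<^sup>+\<omega>. ennreal (\<bar>c \<omega> * (incr s t \<omega>) $ j\<bar> powr p) \<partial>M) \<le>
    ennreal (C * (1 + gauss_moment (sqrt (t - s)) (2 * q)))"
proof -
  let ?\<Delta> = "\<lambda>\<omega>. (incr s t \<omega>) $ j"
  have [measurable]: "c \<in> borel_measurable M" "W t \<in> borel_measurable M" "W s \<in> borel_measurable M"
    using st measurable_F_M[OF c] by (auto intro: W_measurable)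
  have ic: "integrable M (\<lambda>\<omega>. \<bar>c \<omega>\<bar> powr p)"
    using le_less_trans[OF bound ennreal_less_top] by (simp add: integrable_iff_bounded)
  have Ec: "expectation (\<lambda>\<omega>. \<bar>c \<omega>\<bar> powr p) \<le> C"
    using bound C by (simp add: nn_integral_eq_integral[OF ic])
  have le: "\<bar>x\<bar> powr p \<le> 1 + x ^ (2 * q)" for x :: real
  proof (cases "\<bar>x\<bar> \<le> 1")
    case True
    then have "\<bar>x\<bar> powr p \<le> 1 powr p" using p by (intro powr_mono2) auto
    then show ?thesis by (simp add: add_increasing2)
  next
    case False
    then have "\<bar>x\<bar> powr p \<le> \<bar>x\<bar> powr real (2 * q)" using p by (intro powr_mono) auto
    also have "\<dots> = x ^ (2 * q)" using False by (subst powr_realpow) (auto simp: power_even_abs)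
    finally show ?thesis by simp
  qed
  have i2q: "integrable M (\<lambda>\<omega>. 1 + ?\<Delta> \<omega> ^ (2 * q))"
    by (intro Bochner_Integration.integrable_add integrable_increment_power st) simp
  have i\<Delta>: "integrable M (\<lambda>\<omega>. \<bar>?\<Delta> \<omega>\<bar> powr p)"
    by (rule Bochner_Integration.integrable_bound[OF i2q]) (use le in \<open>auto intro!: AE_I2 order_trans[OF le]\<close>)
  have "expectation (\<lambda>\<omega>. \<bar>?\<Delta> \<omega>\<bar> powr p) \<le> expectation (\<lambda>\<omega>. 1 + ?\<Delta> \<omega> ^ (2 * q))"
    by (intro integral_mono i\<Delta> i2q le)
  also have "\<dots> = 1 + gauss_moment (sqrt (t - s)) (2 * q)"
    using integrable_increment_power[OF st, of j "2 * q"] expectation_increment_power[OF st, of j "2 * q"]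
    by (simp add: prob_space del: vector_minus_component)
  finally have E\<Delta>: "expectation (\<lambda>\<omega>. \<bar>?\<Delta> \<omega>\<bar> powr p) \<le> 1 + gauss_moment (sqrt (t - s)) (2 * q)" .
  have ind: "indep_var borel (\<lambda>\<omega>. \<bar>c \<omega>\<bar> powr p) borel (\<lambda>\<omega>. \<bar>?\<Delta> \<omega>\<bar> powr p)"
  proof (rule indep_increment[OF st, where f="\<lambda>x. \<bar>x $ j\<bar> powr p"])
    have "(\<lambda>x::real. \<bar>x\<bar> powr p) \<in> borel_measurable borel" by measurable
    then show "(\<lambda>\<omega>. \<bar>c \<omega>\<bar> powr p) \<in> borel_measurable (F s)" by (rule measurable_compose[OF c])
    show "(\<lambda>x :: real ^ 'k. \<bar>x $ j\<bar> powr p) \<in> borel_measurable borel" by measurable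
  qed
  have "(\<integral>\<^sup>+\<omega>. ennreal (\<bar>c \<omega> * ?\<Delta> \<omega>\<bar> powr p) \<partial>M) = (\<integral>\<^sup>+\<omega>. ennreal (\<bar>c \<omega>\<bar> powr p * \<bar>?\<Delta> \<omega>\<bar> powr p) \<partial>M)"
    by (simp add: abs_mult powr_mult del: vector_minus_component)
  also have "\<dots> = ennreal (expectation (\<lambda>\<omega>. \<bar>c \<omega>\<bar> powr p) * expectation (\<lambda>\<omega>. \<bar>?\<Delta> \<omega>\<bar> powr p))"
    using indep_var_integrable[OF ind ic i\<Delta>] indep_var_lebesgue_integral[OF ind ic i\<Delta>]
    by (subst nn_integral_eq_integral) auto
  also have "\<dots> \<le> ennreal (C * (1 + gauss_moment (sqrt (t - s)) (2 * q)))"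
    using C by (intro ennreal_leI mult_mono Ec E\<Delta> Bochner_Integration.integral_nonneg) auto
  finally show ?thesis .
qed

end

text \<open>An entry of a cell average is a pairing with a fixed step function, as in
  \<open>bracket_functional_dual\<close>; this makes it weakly continuous on paths.\<close>

lemma cell_average_component:
  fixes V :: "real \<Rightarrow> 'w \<Rightarrow> 'x::real_normed_vector ^ 'k ^ 'm"
  assumes V: "(\<lambda>s. V s \<omega>) \<in> Lp (time_measure T) p" and p: "2 < p"
  shows "cell_average T N (\<lambda>s \<omega>. bracket \<beta> (V s \<omega>)) i \<omega> $ a $ b =
    (\<integral>s. ((real N / T) * indicator (delayed_cell T N i) s) *\<^sub>R axis a (axis b 1) \<bullet> bracket \<beta> (V s \<omega>) \<partial>time_measure T)"
proof -
  let ?A = "(delayed_cell T N i)"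
  let ?f = "\<lambda>s. indicator ?A s *\<^sub>R zero_ext T (\<lambda>s \<omega>. bracket \<beta> (V s \<omega>)) s \<omega>"
  note B = bracket_Lp_sq[OF V p, of \<beta>]
  interpret finite_measure "time_measure T" by (rule finite_time_measure)
  have "integrable (time_measure T) (\<lambda>s. bracket \<beta> (V s \<omega>))"
  proof (rule Bochner_Integration.integrable_bound[where f="\<lambda>s. 1 + (norm (bracket \<beta> (V s \<omega>)))\<^sup>2"])
    show "integrable (time_measure T) (\<lambda>s. 1 + (norm (bracket \<beta> (V s \<omega>)))\<^sup>2)"
      using B(2) by (intro Bochner_Integration.integrable_add) auto
    have "x \<le> 1 + x\<^sup>2" for x :: real
      using sum_squares_bound[of x 1] zero_le_power2[of x] unfolding power_one mult_1_right by linarith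
    then show "AE s in time_measure T. norm (bracket \<beta> (V s \<omega>)) \<le> norm (1 + (norm (bracket \<beta> (V s \<omega>)))\<^sup>2)"
      by (intro AE_I2) (simp add: order_trans[OF _ abs_ge_self])
  qed (use B(1) in simp)
  then have "integrable lborel (\<lambda>s. zero_ext T (\<lambda>s \<omega>. bracket \<beta> (V s \<omega>)) s \<omega>)"
    by (simp add: integrable_restrict_space zero_ext_def)
  then have int: "integrable lborel ?f" by (intro integrable_mult_indicator) auto
  have comp: "X $ a $ b = X \<bullet> axis a (axis b 1)" for X :: "real ^ 'k ^ 'm"
    by (simp add: inner_axis)
  have "cell_average T N (\<lambda>s \<omega>. bracket \<beta> (V s \<omega>)) i \<omega> $ a $ b = (real N / T) * (\<integral>s. ?f s \<bullet> axis a (axis b 1) \<partial>lborel)"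
    unfolding cell_average_def comp using int by (subst integral_inner_left) auto
  also have "\<dots> = (\<integral>s. indicator {0..T} s *\<^sub>R (((real N / T) * indicator ?A s) *\<^sub>R axis a (axis b 1) \<bullet> bracket \<beta> (V s \<omega>)) \<partial>lborel)"
    unfolding integral_mult_right_zero[symmetric]
    by (intro Bochner_Integration.integral_cong) (auto simp: zero_ext_def inner_commute indicator_def)
  finally show ?thesis by (simp add: integral_restrict_space)
qed

section \<open>Convergence of the integrals\<close>

lemma L2sq_vec:
  fixes f :: "'a \<Rightarrow> real ^ 'm"
  assumes "f \<in> borel_measurable M"
  shows "L2sq M f = (\<Sum>a\<in>UNIV. L2sq M (\<lambda>x. f x $ a))"
proof -
  have "L2sq M f = (\<integral>\<^sup>+x. (\<Sum>a\<in>UNIV. ennreal ((norm (f x $ a))\<^sup>2)) \<partial>M)"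
    unfolding L2sq_def power2_norm_vec[of "f _"] by (subst sum_ennreal) auto
  also have "\<dots> = (\<Sum>a\<in>UNIV. L2sq M (\<lambda>x. f x $ a))"
    unfolding L2sq_def using assms by (intro nn_integral_sum) measurable
  finally show ?thesis .
qed

locale weakly_convergent_integrands = prob_space M for M :: "'w measure" +
  fixes T p :: real
    and Fn :: "nat \<Rightarrow> real \<Rightarrow> 'w measure" and F :: "real \<Rightarrow> 'w measure"
    and Wn :: "nat \<Rightarrow> real \<Rightarrow> 'w \<Rightarrow> real ^ 'k" and W :: "real \<Rightarrow> 'w \<Rightarrow> real ^ 'k"
    and Vn :: "nat \<Rightarrow> real \<Rightarrow> 'w \<Rightarrow> 'x::{real_inner, banach, second_countable_topology} ^ 'k ^ 'm"
    and V :: "real \<Rightarrow> 'w \<Rightarrow> 'x ^ 'k ^ 'm"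
    and \<beta> :: "'x \<Rightarrow>\<^sub>L real"
  assumes T: "T > 0"
    and filtrations: "\<And>n. filtration_on M T (Fn n)" "filtration_on M T F"
    and wieners: "\<And>n. wiener_process M T (Fn n) (Wn n)" "wiener_process M T F W"
    and p: "p > 2"
    and predictable: "\<And>n. predictable_process M T (Fn n) (Vn n)" "predictable_process M T F V"
    and weak: "AE \<omega> in M. Lp_weak_convergence (time_measure T) p (\<lambda>n t. Vn n t \<omega>) (\<lambda>t. V t \<omega>)"
    and bound: "(SUP n. \<integral>\<^sup>+\<omega>. ennreal (Lp_norm (time_measure T) p (\<lambda>t. Vn n t \<omega>) powr p) \<partial>M) < \<infinity>"
    and uniform: "AE \<omega> in M. uniform_limit {0..T} (\<lambda>n t. Wn n t \<omega>) (\<lambda>t. W t \<omega>) sequentially"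
    and small_translations: "\<And>\<epsilon>. \<epsilon> > 0 \<Longrightarrow> \<forall>\<^sub>F h in at_right 0. \<forall>n.
           (\<integral>\<^sup>+\<omega>. (\<integral>\<^sup>+t\<in>{h..T}. (ennreal (norm (bracket \<beta> (Vn n t \<omega>) - bracket \<beta> (Vn n (t - h) \<omega>))))
              \<partial>lborel) \<partial>M) < ennreal \<epsilon>"
begin

abbreviation "Gn n \<equiv> \<lambda>s \<omega>. bracket \<beta> (Vn n s \<omega>)"
abbreviation "G \<equiv> \<lambda>s \<omega>. bracket \<beta> (V s \<omega>)"

abbreviation "Gn_moment n \<equiv> \<integral>\<^sup>+\<omega>. (\<integral>\<^sup>+s. ennreal (norm (zero_ext T (Gn n) s \<omega>) powr p) \<partial>lborel) \<partial>M"
abbreviation "Vn_norm n \<omega> \<equiv> Lp_norm (time_measure T) p (\<lambda>t. Vn n t \<omega>)"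

sublocale N: wiener_space M T "Fn n" "Wn n" for n
  by unfold_locales (rule filtrations wieners)+

sublocale L: wiener_space M T F W
  by unfold_locales (rule filtrations wieners)+

abbreviation "avg_n N n \<equiv> cell_average T N (Gn n)"
abbreviation "avg N \<equiv> cell_average T N G"
abbreviation "error_n N n \<equiv> \<lambda>(s, \<omega>). Gn n s \<omega> - elementary_process (averaged T N (Gn n)) s \<omega>"
abbreviation "error N \<equiv> \<lambda>(s, \<omega>). G s \<omega> - elementary_process (averaged T N G) s \<omega>"

lemma predictable_G: "predictable_process M T (Fn n) (Gn n)" "predictable_process M T F G"
  by (intro predictable_bracket predictable)+

lemma Gn_zero_ext_measurable [measurable (raw)]:
  "f \<in> borel_measurable K \<Longrightarrow> g \<in> K \<rightarrow>\<^sub>M M \<Longrightarrow> (\<lambda>x. zero_ext T (Gn n) (f x) (g x)) \<in> borel_measurable K"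
  by (rule N.zero_ext_measurable[OF N.predictable_joint[OF predictable_G(1) T] less_imp_le[OF T]])

lemma moment_bound: "\<exists>C\<ge>0. \<forall>n. (\<integral>\<^sup>+\<omega>. ennreal (Vn_norm n \<omega> powr p) \<partial>M) \<le> ennreal C"
proof -
  let ?S = "SUP n. \<integral>\<^sup>+\<omega>. ennreal (Vn_norm n \<omega> powr p) \<partial>M"
  have S: "ennreal (enn2real ?S) = ?S" using bound by (intro ennreal_enn2real) simp
  show ?thesis
  proof (intro exI[of _ "enn2real ?S"] conjI allI)
    fix n
    show "(\<integral>\<^sup>+\<omega>. ennreal (Vn_norm n \<omega> powr p) \<partial>M) \<le> ennreal (enn2real ?S)"
      unfolding S by (rule SUP_upper) simp
  qed simp
qed

lemma Lp_norm_measurable: "(\<lambda>\<omega>. Vn_norm n \<omega>) \<in> borel_measurable M"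
proof -
  have "(\<lambda>(s, \<omega>). Vn n s \<omega>) \<in> borel_measurable (time_space T)"
    by (rule N.predictable_joint[OF predictable(1) T])
  from measurable_compose[OF measurable_pair_swap' this]
  have m: "(\<lambda>x. Vn n (snd x) (fst x)) \<in> borel_measurable (M \<Otimes>\<^sub>M time_measure T)"
    by (simp add: split_beta)
  have "(\<lambda>(\<omega>, s). norm (Vn n s \<omega>) powr p) \<in> borel_measurable (M \<Otimes>\<^sub>M time_measure T)"
    unfolding split_beta using measurable_compose[OF m borel_measurable_norm] by measurable
  from sigma_finite_measure.borel_measurable_lebesgue_integral[OF sigma_finite_time_measure this]
  show ?thesis unfolding Lp_norm_def by measurable
qed

text \<open>Guards against default values: \<open>Lp_norm\<close> is built on the Bochner integral
  and would be 0 for a path whose p-th power is not integrable.\<close>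

lemma AE_Lp: "AE \<omega> in M. (\<forall>n. (\<lambda>t. Vn n t \<omega>) \<in> Lp (time_measure T) p) \<and> (\<lambda>t. V t \<omega>) \<in> Lp (time_measure T) p"
  using weak by eventually_elim (auto simp: Lp_weak_convergence_def)

lemma Gn_powr_bound: "\<exists>C\<ge>0. \<forall>n. Gn_moment n \<le> ennreal C"
proof -
  obtain C where C: "C \<ge> 0" "\<And>n. (\<integral>\<^sup>+\<omega>. ennreal (Vn_norm n \<omega> powr p) \<partial>M) \<le> ennreal C"
    using moment_bound by blast
  show ?thesis
  proof (intro exI[of _ "norm \<beta> powr p * C"] conjI allI)
    fix n
    have "Gn_moment n \<le>
        (\<integral>\<^sup>+\<omega>. ennreal (norm \<beta> powr p) * ennreal (Vn_norm n \<omega> powr p) \<partial>M)"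
    proof (intro nn_integral_mono_AE)
      show "AE \<omega> in M. (\<integral>\<^sup>+s. ennreal (norm (zero_ext T (Gn n) s \<omega>) powr p) \<partial>lborel) \<le>
          ennreal (norm \<beta> powr p) * ennreal (Vn_norm n \<omega> powr p)"
        using AE_Lp
      proof eventually_elim
        case (elim \<omega>)
        then have "(\<lambda>t. Vn n t \<omega>) \<in> Lp (time_measure T) p" by blast
        from bracket_nn_integral_powr_le[OF this, of \<beta>] p
        show ?case unfolding zero_ext_def by simp
      qed
    qed
    also have "\<dots> = ennreal (norm \<beta> powr p) * (\<integral>\<^sup>+\<omega>. ennreal (Vn_norm n \<omega> powr p) \<partial>M)"
      using Lp_norm_measurable[of n] by (intro nn_integral_cmult) measurable
    also have "\<dots> \<le> ennreal (norm \<beta> powr p) * ennreal C"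
      by (intro mult_left_mono C) simp
    also have "\<dots> = ennreal (norm \<beta> powr p * C)"
      using C by (simp add: ennreal_mult)
    finally show "Gn_moment n \<le> ennreal (norm \<beta> powr p * C)" .
  qed (use C in simp)
qed

text \<open>K and h depend only on the uniform moment bound and on the uniform translation
  hypothesis, so \<open>h0\<close> serves every n. The three terms of the estimate get e / 3
  each.\<close>

lemma translation_modulus_small:
  assumes e: "e > 0"
  shows "\<exists>h0>0. \<forall>h n. 0 < h \<and> h < h0 \<longrightarrow> translation_modulus M T (Gn n) h \<le> ennreal e"
proof -
  obtain C where C: "C \<ge> 0" "\<And>n. Gn_moment n \<le> ennreal C"
    using Gn_powr_bound by blast
  obtain K where K: "K > 0" "2 powr p * (2 * C) * K powr (2 - p) < e / 3"
    using powr_neg_tendsto_0[of "2 - p" "e / 3" "2 powr p * (2 * C)"] p e by auto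
  \<comment> \<open>The mean translation will be multiplied by K, hence this tolerance.\<close>
  have "e / (3 * K) > 0" using e K by simp
  from small_translations[OF this]
  obtain b where b: "b > 0" and tr: "\<And>h n. 0 < h \<Longrightarrow> h < b \<Longrightarrow>
      (\<integral>\<^sup>+\<omega>. (\<integral>\<^sup>+t\<in>{h..T}. (ennreal (norm (Gn n t \<omega> - Gn n (t - h) \<omega>))) \<partial>lborel) \<partial>M) < ennreal (e / (3 * K))"
    unfolding eventually_at_right_field by blast
  show ?thesis
  proof (intro exI[of _ "min b (e / (3 * K\<^sup>2))"] conjI allI impI)
    show "0 < min b (e / (3 * K\<^sup>2))" using b e K by simp
    fix h n assume h: "0 < h \<and> h < min b (e / (3 * K\<^sup>2))"
    then have Kh: "K\<^sup>2 * h \<le> e / 3" using K by (simp add: field_simps)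
    have "translation_modulus M T (Gn n) h \<le>
      ennreal K * (\<integral>\<^sup>+\<omega>. (\<integral>\<^sup>+t\<in>{h..T}. ennreal (norm (Gn n t \<omega> - Gn n (t - h) \<omega>)) \<partial>lborel) \<partial>M) +
      ennreal (K\<^sup>2 * h) + ennreal (K powr (2 - p) * 2 powr p * (2 * C))"
      using h by (intro N.translation_modulus_le[OF predictable_G(1) T p K(1) _ C(2) C(1)]) simp
    also have "\<dots> \<le> ennreal K * ennreal (e / (3 * K)) + ennreal (e / 3) + ennreal (e / 3)"
    proof (intro add_mono mult_left_mono ennreal_leI Kh)
      show "(\<integral>\<^sup>+\<omega>. (\<integral>\<^sup>+t\<in>{h..T}. ennreal (norm (Gn n t \<omega> - Gn n (t - h) \<omega>)) \<partial>lborel) \<partial>M) \<le> ennreal (e / (3 * K))"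
        using h by (intro less_imp_le[OF tr]) auto
      show "K powr (2 - p) * 2 powr p * (2 * C) \<le> e / 3"
        using K(2) by (simp add: mult_ac)
    qed simp
    also have "\<dots> = ennreal e"
    proof -
      have e3: "0 \<le> e / 3" using e by simp
      have "ennreal K * ennreal (e / (3 * K)) = ennreal (e / 3)"
        using K(1) e by (subst ennreal_mult[symmetric]) auto
      moreover have "ennreal (e / 3) + ennreal (e / 3) + ennreal (e / 3) = ennreal (e / 3 + e / 3 + e / 3)"
        by (simp only: ennreal_plus[OF add_nonneg_nonneg[OF e3 e3] e3] ennreal_plus[OF e3 e3])
      ultimately show ?thesis by simp
    qed
    finally show "translation_modulus M T (Gn n) h \<le> ennreal e" .
  qed
qed

lemma translation_modulus_limit_le:
  assumes "\<And>n. translation_modulus M T (Gn n) h \<le> c"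
  shows "translation_modulus M T G h \<le> c"
  unfolding translation_modulus_def
proof (rule nn_integral_Fatou_le)
  show "(\<integral>\<^sup>+\<omega>. (\<integral>\<^sup>+s. ennreal ((norm (zero_ext T (Gn n) s \<omega> - zero_ext T (Gn n) (s - h) \<omega>))\<^sup>2) * indicator {0..T} s \<partial>lborel) \<partial>M) \<le> c" for n
    using assms[of n] by (simp add: translation_modulus_def)
  show "(\<lambda>\<omega>. \<integral>\<^sup>+s. ennreal ((norm (zero_ext T (Gn n) s \<omega> - zero_ext T (Gn n) (s - h) \<omega>))\<^sup>2) * indicator {0..T} s \<partial>lborel) \<in> borel_measurable M" for n
    by measurable
  show "AE \<omega> in M. (\<integral>\<^sup>+s. ennreal ((norm (zero_ext T G s \<omega> - zero_ext T G (s - h) \<omega>))\<^sup>2) * indicator {0..T} s \<partial>lborel) \<le>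
      liminf (\<lambda>n. \<integral>\<^sup>+s. ennreal ((norm (zero_ext T (Gn n) s \<omega> - zero_ext T (Gn n) (s - h) \<omega>))\<^sup>2) * indicator {0..T} s \<partial>lborel)"
    using weak
  proof eventually_elim
    case (elim \<omega>)
    from translation_difference_lsc[OF p this, of \<beta> h]
    show ?case by (simp only: zero_ext_def)
  qed
qed

lemma G_square_integrable:
  shows "L2sq (time_space T) (\<lambda>(s, \<omega>). Gn n s \<omega>) < \<infinity>"
    and "L2sq (time_space T) (\<lambda>(s, \<omega>). G s \<omega>) < \<infinity>"
proof -
  obtain C where C: "C \<ge> 0" "\<And>n. Gn_moment n \<le> ennreal C"
    using Gn_powr_bound by blast
  let ?B = "ennreal (1\<^sup>2 * (T + 1)) + ennreal (1 powr (2 - p) * 2 powr p * (2 * C))"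
  have le: "translation_modulus M T (Gn n) (T + 1) \<le> ?B" for n
    using N.translation_modulus_le[OF predictable_G(1)[of n] T p _ _ C(2) C(1), where K=1 and h="T + 1"] T by simp
  have fin: "?B < \<infinity>" by simp
  show "L2sq (time_space T) (\<lambda>(s, \<omega>). Gn n s \<omega>) < \<infinity>"
    unfolding N.L2sq_eq_translation_modulus[OF predictable_G(1) T] using le fin by (rule le_less_trans)
  show "L2sq (time_space T) (\<lambda>(s, \<omega>). G s \<omega>) < \<infinity>"
    unfolding L.L2sq_eq_translation_modulus[OF predictable_G(2) T]
    using translation_modulus_limit_le[OF le] fin by (rule le_less_trans)
qed

lemma uniform_averaged_approximation:
  assumes e: "e > 0"
  shows "\<exists>N>0. (\<forall>n. L2sq (time_space T) (error_n N n) \<le> ennreal e) \<and>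
    L2sq (time_space T) (error N) \<le> ennreal e"
proof -
  have e2: "e / 2 > 0" using e by simp
  obtain h0 where h0: "h0 > 0" "\<And>h n. 0 < h \<Longrightarrow> h < h0 \<Longrightarrow> translation_modulus M T (Gn n) h \<le> ennreal (e / 2)"
    using translation_modulus_small[OF e2] by blast
  obtain N where N: "2 * T / h0 < real N" using reals_Archimedean2 by blast
  moreover have "0 < 2 * T / h0" using T h0 by simp
  ultimately have N0: "0 < N" by (cases N) auto
  have le: "2 * (T / N) < h0" using N N0 h0(1) by (simp add: field_simps)
  have lim: "translation_modulus M T G h \<le> ennreal (e / 2)" if "0 < h" "h < h0" for h
    using h0(2)[OF that] by (rule translation_modulus_limit_le)
  show ?thesis
  proof (intro exI[of _ N] conjI allI N0)
    show "L2sq (time_space T) (error_n N n) \<le> ennreal e" for n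
      using N.averaged_error_le[OF predictable_G(1) T G_square_integrable(1)[of n] N0, where c="e / 2"] h0(2) le e by simp
    show "L2sq (time_space T) (error N) \<le> ennreal e"
      using L.averaged_error_le[OF predictable_G(2) T G_square_integrable(2) N0, where c="e / 2"] lim le e by simp
  qed
qed

lemma sq_elementary_averaged_G:
  assumes "0 < N"
  shows "N.sq_elementary n (averaged T N (Gn n))" "L.sq_elementary (averaged T N G)"
  using N.sq_elementary_averaged[OF predictable_G(1) T G_square_integrable(1) assms]
    L.sq_elementary_averaged[OF predictable_G(2) T G_square_integrable(2) assms] by blast+

lemma has_ito_integral_G:
  assumes t: "0 \<le> t" "t \<le> T"
  shows "has_ito_integral M T (Fn n) (Wn n) (Gn n) t (ito_integral M T (Fn n) (Wn n) (Gn n) t)"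
    and "has_ito_integral M T F W G t (ito_integral M T F W G t)"
proof -
  have "\<exists>I. has_ito_integral M T (Fn n) (Wn n) (Gn n) t I"
  proof (rule N.has_ito_integral_exists[OF predictable_G(1) N.predictable_joint[OF predictable_G(1) T] G_square_integrable(1) _ t])
    fix e :: real assume "e > 0"
    from uniform_averaged_approximation[OF this] sq_elementary_averaged_G(1)[of _ n]
    show "\<exists>S. N.sq_elementary n S \<and> L2sq (time_space T) (\<lambda>(s, \<omega>). Gn n s \<omega> - elementary_process S s \<omega>) \<le> ennreal e"
      by blast
  qed
  then show "has_ito_integral M T (Fn n) (Wn n) (Gn n) t (ito_integral M T (Fn n) (Wn n) (Gn n) t)"
    unfolding ito_integral_def by (rule someI_ex)
  have "\<exists>I. has_ito_integral M T F W G t I"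
  proof (rule L.has_ito_integral_exists[OF predictable_G(2) L.predictable_joint[OF predictable_G(2) T] G_square_integrable(2) _ t])
    fix e :: real assume "e > 0"
    from uniform_averaged_approximation[OF this] sq_elementary_averaged_G(2)
    show "\<exists>S. L.sq_elementary S \<and> L2sq (time_space T) (\<lambda>(s, \<omega>). G s \<omega> - elementary_process S s \<omega>) \<le> ennreal e"
      by blast
  qed
  then show "has_ito_integral M T F W G t (ito_integral M T F W G t)"
    unfolding ito_integral_def by (rule someI_ex)
qed

lemma cell_average_limit:
  assumes N: "0 < N"
  shows "AE \<omega> in M. (\<lambda>n. avg_n N n i \<omega> $ a $ b) \<longlonglongrightarrow> avg N i \<omega> $ a $ b"
    and "\<exists>C\<ge>0. \<forall>n. (\<integral>\<^sup>+\<omega>. ennreal (\<bar>avg_n N n i \<omega> $ a $ b\<bar> powr p) \<partial>M) \<le> ennreal C"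
proof -
  let ?\<mu> = "time_measure T"
  interpret \<mu>: finite_measure ?\<mu> by (rule finite_time_measure)
  let ?A = "(delayed_cell T N i)"
  define \<theta> :: "real \<Rightarrow> real ^ 'k ^ 'm" where "\<theta> s = ((real N / T) * indicator ?A s) *\<^sub>R axis a (axis b 1)" for s
  define \<Lambda> where "\<Lambda> f = (\<integral>s. \<theta> s \<bullet> bracket \<beta> (f s) \<partial>?\<mu>)" for f :: "real \<Rightarrow> 'x ^ 'k ^ 'm"
  have m\<theta>: "\<theta> \<in> borel_measurable ?\<mu>"
    unfolding \<theta>_def[abs_def] by (intro measurable_restrict_space1) measurable
  have "\<Lambda> \<in> Lp_dual ?\<mu> p"
    unfolding \<Lambda>_def[abs_def]
  proof (rule bracket_functional_dual[OF p m\<theta>])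
    show "integrable ?\<mu> (\<lambda>t. (norm (\<theta> t))\<^sup>2)"
    proof (rule \<mu>.integrable_const_bound[where B="(real N / T)\<^sup>2"])
      show "AE t in ?\<mu>. norm ((norm (\<theta> t))\<^sup>2) \<le> (real N / T)\<^sup>2"
        using T by (intro AE_I2) (simp add: \<theta>_def indicator_def)
      show "(\<lambda>t. (norm (\<theta> t))\<^sup>2) \<in> borel_measurable ?\<mu>"
        using m\<theta> by measurable
    qed
  qed
  then have lim: "\<And>v u. Lp_weak_convergence ?\<mu> p v u \<Longrightarrow> (\<lambda>n. \<Lambda> (v n)) \<longlonglongrightarrow> \<Lambda> u"
    and "\<exists>B. \<forall>f\<in>Lp ?\<mu> p. \<bar>\<Lambda> f\<bar> \<le> B * Lp_norm ?\<mu> p f"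
    by (auto simp: Lp_weak_convergence_def Lp_dual_def)
  then obtain B where B: "\<And>f. f \<in> Lp ?\<mu> p \<Longrightarrow> \<bar>\<Lambda> f\<bar> \<le> B * Lp_norm ?\<mu> p f" by blast
  have cn: "avg_n N n i \<omega> $ a $ b = \<Lambda> (\<lambda>t. Vn n t \<omega>)" if "(\<lambda>t. Vn n t \<omega>) \<in> Lp ?\<mu> p" for n \<omega>
    unfolding \<Lambda>_def \<theta>_def by (rule cell_average_component[where V="Vn n", OF that p])
  have c: "avg N i \<omega> $ a $ b = \<Lambda> (\<lambda>t. V t \<omega>)" if "(\<lambda>t. V t \<omega>) \<in> Lp ?\<mu> p" for \<omega>
    unfolding \<Lambda>_def \<theta>_def by (rule cell_average_component[where V=V, OF that p])
  show "AE \<omega> in M. (\<lambda>n. avg_n N n i \<omega> $ a $ b) \<longlonglongrightarrow> avg N i \<omega> $ a $ b"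
    using weak AE_Lp
  proof eventually_elim
    case (elim \<omega>)
    then show ?case using lim[OF elim(1)] cn c by simp
  qed
  obtain C where C: "C \<ge> 0" "\<And>n. (\<integral>\<^sup>+\<omega>. ennreal (Vn_norm n \<omega> powr p) \<partial>M) \<le> ennreal C"
    using moment_bound by blast
  show "\<exists>C\<ge>0. \<forall>n. (\<integral>\<^sup>+\<omega>. ennreal (\<bar>avg_n N n i \<omega> $ a $ b\<bar> powr p) \<partial>M) \<le> ennreal C"
  proof (intro exI[of _ "\<bar>B\<bar> powr p * C"] conjI allI)
    fix n
    have "(\<integral>\<^sup>+\<omega>. ennreal (\<bar>avg_n N n i \<omega> $ a $ b\<bar> powr p) \<partial>M) \<le>
      (\<integral>\<^sup>+\<omega>. ennreal (\<bar>B\<bar> powr p) * ennreal (Vn_norm n \<omega> powr p) \<partial>M)"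
    proof (intro nn_integral_mono_AE)
      show "AE \<omega> in M. ennreal (\<bar>avg_n N n i \<omega> $ a $ b\<bar> powr p) \<le>
          ennreal (\<bar>B\<bar> powr p) * ennreal (Vn_norm n \<omega> powr p)"
        using AE_Lp
      proof eventually_elim
        case (elim \<omega>)
        then have V: "(\<lambda>t. Vn n t \<omega>) \<in> Lp ?\<mu> p" by blast
        have nn: "0 \<le> Vn_norm n \<omega>" by (simp add: Lp_norm_def)
        have "\<bar>\<Lambda> (\<lambda>t. Vn n t \<omega>)\<bar> \<le> \<bar>B\<bar> * Vn_norm n \<omega>"
          using B[OF V] mult_right_mono[OF abs_ge_self[of B] nn] by linarith
        then have "\<bar>\<Lambda> (\<lambda>t. Vn n t \<omega>)\<bar> powr p \<le> (\<bar>B\<bar> * Vn_norm n \<omega>) powr p"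
          using p by (intro powr_mono2) auto
        also have "\<dots> = \<bar>B\<bar> powr p * Vn_norm n \<omega> powr p"
          using nn by (simp add: powr_mult)
        finally show ?case
          unfolding cn[OF V] by (simp add: ennreal_mult[symmetric] ennreal_leI)
      qed
    qed
    also have "\<dots> = ennreal (\<bar>B\<bar> powr p) * (\<integral>\<^sup>+\<omega>. ennreal (Vn_norm n \<omega> powr p) \<partial>M)"
      using Lp_norm_measurable[of n] by (intro nn_integral_cmult) measurable
    also have "\<dots> \<le> ennreal (\<bar>B\<bar> powr p) * ennreal C"
      by (intro mult_left_mono C) simp
    also have "\<dots> = ennreal (\<bar>B\<bar> powr p * C)"
      using C by (simp add: ennreal_mult)
    finally show "(\<integral>\<^sup>+\<omega>. ennreal (\<bar>avg_n N n i \<omega> $ a $ b\<bar> powr p) \<partial>M) \<le> ennreal (\<bar>B\<bar> powr p * C)" .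
  qed (use C in simp)
qed

lemma averaged_term_tendsto:
  assumes N: "0 < N" and i: "i < N" and t: "0 \<le> t" "t \<le> T"
  defines "lo \<equiv> min t (real i * (T / N))" and "hi \<equiv> min t (real (Suc i) * (T / N))"
  shows "(\<lambda>n. L2sq M (\<lambda>\<omega>. avg_n N n i \<omega> $ a $ b * (Wn n hi \<omega> - Wn n lo \<omega>) $ b -
     avg N i \<omega> $ a $ b * (W hi \<omega> - W lo \<omega>) $ b)) \<longlonglongrightarrow> 0"
proof -
  have \<tau>: "0 \<le> real i * (T / N)" "real i * (T / N) \<le> T" "0 \<le> real (Suc i) * (T / N)"
      "real i * (T / N) \<le> real (Suc i) * (T / N)"
    using T N i by (auto simp: field_simps)
  have lohi: "0 \<le> lo" "lo \<le> hi" "hi \<le> T" "hi \<in> {0..T}" "lo \<in> {0..T}" "lo \<le> T" "0 \<le> hi"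
    using t \<tau> by (auto simp: lo_def hi_def)
  note mc = N.cell_average_measurable[OF predictable_G(1) T i] L.cell_average_measurable[OF predictable_G(2) T i]
  note mcM = N.measurable_F_M[OF mc(1) \<tau>(1,2)] L.measurable_F_M[OF mc(2) \<tau>(1,2)]
  note mW = N.W_measurable[OF lohi(1,6)] N.W_measurable[OF lohi(7,3)] L.W_measurable[OF lohi(1,6)] L.W_measurable[OF lohi(7,3)]
  obtain C where C: "C \<ge> 0" "\<And>n. (\<integral>\<^sup>+\<omega>. ennreal (\<bar>avg_n N n i \<omega> $ a $ b\<bar> powr p) \<partial>M) \<le> ennreal C"
    using cell_average_limit(2)[OF N, of i a b] by blast
  obtain q where q: "p \<le> real (2 * q)"
    using real_arch_simple[of p] by (metis mult_2 of_nat_add le_add2 of_nat_le_iff order_trans)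
  show ?thesis
  proof (rule L2sq_tendsto_0_if_powr_bounded[OF _ _ _ p])
    show "(\<lambda>\<omega>. avg_n N n i \<omega> $ a $ b * (Wn n hi \<omega> - Wn n lo \<omega>) $ b) \<in> borel_measurable M" for n
      using mcM(1)[of n] mW(1)[of n] mW(2)[of n] by measurable
    show "(\<lambda>\<omega>. avg N i \<omega> $ a $ b * (W hi \<omega> - W lo \<omega>) $ b) \<in> borel_measurable M"
      using mcM(2) mW(3,4) by measurable
    show "AE \<omega> in M. (\<lambda>n. avg_n N n i \<omega> $ a $ b * (Wn n hi \<omega> - Wn n lo \<omega>) $ b) \<longlonglongrightarrow>
        avg N i \<omega> $ a $ b * (W hi \<omega> - W lo \<omega>) $ b"
      using cell_average_limit(1)[OF N, of i a b] uniform
    proof eventually_elim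
      case (elim \<omega>)
      show ?case
        by (intro tendsto_mult elim(1) tendsto_vec_nth tendsto_diff tendsto_uniform_limitI[OF elim(2)] lohi)
    qed
    show "(\<integral>\<^sup>+\<omega>. ennreal (\<bar>avg_n N n i \<omega> $ a $ b * (Wn n hi \<omega> - Wn n lo \<omega>) $ b\<bar> powr p) \<partial>M) \<le>
       ennreal (C * (1 + gauss_moment (sqrt (hi - lo)) (2 * q)))" for n
    proof (cases "lo < hi")
      case True
      then have lo: "lo = real i * (T / N)"
        by (auto simp: lo_def hi_def min_def split: if_splits)
      have "(\<lambda>\<omega>. avg_n N n i \<omega> $ a $ b) \<in> borel_measurable (Fn n lo)"
        using mc(1)[of n] unfolding lo by measurable
      then show ?thesis
        using True lohi p q by (intro N.times_increment_powr_bound C) auto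
    next
      case False
      then have "hi = lo" using lohi by simp
      then show ?thesis using p by simp
    qed
  qed
qed

lemma averaged_integral_tendsto:
  assumes N: "0 < N" and t: "0 \<le> t" "t \<le> T"
  shows "(\<lambda>n. L2sq M (\<lambda>\<omega>. elementary_integral (Wn n) (averaged T N (Gn n)) t \<omega> -
     elementary_integral W (averaged T N G) t \<omega>)) \<longlonglongrightarrow> 0"
proof -
  let ?lo = "\<lambda>i. min t (real i * (T / N))" and ?hi = "\<lambda>i. min t (real (Suc i) * (T / N))"
  define X where "X n a \<kappa> \<omega> = avg_n N n (fst \<kappa>) \<omega> $ a $ snd \<kappa> * (Wn n (?hi (fst \<kappa>)) \<omega> - Wn n (?lo (fst \<kappa>)) \<omega>) $ snd \<kappa> -
     avg N (fst \<kappa>) \<omega> $ a $ snd \<kappa> * (W (?hi (fst \<kappa>)) \<omega> - W (?lo (fst \<kappa>)) \<omega>) $ snd \<kappa>" for n a \<kappa> \<omega>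
  let ?A = "{..<N} \<times> (UNIV :: 'k set)"
  let ?d = "\<lambda>n \<omega>. elementary_integral (Wn n) (averaged T N (Gn n)) t \<omega> - elementary_integral W (averaged T N G) t \<omega>"
  have comp: "?d n \<omega> $ a = (\<Sum>\<kappa>\<in>?A. X n a \<kappa> \<omega>)" for n \<omega> a
    by (simp add: averaged_def sum_component matrix_vector_mult_def sum.cartesian_product' X_def sum_subtractf)
  have md: "?d n \<in> borel_measurable M" for n
    using N.elementary_integral_measurable[OF sq_elementary_averaged_G(1)[OF N] t]
      L.elementary_integral_measurable[OF sq_elementary_averaged_G(2)[OF N] t] by measurable
  have mX: "X n a \<kappa> \<in> borel_measurable M" if "\<kappa> \<in> ?A" for n a \<kappa>
  proof -
    have i: "fst \<kappa> < N" using that by auto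
    have \<tau>: "0 \<le> real (fst \<kappa>) * (T / N)" "real (fst \<kappa>) * (T / N) \<le> T" "0 \<le> real (Suc (fst \<kappa>)) * (T / N)"
      using T N i by (auto simp: field_simps)
    have lohi: "0 \<le> ?lo (fst \<kappa>)" "?lo (fst \<kappa>) \<le> T" "0 \<le> ?hi (fst \<kappa>)" "?hi (fst \<kappa>) \<le> T"
      using t \<tau> by auto
    have "avg_n N n (fst \<kappa>) \<in> borel_measurable M" "avg N (fst \<kappa>) \<in> borel_measurable M"
      using N.measurable_F_M[OF N.cell_average_measurable[OF predictable_G(1) T i] \<tau>(1,2)]
        L.measurable_F_M[OF L.cell_average_measurable[OF predictable_G(2) T i] \<tau>(1,2)] by auto
    moreover note N.W_measurable[OF lohi(1,2), of n] N.W_measurable[OF lohi(3,4), of n] L.W_measurable[OF lohi(1,2)] L.W_measurable[OF lohi(3,4)]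
    ultimately show ?thesis unfolding X_def[abs_def] by measurable
  qed
  show ?thesis
  proof (rule ennreal_tendsto_0_le)
    show "L2sq M (?d n) \<le> (\<Sum>a\<in>UNIV. of_nat (card ?A) * (\<Sum>\<kappa>\<in>?A. L2sq M (X n a \<kappa>)))" for n
      unfolding L2sq_vec[OF md] comp using mX by (intro sum_mono L2sq_sum_le) auto
    have "(\<lambda>n. L2sq M (X n a \<kappa>)) \<longlonglongrightarrow> 0" if "\<kappa> \<in> ?A" for a \<kappa>
      unfolding X_def[abs_def] using that by (intro averaged_term_tendsto N t) auto
    then have "(\<lambda>n. \<Sum>a\<in>UNIV. of_nat (card ?A) * (\<Sum>\<kappa>\<in>?A. L2sq M (X n a \<kappa>))) \<longlonglongrightarrow> (\<Sum>a\<in>(UNIV::'m set). of_nat (card ?A) * (\<Sum>\<kappa>\<in>?A. 0))"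
      by (intro tendsto_sum ennreal_tendsto_cmult) (simp_all add: ennreal_of_nat_eq_real_of_nat)
    then show "(\<lambda>n. \<Sum>a\<in>UNIV. of_nat (card ?A) * (\<Sum>\<kappa>\<in>?A. L2sq M (X n a \<kappa>))) \<longlonglongrightarrow> 0"
      by simp
  qed
qed

lemma ito_integral_tendsto:
  assumes t: "0 \<le> t" "t \<le> T"
  shows "Lp_strong_convergence M 2 (\<lambda>n. ito_integral M T (Fn n) (Wn n) (Gn n) t) (ito_integral M T F W G t)"
proof -
  define In where "In n = ito_integral M T (Fn n) (Wn n) (Gn n) t" for n
  define I where "I = ito_integral M T F W G t"
  note In = has_ito_integral_G(1)[OF t, folded In_def] and I = has_ito_integral_G(2)[OF t, folded I_def]
  have mIn: "In n \<in> borel_measurable M \<and> L2sq M (In n) < \<infinity>" for n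
    using In[of n] unfolding has_ito_integral_def Lp_strong_convergence_2_iff by blast
  have mI: "I \<in> borel_measurable M \<and> L2sq M I < \<infinity>"
    using I unfolding has_ito_integral_def Lp_strong_convergence_2_iff by blast
  have "(\<lambda>n. L2sq M (\<lambda>\<omega>. In n \<omega> - I \<omega>)) \<longlonglongrightarrow> 0"
  proof (rule tendsto_zero_ennreal)
    fix e :: real assume e: "0 < e"
    define d where "d = e / 64"
    have d: "d > 0" using e by (simp add: d_def)
    obtain N where N: "N > 0"
      and An: "\<And>n. L2sq (time_space T) (error_n N n) \<le> ennreal d"
      and A: "L2sq (time_space T) (error N) \<le> ennreal d"
      using uniform_averaged_approximation[OF d] by blast
    note S = sq_elementary_averaged_G[OF N]
    let ?Jn = "\<lambda>n. elementary_integral (Wn n) (averaged T N (Gn n)) t" and ?J = "elementary_integral W (averaged T N G) t"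
    have mJn: "?Jn n \<in> borel_measurable M" for n by (rule N.elementary_integral_measurable[OF S(1) t])
    have mJ: "?J \<in> borel_measurable M" by (rule L.elementary_integral_measurable[OF S(2) t])
    have Bn: "L2sq M (\<lambda>\<omega>. In n \<omega> - ?Jn n \<omega>) \<le> 4 * ennreal d" for n
    proof -
      have "(error_n N n) \<in> borel_measurable (time_space T)"
        using borel_measurable_diff[OF N.predictable_joint[OF predictable_G(1)[of n] T] N.elementary_process_measurable[OF S(1)[of n]]]
        by (simp add: case_prod_beta')
      from order_trans[OF L2sq_time_pair_mono[OF this t(2)] An]
      show ?thesis by (intro order_trans[OF N.has_ito_integral_bound[OF In S(1) t]] mult_left_mono) auto
    qed
    have B: "L2sq M (\<lambda>\<omega>. ?J \<omega> - I \<omega>) \<le> 4 * ennreal d"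
    proof -
      have "(error N) \<in> borel_measurable (time_space T)"
        using borel_measurable_diff[OF L.predictable_joint[OF predictable_G(2) T] L.elementary_process_measurable[OF S(2)]]
        by (simp add: case_prod_beta')
      from order_trans[OF L2sq_time_pair_mono[OF this t(2)] A]
      have "L2sq M (\<lambda>\<omega>. I \<omega> - ?J \<omega>) \<le> 4 * ennreal d"
        by (intro order_trans[OF L.has_ito_integral_bound[OF I S(2) t]] mult_left_mono) auto
      then show ?thesis by (subst L2sq_minus_commute)
    qed
    have "\<forall>\<^sub>F n in sequentially. L2sq M (\<lambda>\<omega>. ?Jn n \<omega> - ?J \<omega>) < ennreal d"
      using averaged_integral_tendsto[OF N t] d by (intro order_tendstoD) auto
    then show "\<forall>\<^sub>F n in sequentially. L2sq M (\<lambda>\<omega>. In n \<omega> - I \<omega>) < ennreal e"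
    proof eventually_elim
      case (elim n)
      have "L2sq M (\<lambda>\<omega>. In n \<omega> - I \<omega>) \<le> 2 * L2sq M (\<lambda>\<omega>. In n \<omega> - ?Jn n \<omega>) + 2 * L2sq M (\<lambda>\<omega>. ?Jn n \<omega> - I \<omega>)"
        using mIn mI mJn by (intro L2sq_diff_le) auto
      also have "\<dots> \<le> 2 * (4 * ennreal d) + 2 * (2 * ennreal d + 2 * (4 * ennreal d))"
      proof (intro add_mono mult_left_mono Bn)
        have "L2sq M (\<lambda>\<omega>. ?Jn n \<omega> - I \<omega>) \<le> 2 * L2sq M (\<lambda>\<omega>. ?Jn n \<omega> - ?J \<omega>) + 2 * L2sq M (\<lambda>\<omega>. ?J \<omega> - I \<omega>)"
          using mI mJn mJ by (intro L2sq_diff_le) auto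
        also have "\<dots> \<le> 2 * ennreal d + 2 * (4 * ennreal d)"
          by (intro add_mono mult_left_mono less_imp_le[OF elim] B) auto
        finally show "L2sq M (\<lambda>\<omega>. ?Jn n \<omega> - I \<omega>) \<le> 2 * ennreal d + 2 * (4 * ennreal d)" .
      qed auto
      also have "\<dots> = ennreal (2 * (4 * d) + 2 * (2 * d + 2 * (4 * d)))"
        using d by (simp only: ennreal_plus ennreal_mult' ennreal_numeral mult_nonneg_nonneg add_nonneg_nonneg less_imp_le zero_le_numeral)
      also have "\<dots> < ennreal e"
        using e by (intro ennreal_lessI) (auto simp: d_def)
      finally show ?case .
    qed
  qed
  then show ?thesis
    using mIn mI unfolding Lp_strong_convergence_2_iff In_def[symmetric] I_def[symmetric] by blast
qed

end

theorem corollary4p2: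
  fixes M :: "'w measure"
    and T p :: real
    and Fn :: "nat \<Rightarrow> real \<Rightarrow> 'w measure" and F :: "real \<Rightarrow> 'w measure"
    and Wn :: "nat \<Rightarrow> real \<Rightarrow> 'w \<Rightarrow> real ^ 'k" and W :: "real \<Rightarrow> 'w \<Rightarrow> real ^ 'k"
    and Vn :: "nat \<Rightarrow> real \<Rightarrow> 'w \<Rightarrow>
      'x::{real_inner, banach, second_countable_topology} ^ 'k ^ 'm"
    and V :: "real \<Rightarrow> 'w \<Rightarrow> 'x ^ 'k ^ 'm"
    and \<beta> :: "'x \<Rightarrow>\<^sub>L real"
  assumes "prob_space M"
    and "T > 0"
    and "\<And>n. filtration_on M T (Fn n)"
    and "filtration_on M T F"
    and "\<And>n. wiener_process M T (Fn n) (Wn n)"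
    and "wiener_process M T F W"
    and "p > 2"
    and "\<And>n. predictable_process M T (Fn n) (Vn n)"
    and "predictable_process M T F V"
    and "AE \<omega> in M. Lp_weak_convergence (time_measure T) p (\<lambda>n t. Vn n t \<omega>) (\<lambda>t. V t \<omega>)"
    and "(SUP n. \<integral>\<^sup>+\<omega>. ennreal (Lp_norm (time_measure T) p (\<lambda>t. Vn n t \<omega>) powr p) \<partial>M) < \<infinity>"
    and "AE \<omega> in M. uniform_limit {0..T} (\<lambda>n t. Wn n t \<omega>) (\<lambda>t. W t \<omega>) sequentially"
    and "\<And>\<epsilon>. \<epsilon> > 0 \<Longrightarrow> \<forall>\<^sub>F h in at_right 0. \<forall>n.
           (\<integral>\<^sup>+\<omega>. (\<integral>\<^sup>+t\<in>{h..T}. (ennreal (norm (bracket \<beta> (Vn n t \<omega>) - bracket \<beta> (Vn n (t - h) \<omega>))))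
              \<partial>lborel) \<partial>M) < ennreal \<epsilon>"
  shows "\<forall>t\<in>{0..T}. Lp_strong_convergence M 2
           (\<lambda>n. ito_integral M T (Fn n) (Wn n) (\<lambda>s \<omega>. bracket \<beta> (Vn n s \<omega>)) t)
           (ito_integral M T F W (\<lambda>s \<omega>. bracket \<beta> (V s \<omega>)) t)"
proof -
  interpret weakly_convergent_integrands M T p Fn F Wn W Vn V \<beta>
    using assms by (simp add: weakly_convergent_integrands_def weakly_convergent_integrands_axioms_def)
  show ?thesis
    using ito_integral_tendsto by simp
qed

end
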